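(* For every $\varepsilon$ with $0<\varepsilon<\frac12$ and every $\nu$ with $-1<\nu<1$ there exists a semi-infinite complex Jacobi matrix $J\in\mathcal{P}(\frac12-\varepsilon)$ such that its discrete spectrum $\sigma_d(J)$ is infinite and, moreover, $E_J=\{\nu\}$, i.e. $\nu$ is the unique accumulation point of $\sigma_d(J)$.
   Context: A semi-infinite complex Jacobi matrix is a tridiagonal matrix $J$ with rows and columns indexed by $\mathbb{Z}_+=\{0,1,2,\dots\}$, with diagonal entries $J_{n,n}=b_n$, superdiagonal entries $J_{n,n+1}=c_n$, subdiagonal entries $J_{n+1,n}=a_n$ ($n\ge 0$), where $a_n,b_n,c_n\in\mathbb{C}$, and all other entries zero. For $0<\beta<1$, $J\in\mathcal{P}(\beta)$ means that there are constants $C_1,C_2>0$ with $|a_n-\frac12|+|c_n-\frac12|+|b_n|\le C_1\exp(-C_2 n^\beta)$ for all $n\geq 0$. Such a $J$ defines a bounded operator on $\ell^2(\mathbb{Z}_+)$ that is a compact perturbation of the discrete Laplacian $J_0$ ($a_n=c_n=\frac12$, $b_n=0$). By Weyl's theorem its spectrum is $\sigma(J)=[-1,1]\cup\sigma_d(J)$, where the discrete spectrum $\sigma_d(J)=\sigma(J)\setminus[-1,1]$ is an at most countable set of eigenvalues of finite algebraic multiplicity, whose accumulation points can lie only in $[-1,1]$. $E_J:=\{\sigma_d(J)\}'$ denotes the set of accumulation points of $\sigma_d(J)$ in $\mathbb{C}$. *)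

theory Defs
  imports "HOL-Analysis.Analysis"
begin

definition ell2 :: "(nat \<Rightarrow> complex) set" where
  "ell2 = {u. summable (\<lambda>n. (cmod (u n))\<^sup>2)}"

definition ell2_norm :: "(nat \<Rightarrow> complex) \<Rightarrow> real" where
  "ell2_norm u = sqrt (\<Sum>n. (cmod (u n))\<^sup>2)"

text \<open>Operators on \<open>ell2\<close> are functions on all sequences of which only the values on
  \<open>ell2\<close> matter.\<close>

definition bounded_ell2_op :: "((nat \<Rightarrow> complex) \<Rightarrow> (nat \<Rightarrow> complex)) \<Rightarrow> bool" where
  "bounded_ell2_op T \<longleftrightarrow>
     (\<forall>u\<in>ell2. T u \<in> ell2) \<and>
     (\<forall>u\<in>ell2. \<forall>v\<in>ell2. T (\<lambda>n. u n + v n) = (\<lambda>n. T u n + T v n)) \<and>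
     (\<forall>z. \<forall>u\<in>ell2. T (\<lambda>n. z * u n) = (\<lambda>n. z * T u n)) \<and>
     (\<exists>K. \<forall>u\<in>ell2. ell2_norm (T u) \<le> K * ell2_norm u)"

definition ell2_resolvent_set :: "((nat \<Rightarrow> complex) \<Rightarrow> (nat \<Rightarrow> complex)) \<Rightarrow> complex set" where
  "ell2_resolvent_set T =
     {z. \<exists>R. bounded_ell2_op R \<and>
           (\<forall>u\<in>ell2. R (\<lambda>n. T u n - z * u n) = u) \<and>
           (\<forall>u\<in>ell2. (\<lambda>n. T (R u) n - z * R u n) = u)}"

definition ell2_spectrum :: "((nat \<Rightarrow> complex) \<Rightarrow> (nat \<Rightarrow> complex)) \<Rightarrow> complex set" where
  "ell2_spectrum T = - ell2_resolvent_set T"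

definition jacobi_matrix ::
    "(nat \<Rightarrow> complex) \<Rightarrow> (nat \<Rightarrow> complex) \<Rightarrow> (nat \<Rightarrow> complex) \<Rightarrow> nat \<Rightarrow> nat \<Rightarrow> complex" where
  "jacobi_matrix a b c i j =
     (if j = i then b i else if j = Suc i then c i else if i = Suc j then a j else 0)"

text \<open>For a tridiagonal matrix each of these series has at most three nonzero terms.\<close>

definition matrix_op :: "(nat \<Rightarrow> nat \<Rightarrow> complex) \<Rightarrow> (nat \<Rightarrow> complex) \<Rightarrow> (nat \<Rightarrow> complex)" where
  "matrix_op J u = (\<lambda>i. \<Sum>j. J i j * u j)"

definition jacobi_class :: "real \<Rightarrow> (nat \<Rightarrow> nat \<Rightarrow> complex) set" where
  "jacobi_class \<beta> =
     {J. \<exists>a b c. J = jacobi_matrix a b c \<and>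
           (\<exists>C1>0. \<exists>C2>0. \<forall>n.
              cmod (a n - 1/2) + cmod (c n - 1/2) + cmod (b n) \<le> C1 * exp (- C2 * real n powr \<beta>))}"

text \<open>For \<open>J\<close> in \<open>jacobi_class \<beta>\<close> with \<open>\<beta> > 0\<close>, \<open>matrix_op J\<close> is a compact
  perturbation of the discrete Laplacian, so \<open>[-1, 1]\<close> is its essential spectrum.\<close>

definition discrete_spectrum :: "(nat \<Rightarrow> nat \<Rightarrow> complex) \<Rightarrow> complex set" where
  "discrete_spectrum J = ell2_spectrum (matrix_op J) - complex_of_real ` {-1..1}"

definition accumulation_set :: "(nat \<Rightarrow> nat \<Rightarrow> complex) \<Rightarrow> complex set" where
  "accumulation_set J = {z. z islimpt discrete_spectrum J}"

end

theory Submission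
  imports Defs "HOL-Complex_Analysis.Complex_Analysis" "HOL-Real_Asymp.Real_Asymp"
begin

text \<open>Write the spectral parameter as \<open>(z + 1/z)/2\<close> with \<open>|z| < 1\<close>. If \<open>u\<close> is the solution of the
  eigenvalue recursion that decays like \<open>z\<^sup>n\<close>, the ratios \<open>M\<^sub>n = u\<^sub>n\<^sub>-\<^sub>1 / u\<^sub>n = 1/z + h\<^sub>n(z)\<close> satisfy
  \<open>M\<^sub>n = z + 1/z - 2 b\<^sub>n - 2 c\<^sub>n / M\<^sub>n\<^sub>+\<^sub>1\<close> (with \<open>a\<^sub>n = 1/2\<close>). Read from left to right this is a map
  on power series: \<open>b\<^sub>n\<close> and \<open>c\<^sub>n\<close> are read off the first two coefficients of \<open>h\<^sub>n\<close>, and to first order \<open>h\<^sub>n\<^sub>+\<^sub>1\<close> is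
  \<open>h\<^sub>n\<close> shifted by two. Hence every small \<open>h\<^sub>1\<close> with coefficients of size \<open>exp (- \<theta> k\<^sup>\<beta>)\<close> comes
  from a matrix with the same decay; log-concavity of the weight makes the quadratic terms summable.

  One more row, with free \<open>b\<^sub>0\<close> and \<open>c\<^sub>0\<close>, makes the eigenvalues the zeros of
  \<open>(z\<^sup>2 + 1 - 2 b\<^sub>0 z) (1 + z h\<^sub>1) - 2 c\<^sub>0 z\<^sup>2\<close>. For \<open>h\<^sub>1 = 0\<close> and \<open>b\<^sub>0 = w\<close>, where \<open>|w| = 1\<close> and \<open>Re w = \<nu>\<close>, a suitable
  \<open>c\<^sub>0\<close> turns this into \<open>(1 - w z)\<^sup>2\<close>, and multiplication by the factor
  \<open>exp (- \<delta> E) cos (\<delta> t E)\<close>, \<open>E = (1 - w z)\<^sup>-\<^sup>\<alpha> - 1\<close>, produces infinitely many zeros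
  tending to \<open>1/w\<close>. For small \<open>\<delta>\<close> this is a small perturbation because of the double zero, and its
  coefficients are of size \<open>exp (- c k\<^sup>\<alpha>\<^sup>/\<^sup>(\<^sup>1\<^sup>+\<^sup>\<alpha>\<^sup>))\<close>, where the exponent is arbitrarily close to \<open>1/2\<close>.\<close>

section \<open>Square-summable sequences and geometric kernels\<close>

text \<open>Two obstacles shape the construction. The stretched exponential bound on the
  coefficients of the perturbation is not uniform in \<open>\<delta>\<close>: its constants
  deteriorate as \<open>\<delta>\<close> tends to 0, and only the polynomially weighted norm is
  shown to become small. The weight therefore carries a parameter \<open>\<theta>\<close>, and the
  smallness threshold of the expansion does not depend on it. First \<open>\<delta>\<close> is fixed
  by the polynomial norm; convexity of the exponential then allows a \<open>\<theta>\<close> so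
  small that the full norm is small too. Solving the characteristic equation for \<open>h\<close>
  means dividing by \<open>z\<^sup>2 + 1 - 2 w z\<close>, which has a zero \<open>a\<close> in the
  disc because \<open>w\<close> is not real. The free entry \<open>c0\<close> supplies a multiple of
  \<open>z\<^sup>2\<close> that makes the numerator vanish there. The bound 1/2 on the exponent
  comes from \<open>\<alpha> < 1\<close>: then \<open>(1 - z) powr (- \<alpha>)\<close> maps the
  disc, and even a slightly larger sector, into a sector strictly inside the right half-plane. So
  \<open>exp (- \<delta> E)\<close> decays with room to spare for the growth of the cosine, and
  \<open>\<alpha> / (1 + \<alpha>) < 1/2\<close>.\<close>

lemma ell2_normI:
  assumes "\<And>N. (\<Sum>n<N. (cmod (u n))\<^sup>2) \<le> B\<^sup>2" "0 \<le> B"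
  shows "u \<in> ell2" "ell2_norm u \<le> B"
proof -
  have s: "summable (\<lambda>n. (cmod (u n))\<^sup>2)"
    by (rule summableI_nonneg_bounded[OF _ assms(1)]) auto
  then show "u \<in> ell2" by (simp add: ell2_def)
  have "(\<Sum>n. (cmod (u n))\<^sup>2) \<le> B\<^sup>2"
    by (rule suminf_le_const[OF s]) (use assms(1) in auto)
  then show "ell2_norm u \<le> B"
    using assms(2) unfolding ell2_norm_def by (rule real_le_lsqrt[rotated])
qed

lemma ell2_partial_sum_le:
  assumes "u \<in> ell2"
  shows "(\<Sum>n<N. (cmod (u n))\<^sup>2) \<le> (ell2_norm u)\<^sup>2"
proof -
  have s: "summable (\<lambda>n. (cmod (u n))\<^sup>2)" using assms by (simp add: ell2_def)
  have "0 \<le> (\<Sum>n. (cmod (u n))\<^sup>2)" by (rule suminf_nonneg[OF s]) auto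
  then show ?thesis
    unfolding ell2_norm_def using sum_le_suminf[OF s, of "{..<N}"] by simp
qed

lemma ell2_norm_nonneg: "u \<in> ell2 \<Longrightarrow> 0 \<le> ell2_norm u"
  unfolding ell2_norm_def ell2_def by (auto intro!: suminf_nonneg)

lemma ell2_nth_le:
  assumes "u \<in> ell2"
  shows "cmod (u n) \<le> ell2_norm u"
proof -
  have "(cmod (u n))\<^sup>2 \<le> (\<Sum>i<Suc n. (cmod (u i))\<^sup>2)" by (simp add: sum_nonneg)
  also have "\<dots> \<le> (ell2_norm u)\<^sup>2" by (rule ell2_partial_sum_le[OF assms])
  finally show ?thesis using ell2_norm_nonneg[OF assms] by (rule power2_le_imp_le)
qed

lemma ell2_scale: "u \<in> ell2 \<Longrightarrow> (\<lambda>n. z * u n) \<in> ell2"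
  unfolding ell2_def by (auto simp: norm_mult power_mult_distrib intro: summable_mult)

lemma ell2_add:
  assumes "u \<in> ell2" "v \<in> ell2"
  shows "(\<lambda>n. u n + v n) \<in> ell2"
proof -
  have s: "summable (\<lambda>n. 2 * (cmod (u n))\<^sup>2 + 2 * (cmod (v n))\<^sup>2)"
    using assms unfolding ell2_def by (auto intro: summable_add summable_mult)
  have "(cmod (u n + v n))\<^sup>2 \<le> 2 * (cmod (u n))\<^sup>2 + 2 * (cmod (v n))\<^sup>2" for n
  proof -
    have "(cmod (u n + v n))\<^sup>2 \<le> (cmod (u n) + cmod (v n))\<^sup>2"
      by (intro power_mono norm_triangle_ineq) auto
    also have "\<dots> \<le> 2 * (cmod (u n))\<^sup>2 + 2 * (cmod (v n))\<^sup>2"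
      using sum_squares_bound[of "cmod (u n)" "cmod (v n)"] by (simp add: power2_sum)
    finally show ?thesis .
  qed
  then show ?thesis unfolding ell2_def
    by (auto intro!: summable_comparison_test[OF _ s])
qed

lemma ell2_mult_bounded:
  assumes "u \<in> ell2" "\<And>n. cmod (f n) \<le> B"
  shows "(\<lambda>n. f n * u n) \<in> ell2"
proof -
  have s: "summable (\<lambda>n. B\<^sup>2 * (cmod (u n))\<^sup>2)"
    using assms unfolding ell2_def by (auto intro: summable_mult)
  have "(cmod (f n * u n))\<^sup>2 \<le> B\<^sup>2 * (cmod (u n))\<^sup>2" for n
    unfolding norm_mult power_mult_distrib
    by (intro mult_right_mono power_mono assms) auto
  then show ?thesis unfolding ell2_def
    by (auto intro!: summable_comparison_test[OF _ s])
qed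

lemma ell2_Suc_iff: "(\<lambda>n. u (Suc n)) \<in> ell2 \<longleftrightarrow> u \<in> ell2"
  unfolding ell2_def by (auto simp: summable_Suc_iff[where f = "\<lambda>n. (cmod (u n))\<^sup>2"])

lemma sum_geometric_le:
  fixes q :: real
  assumes "0 < q" "q < 1"
  shows "(\<Sum>i<n. q ^ i) \<le> 1 / (1 - q)"
proof -
  have "(\<Sum>i<n. q ^ i) \<le> (\<Sum>i. q ^ i)"
    using assms by (intro sum_le_suminf summable_geometric) auto
  then show ?thesis using assms by (simp add: suminf_geometric)
qed

text \<open>With truncated subtraction, \<open>(i - j) + (j - i)\<close> is the distance of \<open>i\<close> and \<open>j\<close>.\<close>

lemma sum_geometric_dist_le:
  fixes q :: real
  assumes q: "0 < q" "q < 1"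
  shows "(\<Sum>j<N. q ^ ((i - j) + (j - i))) \<le> 2 / (1 - q)"
proof -
  have "(\<Sum>j<N. q ^ ((i - j) + (j - i))) \<le> (\<Sum>j\<in>{..<i} \<union> {i..<i+N}. q ^ ((i - j) + (j - i)))"
    using q by (intro sum_mono2) auto
  also have "\<dots> = (\<Sum>j<i. q ^ ((i - j) + (j - i))) + (\<Sum>j\<in>{i..<i+N}. q ^ ((i - j) + (j - i)))"
    by (intro sum.union_disjoint) auto
  also have "(\<Sum>j<i. q ^ ((i - j) + (j - i))) = (\<Sum>j<i. q ^ (Suc (i - Suc j)))"
    by (intro sum.cong) (auto simp: Suc_diff_Suc)
  also have "\<dots> = (\<Sum>j<i. q ^ Suc j)" by (rule sum.nat_diff_reindex)
  also have "\<dots> \<le> (\<Sum>j<i. q ^ j)"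
    using q by (intro sum_mono) (auto simp: mult_left_le_one_le)
  also have "\<dots> \<le> 1 / (1 - q)" by (rule sum_geometric_le[OF q])
  also have "(\<Sum>j\<in>{i..<i+N}. q ^ ((i - j) + (j - i))) = (\<Sum>j<N. q ^ j)"
    by (rule sum.reindex_bij_witness[of _ "\<lambda>j. j + i" "\<lambda>j. j - i"]) auto
  also have "\<dots> \<le> 1 / (1 - q)" by (rule sum_geometric_le[OF q])
  finally show ?thesis by simp
qed

text \<open>Schur's test: Cauchy-Schwarz with \<open>q ^ dist\<close> split into two square roots
  reduces boundedness to row and column sums, and the symmetry of the distance bounds both by
  \<open>D\<close>.\<close>

lemma geometric_kernel:
  fixes K :: "nat \<Rightarrow> nat \<Rightarrow> complex"
  assumes q: "0 < q" "q < 1" and C: "0 \<le> C"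
    and K: "\<And>i j. cmod (K i j) \<le> C * q ^ ((i - j) + (j - i))"
  shows geometric_kernel_summable: "u \<in> ell2 \<Longrightarrow> summable (\<lambda>j. K i j * u j)"
    and geometric_kernel_bounded: "bounded_ell2_op (\<lambda>u i. \<Sum>j. K i j * u j)"
proof -
  define D where "D = 2 / (1 - q)"
  have D: "0 < D" using q by (simp add: D_def)
  have sumd: "(\<Sum>j<N. q ^ ((i - j) + (j - i))) \<le> D" for i N
    unfolding D_def by (rule sum_geometric_dist_le[OF q])
  have summ: "summable (\<lambda>j. K i j * u j)" if u: "u \<in> ell2" for i u
  proof (rule summable_norm_cancel, rule summable_comparison_test')
    show "summable (\<lambda>j. C * ell2_norm u * q ^ ((i - j) + (j - i)))"
      by (intro summable_mult summableI_nonneg_bounded[OF _ sumd]) (use q in auto)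
    show "norm (norm (K i j * u j)) \<le> C * ell2_norm u * q ^ ((i - j) + (j - i))" for j
    proof -
      have "cmod (K i j) * cmod (u j) \<le> (C * q ^ ((i - j) + (j - i))) * ell2_norm u"
        by (intro mult_mono K ell2_nth_le u) (use C q in auto)
      then show ?thesis by (simp add: norm_mult mult_ac)
    qed
  qed
  then show "u \<in> ell2 \<Longrightarrow> summable (\<lambda>j. K i j * u j)" for u .
  have fin: "(cmod (\<Sum>j<m. K i j * u j))\<^sup>2
      \<le> C\<^sup>2 * D * (\<Sum>j<m. q ^ ((i - j) + (j - i)) * (cmod (u j))\<^sup>2)" for u i m
  proof -
    let ?d = "\<lambda>j. q ^ ((i - j) + (j - i))"
    have "cmod (\<Sum>j<m. K i j * u j) \<le> (\<Sum>j<m. cmod (K i j) * cmod (u j))"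
      by (rule order_trans[OF norm_sum]) (simp add: norm_mult)
    also have "\<dots> \<le> (\<Sum>j<m. C * ?d j * cmod (u j))"
      by (intro sum_mono mult_right_mono K) auto
    also have "\<dots> = C * (\<Sum>j<m. sqrt (?d j) * (sqrt (?d j) * cmod (u j)))"
      using q by (simp add: sum_distrib_left mult_ac flip: mult.assoc real_sqrt_mult)
    finally have "(cmod (\<Sum>j<m. K i j * u j))\<^sup>2 \<le> (C * (\<Sum>j<m. sqrt (?d j) * (sqrt (?d j) * cmod (u j))))\<^sup>2"
      by (rule power_mono) simp
    also have "\<dots> = C\<^sup>2 * (\<Sum>j<m. sqrt (?d j) * (sqrt (?d j) * cmod (u j)))\<^sup>2"
      by (simp add: power_mult_distrib)
    also have "\<dots> \<le> C\<^sup>2 * ((\<Sum>j<m. (sqrt (?d j))\<^sup>2) * (\<Sum>j<m. (sqrt (?d j) * cmod (u j))\<^sup>2))"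
      by (intro mult_left_mono Cauchy_Schwarz_ineq_sum) auto
    also have "\<dots> = C\<^sup>2 * ((\<Sum>j<m. ?d j) * (\<Sum>j<m. ?d j * (cmod (u j))\<^sup>2))"
      using q by (simp add: power_mult_distrib)
    also have "\<dots> \<le> C\<^sup>2 * (D * (\<Sum>j<m. ?d j * (cmod (u j))\<^sup>2))"
      by (intro mult_left_mono mult_right_mono sumd sum_nonneg) (use q in auto)
    finally show ?thesis by (simp add: mult_ac)
  qed
  \<comment> \<open>The inner series is truncated at \<open>m\<close> so that only finite sums are
    interchanged; the bound survives the limit in \<open>m\<close>.\<close>
  have bd: "(\<Sum>i<N. (cmod (\<Sum>j. K i j * u j))\<^sup>2) \<le> (C * D * ell2_norm u)\<^sup>2" if u: "u \<in> ell2" for u N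
  proof (rule LIMSEQ_le_const2)
    show "(\<lambda>m. \<Sum>i<N. (cmod (\<Sum>j<m. K i j * u j))\<^sup>2) \<longlonglongrightarrow> (\<Sum>i<N. (cmod (\<Sum>j. K i j * u j))\<^sup>2)"
      by (intro tendsto_sum tendsto_power tendsto_norm summable_LIMSEQ summ u)
    have "(\<Sum>i<N. (cmod (\<Sum>j<m. K i j * u j))\<^sup>2) \<le> (C * D * ell2_norm u)\<^sup>2" for m
    proof -
      have "(\<Sum>i<N. (cmod (\<Sum>j<m. K i j * u j))\<^sup>2)
          \<le> (\<Sum>i<N. C\<^sup>2 * D * (\<Sum>j<m. q ^ ((i - j) + (j - i)) * (cmod (u j))\<^sup>2))"
        by (intro sum_mono fin)
      also have "\<dots> = C\<^sup>2 * D * (\<Sum>j<m. (\<Sum>i<N. q ^ ((j - i) + (i - j))) * (cmod (u j))\<^sup>2)"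
        by (subst sum_distrib_left[symmetric], subst sum.swap) (simp add: sum_distrib_right add.commute)
      also have "\<dots> \<le> C\<^sup>2 * D * (\<Sum>j<m. D * (cmod (u j))\<^sup>2)"
        using D by (intro mult_left_mono sum_mono mult_right_mono sumd) auto
      also have "\<dots> = C\<^sup>2 * D\<^sup>2 * (\<Sum>j<m. (cmod (u j))\<^sup>2)"
        by (simp add: sum_distrib_left power2_eq_square mult_ac)
      also have "\<dots> \<le> C\<^sup>2 * D\<^sup>2 * (ell2_norm u)\<^sup>2"
        by (intro mult_left_mono ell2_partial_sum_le u) auto
      finally show ?thesis by (simp add: power_mult_distrib)
    qed
    then show "\<exists>m0. \<forall>m\<ge>m0. (\<Sum>i<N. (cmod (\<Sum>j<m. K i j * u j))\<^sup>2) \<le> (C * D * ell2_norm u)\<^sup>2"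
      by blast
  qed
  show "bounded_ell2_op (\<lambda>u i. \<Sum>j. K i j * u j)"
    unfolding bounded_ell2_op_def
  proof (intro conjI ballI allI exI)
    fix u assume u: "u \<in> ell2"
    have B: "0 \<le> C * D * ell2_norm u" using C D ell2_norm_nonneg[OF u] by simp
    show "(\<lambda>i. \<Sum>j. K i j * u j) \<in> ell2" "ell2_norm (\<lambda>i. \<Sum>j. K i j * u j) \<le> C * D * ell2_norm u"
      using ell2_normI[OF bd[OF u] B] by auto
    show "(\<lambda>i. \<Sum>j. K i j * (z * u j)) = (\<lambda>n. z * (\<Sum>j. K n j * u j))" for z
    proof
      fix i
      show "(\<Sum>j. K i j * (z * u j)) = z * (\<Sum>j. K i j * u j)"
        using suminf_mult[OF summ[OF u], of z i] by (simp add: mult_ac)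
    qed
    fix v assume v: "v \<in> ell2"
    show "(\<lambda>i. \<Sum>j. K i j * (u j + v j)) = (\<lambda>n. (\<Sum>j. K n j * u j) + (\<Sum>j. K n j * v j))"
      using suminf_add[OF summ[OF u] summ[OF v]] by (simp add: ring_distribs)
  qed
qed

lemma bounded_ell2_op_compose:
  assumes "bounded_ell2_op S" "bounded_ell2_op T"
  shows "bounded_ell2_op (\<lambda>u. S (T u))"
proof -
  obtain K where K: "\<forall>u\<in>ell2. ell2_norm (S u) \<le> K * ell2_norm u"
    using assms(1) unfolding bounded_ell2_op_def by blast
  obtain L where L: "\<forall>u\<in>ell2. ell2_norm (T u) \<le> L * ell2_norm u"
    using assms(2) unfolding bounded_ell2_op_def by blast
  have T: "T u \<in> ell2" if "u \<in> ell2" for u using assms(2) that unfolding bounded_ell2_op_def by blast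
  have "ell2_norm (S (T u)) \<le> (max K 0 * L) * ell2_norm u" if u: "u \<in> ell2" for u
  proof -
    have "ell2_norm (S (T u)) \<le> K * ell2_norm (T u)" using K T[OF u] by blast
    also have "\<dots> \<le> max K 0 * ell2_norm (T u)"
      by (intro mult_right_mono ell2_norm_nonneg T u) auto
    also have "\<dots> \<le> max K 0 * (L * ell2_norm u)"
      using L u by (intro mult_left_mono) auto
    finally show ?thesis by (simp add: mult_ac)
  qed
  then have "\<exists>K. \<forall>u\<in>ell2. ell2_norm (S (T u)) \<le> K * ell2_norm u" by blast
  then show ?thesis using assms T unfolding bounded_ell2_op_def by simp
qed

lemma bounded_ell2_op_scale:
  assumes "bounded_ell2_op S"
  shows "bounded_ell2_op (\<lambda>u n. c * S u n)"
proof -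
  have "bounded_ell2_op (\<lambda>u i. \<Sum>j. (if j = i then c else 0) * u j)"
    by (rule geometric_kernel_bounded[of "1/2" "cmod c"]) auto
  moreover have "(\<lambda>u i. \<Sum>j. (if j = i then c else 0) * u j) = (\<lambda>u n. c * u n)"
  proof (intro ext)
    fix u :: "nat \<Rightarrow> complex" and i
    show "(\<Sum>j. (if j = i then c else 0) * u j) = c * u i"
      by (subst suminf_finite[of "{i}"]) auto
  qed
  ultimately have "bounded_ell2_op (\<lambda>u n. c * u n)" by simp
  from bounded_ell2_op_compose[OF this assms] show ?thesis .
qed

section \<open>Factorization of Jacobi matrices\<close>

text \<open>The finitely many factors above \<open>q\<close> enter only through \<open>C\<close>,
  the product of their excesses, so one constant serves all \<open>j\<close> and
  \<open>n\<close>.\<close>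

lemma eventually_le_imp_prod_le_geometric:
  fixes r :: "nat \<Rightarrow> real"
  assumes q: "0 < q" and r: "\<And>i. 0 \<le> r i" and ev: "eventually (\<lambda>i. r i \<le> q) sequentially"
  shows "\<exists>C>0. \<forall>j n. j \<le> n \<longrightarrow> (\<Prod>i\<in>{j..<n}. r i) \<le> C * q ^ (n - j)"
proof -
  obtain N where N: "\<And>i. N \<le> i \<Longrightarrow> r i \<le> q" using ev unfolding eventually_sequentially by blast
  define C where "C = (\<Prod>i<N. max 1 (r i / q))"
  have "(\<Prod>i\<in>{j..<n}. r i) \<le> C * q ^ (n - j)" if "j \<le> n" for j n
  proof -
    have "(\<Prod>i\<in>{j..<n}. r i / q) \<le> (\<Prod>i\<in>{j..<n} \<inter> {..<N}. max 1 (r i / q))"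
    proof -
      have "(\<Prod>i\<in>{j..<n}. r i / q) \<le> (\<Prod>i\<in>{j..<n}. if i < N then max 1 (r i / q) else 1)"
        using N q r by (intro prod_mono) (auto simp: le_max_iff_disj)
      also have "\<dots> = (\<Prod>i\<in>{j..<n} \<inter> {..<N}. max 1 (r i / q))"
        by (subst prod.inter_restrict) (auto intro: prod.cong)
      finally show ?thesis .
    qed
    also have "\<dots> \<le> C"
      unfolding C_def by (intro prod_mono2) auto
    finally have "(\<Prod>i\<in>{j..<n}. r i / q) \<le> C" .
    moreover have "(\<Prod>i\<in>{j..<n}. r i / q) = (\<Prod>i\<in>{j..<n}. r i) / q ^ (n - j)"
      by (simp add: prod_dividef)
    ultimately show ?thesis using q by (simp add: field_simps)
  qed
  moreover have "0 < C" unfolding C_def by (intro prod_pos) (auto simp: less_max_iff_disj)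
  ultimately show ?thesis by blast
qed

lemma matrix_op_jacobi_0: "matrix_op (jacobi_matrix a b c) u 0 = b 0 * u 0 + c 0 * u 1"
proof -
  have "matrix_op (jacobi_matrix a b c) u 0 = (\<Sum>j\<in>{0,1}. jacobi_matrix a b c 0 j * u j)"
    unfolding matrix_op_def by (rule suminf_finite) (auto simp: jacobi_matrix_def)
  then show ?thesis by (simp add: jacobi_matrix_def)
qed

lemma matrix_op_jacobi_Suc:
  "matrix_op (jacobi_matrix a b c) u (Suc n) =
     a n * u n + b (Suc n) * u (Suc n) + c (Suc n) * u (Suc (Suc n))"
proof -
  have "matrix_op (jacobi_matrix a b c) u (Suc n) =
      (\<Sum>j\<in>{n, Suc n, Suc (Suc n)}. jacobi_matrix a b c (Suc n) j * u j)"
    unfolding matrix_op_def by (rule suminf_finite) (auto simp: jacobi_matrix_def)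
  then show ?thesis by (simp add: jacobi_matrix_def)
qed

lemma matrix_op_jacobi_ell2:
  assumes u: "u \<in> ell2"
    and bd: "\<And>n. cmod (a n) \<le> B" "\<And>n. cmod (b n) \<le> B" "\<And>n. cmod (c n) \<le> B"
  shows "matrix_op (jacobi_matrix a b c) u \<in> ell2"
proof -
  have s: "(\<lambda>n. u (Suc n)) \<in> ell2" "(\<lambda>n. u (Suc (Suc n))) \<in> ell2"
    using u ell2_Suc_iff[of u] ell2_Suc_iff[of "\<lambda>n. u (Suc n)"] by auto
  have "(\<lambda>n. a n * u n + b (Suc n) * u (Suc n) + c (Suc n) * u (Suc (Suc n))) \<in> ell2"
    by (intro ell2_add ell2_mult_bounded[where B=B] bd u s)
  then have "(\<lambda>n. matrix_op (jacobi_matrix a b c) u (Suc n)) \<in> ell2"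
    by (simp add: matrix_op_jacobi_Suc)
  then show ?thesis by (simp only: ell2_Suc_iff)
qed

lemma matrix_op_jacobi_diff:
  "matrix_op (jacobi_matrix a b c) (\<lambda>n. u n - v n) i =
     matrix_op (jacobi_matrix a b c) u i - matrix_op (jacobi_matrix a b c) v i"
  by (cases i) (simp_all add: matrix_op_jacobi_0 matrix_op_jacobi_Suc algebra_simps)

text \<open>The factors of \<open>-2 (J - x/2) = U L\<close>, where \<open>U\<close> is the upper bidiagonal and \<open>L\<close> the lower
  bidiagonal matrix below.\<close>

definition lower_factor :: "(nat \<Rightarrow> complex) \<Rightarrow> (nat \<Rightarrow> complex) \<Rightarrow> nat \<Rightarrow> complex" where
  "lower_factor M u n = M n * u n - (case n of 0 \<Rightarrow> 0 | Suc m \<Rightarrow> u m)"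

definition upper_factor :: "(nat \<Rightarrow> complex) \<Rightarrow> (nat \<Rightarrow> complex) \<Rightarrow> nat \<Rightarrow> complex" where
  "upper_factor t u n = u n - t n * u (Suc n)"

text \<open>The entries of \<open>L\<^sup>-\<^sup>1\<close>, and in the next definition those of
  \<open>U\<^sup>-\<^sup>1\<close>. In the application both \<open>1 / M i\<close> and
  \<open>t i\<close> tend to \<open>z\<close>, so both kernels decay geometrically away from the
  diagonal.\<close>

definition lower_kernel :: "(nat \<Rightarrow> complex) \<Rightarrow> nat \<Rightarrow> nat \<Rightarrow> complex" where
  "lower_kernel M n j = (if j \<le> n then \<Prod>i\<in>{j..<Suc n}. inverse (M i) else 0)"

definition upper_kernel :: "(nat \<Rightarrow> complex) \<Rightarrow> nat \<Rightarrow> nat \<Rightarrow> complex" where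
  "upper_kernel t n j = (if n \<le> j then \<Prod>i\<in>{n..<j}. t i else 0)"

text \<open>Matching the diagonal of \<open>U L\<close> is exactly the continued fraction recursion
  \<open>b\<close>. Division occurs only by the later pivots; \<open>M 0\<close> may vanish, so the
  same identity serves both the resolvent and the eigenvector.\<close>

lemma jacobi_factorization:
  assumes M: "\<And>n. M (Suc n) \<noteq> 0"
    and b: "\<And>n. 2 * b n = x - M n - 2 * c n / M (Suc n)"
    and t: "\<And>n. t n = 2 * c n / M (Suc n)"
  shows "matrix_op (jacobi_matrix (\<lambda>_. 1/2) b c) u n - x / 2 * u n
    = - (1/2) * upper_factor t (lower_factor M u) n"
proof -
  have b': "b n = (x - M n - t n) / 2" for n using b[of n] t[of n] by (simp add: field_simps)
  have c': "c n = t n * M (Suc n) / 2" for n using t[of n] M[of n] by (simp add: field_simps)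
  show ?thesis
    by (cases n) (simp_all add: matrix_op_jacobi_0 matrix_op_jacobi_Suc b' c' upper_factor_def
        lower_factor_def field_simps)
qed

lemma norm_lower_kernel_le:
  assumes "0 < q" "0 < C"
    and P: "\<And>j n. j \<le> n \<Longrightarrow> (\<Prod>i\<in>{j..<n}. cmod (inverse (M i))) \<le> C * q ^ (n - j)"
  shows "cmod (lower_kernel M n j) \<le> C * q * q ^ ((n - j) + (j - n))"
  using P[of j "Suc n"] assms(1,2)
  by (auto simp: lower_kernel_def Suc_diff_le mult_ac simp flip: prod_norm simp del: prod.op_ivl_Suc)

lemma norm_upper_kernel_le:
  assumes "0 < q" "0 < C"
    and P: "\<And>j n. j \<le> n \<Longrightarrow> (\<Prod>i\<in>{j..<n}. cmod (t i)) \<le> C * q ^ (n - j)"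
  shows "cmod (upper_kernel t n j) \<le> C * q ^ ((n - j) + (j - n))"
  using P[of n j] assms(1,2) by (auto simp: upper_kernel_def simp flip: prod_norm)

lemma lower_factor_kernel:
  assumes M: "\<And>n. M n \<noteq> 0" and s: "\<And>i. summable (\<lambda>j. lower_kernel M i j * y j)"
  shows "lower_factor M (\<lambda>i. \<Sum>j. lower_kernel M i j * y j) n = y n"
proof (cases n)
  case 0
  have "(\<Sum>j. lower_kernel M 0 j * y j) = (\<Sum>j\<in>{0}. lower_kernel M 0 j * y j)"
    by (rule suminf_finite) (auto simp: lower_kernel_def)
  then show ?thesis using M 0 by (simp add: lower_factor_def lower_kernel_def)
next
  case (Suc m)
  have k: "M (Suc m) * lower_kernel M (Suc m) j = lower_kernel M m j + (if j = Suc m then 1 else 0)" for j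
    using M[of "Suc m"] by (auto simp: lower_kernel_def not_le le_Suc_eq)
  have "M (Suc m) * (\<Sum>j. lower_kernel M (Suc m) j * y j)
      = (\<Sum>j. M (Suc m) * lower_kernel M (Suc m) j * y j)"
    using suminf_mult[OF s[of "Suc m"], of "M (Suc m)"] by (simp add: mult_ac)
  also have "\<dots> = (\<Sum>j. lower_kernel M m j * y j + (if j = Suc m then 1 else 0) * y j)"
    unfolding k by (simp add: ring_distribs)
  also have "\<dots> = (\<Sum>j. lower_kernel M m j * y j) + (\<Sum>j. (if j = Suc m then 1 else 0) * y j)"
    by (rule suminf_add[OF s, symmetric]) (rule summable_finite[of "{Suc m}"], auto)
  also have "(\<Sum>j. (if j = Suc m then 1 else 0) * y j) = y (Suc m)"
    by (subst suminf_finite[of "{Suc m}"]) auto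
  finally show ?thesis by (simp add: lower_factor_def Suc)
qed

lemma upper_factor_kernel:
  assumes s: "\<And>i. summable (\<lambda>j. upper_kernel t i j * y j)"
  shows "upper_factor t (\<lambda>i. \<Sum>j. upper_kernel t i j * y j) n = y n"
proof -
  have k: "upper_kernel t n j = (if j = n then 1 else 0) + t n * upper_kernel t (Suc n) j" for j
    by (auto simp: upper_kernel_def prod.atLeast_Suc_lessThan)
  have "(\<Sum>j. upper_kernel t n j * y j)
      = (\<Sum>j. (if j = n then 1 else 0) * y j + t n * (upper_kernel t (Suc n) j * y j))"
    unfolding k by (simp add: ring_distribs mult_ac)
  also have "\<dots> = (\<Sum>j. (if j = n then 1 else 0) * y j) + (\<Sum>j. t n * (upper_kernel t (Suc n) j * y j))"
    by (rule suminf_add[symmetric]) (rule summable_finite[of "{n}"], auto intro: summable_mult s)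
  also have "(\<Sum>j. (if j = n then 1 else 0) * y j) = y n"
    by (subst suminf_finite[of "{n}"]) auto
  also have "(\<Sum>j. t n * (upper_kernel t (Suc n) j * y j)) = t n * (\<Sum>j. upper_kernel t (Suc n) j * y j)"
    by (rule suminf_mult[OF s])
  finally show ?thesis by (simp add: upper_factor_def)
qed

lemma lower_factor_eq_0_imp:
  assumes "\<And>n. M n \<noteq> 0" "\<And>n. lower_factor M u n = 0"
  shows "u n = 0"
proof (induction n)
  case 0
  then show ?case using assms(1)[of 0] assms(2)[of 0] by (simp add: lower_factor_def)
next
  case (Suc n)
  then show ?case using assms(1)[of "Suc n"] assms(2)[of "Suc n"] by (simp add: lower_factor_def)
qed

text \<open>\<open>L\<close> is injective on all sequences by forward recursion, \<open>U\<close>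
  only on bounded ones: \<open>w n\<close> is a geometrically small product times
  \<open>w (n + k)\<close>, and \<open>k\<close> tends to infinity.\<close>

lemma upper_factor_eq_0_imp:
  assumes q: "0 < q" "q < 1"
    and P: "\<And>j n. j \<le> n \<Longrightarrow> (\<Prod>i\<in>{j..<n}. cmod (t i)) \<le> C * q ^ (n - j)"
    and B: "\<And>n. cmod (w n) \<le> B" and w: "\<And>n. upper_factor t w n = 0"
  shows "w n = 0"
proof -
  have step: "w n = t n * w (Suc n)" for n using w[of n] by (simp add: upper_factor_def)
  have eq: "w n = (\<Prod>i\<in>{n..<n+k}. t i) * w (n + k)" for k
  proof (induction k)
    case (Suc k)
    then show ?case using step[of "n + k"] by (simp add: mult_ac)
  qed simp
  have "cmod (w n) \<le> C * q ^ k * B" for k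
  proof -
    have "cmod (w n) = (\<Prod>i\<in>{n..<n+k}. cmod (t i)) * cmod (w (n + k))"
      by (subst eq[of k]) (simp add: norm_mult prod_norm)
    also have "\<dots> \<le> (C * q ^ (n + k - n)) * B"
    proof (intro mult_mono P B)
      have "0 \<le> (\<Prod>i\<in>{n..<n+k}. cmod (t i))" by (intro prod_nonneg) auto
      then show "0 \<le> C * q ^ (n + k - n)" using P[of n "n + k"] by linarith
    qed auto
    finally show ?thesis by simp
  qed
  moreover have "(\<lambda>k. C * q ^ k * B) \<longlonglongrightarrow> C * 0 * B"
    by (intro tendsto_intros LIMSEQ_power_zero) (use q in auto)
  ultimately have "cmod (w n) \<le> C * 0 * B"
    by (intro LIMSEQ_le_const) auto
  then show ?thesis by simp
qed

text \<open>With all pivots nonzero the inverse is explicit: \<open>-2\<close> times the composition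
  of the kernels of \<open>L\<^sup>-\<^sup>1\<close> and \<open>U\<^sup>-\<^sup>1\<close>, each
  bounded by Schur's test.\<close>

lemma jacobi_resolvent:
  assumes M: "\<And>n. M n \<noteq> 0"
    and b: "\<And>n. 2 * b n = x - M n - 2 * c n / M (Suc n)"
    and lim: "M \<longlonglongrightarrow> 1 / z" "c \<longlonglongrightarrow> 1 / 2" and z: "0 < cmod z" "cmod z < 1"
    and bd: "\<And>n. cmod (b n) \<le> B" "\<And>n. cmod (c n) \<le> B"
  shows "x / 2 \<in> ell2_resolvent_set (matrix_op (jacobi_matrix (\<lambda>_. 1/2) b c))"
proof -
  define t where "t = (\<lambda>n. 2 * c n / M (Suc n))"
  obtain q where q: "cmod z < q" "q < 1" using dense z(2) by blast
  have q0: "0 < q" using z q by linarith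
  have z0: "z \<noteq> 0" using z by auto
  have "(\<lambda>n. cmod (inverse (M n))) \<longlonglongrightarrow> cmod (inverse (1 / z))"
    by (intro tendsto_intros lim) (use z0 in auto)
  from order_tendstoD(2)[OF this, of q] q have "eventually (\<lambda>n. cmod (inverse (M n)) < q) sequentially"
    by simp
  then have "eventually (\<lambda>n. cmod (inverse (M n)) \<le> q) sequentially"
    by (rule eventually_mono) simp
  from eventually_le_imp_prod_le_geometric[OF q0 _ this] obtain C1 where C1: "0 < C1"
      "\<And>j n. j \<le> n \<Longrightarrow> (\<Prod>i\<in>{j..<n}. cmod (inverse (M i))) \<le> C1 * q ^ (n - j)" by auto
  have "(\<lambda>n. cmod (2 * c n / M (Suc n))) \<longlonglongrightarrow> cmod (2 * (1 / 2) / (1 / z))"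
    by (intro tendsto_intros lim(2) LIMSEQ_Suc[OF lim(1)]) (use z0 in auto)
  from order_tendstoD(2)[OF this, of q] q have "eventually (\<lambda>n. cmod (t n) < q) sequentially"
    by (simp add: t_def)
  then have "eventually (\<lambda>n. cmod (t n) \<le> q) sequentially"
    by (rule eventually_mono) simp
  from eventually_le_imp_prod_le_geometric[OF q0 _ this] obtain C2 where C2: "0 < C2"
      "\<And>j n. j \<le> n \<Longrightarrow> (\<Prod>i\<in>{j..<n}. cmod (t i)) \<le> C2 * q ^ (n - j)" by auto
  let ?T = "matrix_op (jacobi_matrix (\<lambda>_. 1/2) b c)"
  let ?A = "\<lambda>u n. ?T u n - x / 2 * u n"
  define S1 where "S1 = (\<lambda>u i. \<Sum>j. lower_kernel M i j * u j)"
  define S2 where "S2 = (\<lambda>u i. \<Sum>j. upper_kernel t i j * u j)"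
  define R where "R = (\<lambda>u n. -2 * S1 (S2 u) n)"
  have A: "?A u n = - (1/2) * upper_factor t (lower_factor M u) n" for u n
    by (rule jacobi_factorization[of M b x c t]) (simp_all add: M b t_def)
  have k1: "cmod (lower_kernel M n j) \<le> C1 * q * q ^ ((n - j) + (j - n))" for n j
    by (rule norm_lower_kernel_le[OF q0 C1])
  have k2: "cmod (upper_kernel t n j) \<le> C2 * q ^ ((n - j) + (j - n))" for n j
    by (rule norm_upper_kernel_le[OF q0 C2])
  have C1': "0 \<le> C1 * q" and C2': "0 \<le> C2" using C1(1) C2(1) q0 by auto
  have S1: "bounded_ell2_op S1"
    unfolding S1_def by (rule geometric_kernel_bounded[OF q0 q(2) C1' k1])
  have S2: "bounded_ell2_op S2"
    unfolding S2_def by (rule geometric_kernel_bounded[OF q0 q(2) C2' k2])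
  have R: "bounded_ell2_op R"
    unfolding R_def by (rule bounded_ell2_op_scale[OF bounded_ell2_op_compose[OF S1 S2]])
  have R_ell2: "R u \<in> ell2" and S2_ell2: "S2 u \<in> ell2" if "u \<in> ell2" for u
    using R S2 that unfolding bounded_ell2_op_def by auto
  have right: "?A (R u) = u" if u: "u \<in> ell2" for u
  proof
    fix n
    have l: "lower_factor M (R u) i = -2 * S2 u i" for i
    proof -
      have "lower_factor M (R u) i = -2 * lower_factor M (S1 (S2 u)) i"
        by (simp add: R_def lower_factor_def algebra_simps split: nat.split)
      also have "lower_factor M (S1 (S2 u)) i = S2 u i"
        unfolding S1_def
        by (rule lower_factor_kernel)
          (rule M geometric_kernel_summable[OF q0 q(2) C1' k1 S2_ell2[OF u]])+
      finally show ?thesis .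
    qed
    have "?A (R u) n = - (1/2) * upper_factor t (\<lambda>i. -2 * S2 u i) n"
      unfolding A by (simp add: upper_factor_def l)
    also have "\<dots> = upper_factor t (S2 u) n" by (simp add: upper_factor_def algebra_simps)
    also have "\<dots> = u n"
      unfolding S2_def
      by (rule upper_factor_kernel) (rule geometric_kernel_summable[OF q0 q(2) C2' k2 u])
    finally show "?A (R u) n = u n" .
  qed
  have "Bseq M" using lim(1) by (auto intro!: convergent_imp_Bseq convergentI)
  then obtain BM where BM: "\<And>n. cmod (M n) \<le> BM" by (auto simp: Bseq_def)
  have inj: "u = (\<lambda>_. 0)" if u: "u \<in> ell2" and A0: "?A u = (\<lambda>_. 0)" for u
  proof -
    have "lower_factor M u n = 0" for n
    proof (rule upper_factor_eq_0_imp[OF q0 q(2) C2(2)])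
      show "upper_factor t (lower_factor M u) n = 0" for n
        using A[of u n] fun_cong[OF A0, of n] by simp
      show "cmod (lower_factor M u n) \<le> BM * ell2_norm u + ell2_norm u" for n
      proof -
        have "cmod (lower_factor M u n) \<le> cmod (M n * u n) + cmod (case n of 0 \<Rightarrow> 0 | Suc m \<Rightarrow> u m)"
          unfolding lower_factor_def by (rule norm_triangle_ineq4)
        also have "cmod (M n * u n) \<le> BM * ell2_norm u"
          unfolding norm_mult using BM[of n] order_trans[OF norm_ge_zero BM[of n]]
          by (intro mult_mono ell2_nth_le u) auto
        also have "cmod (case n of 0 \<Rightarrow> 0 | Suc m \<Rightarrow> u m) \<le> ell2_norm u"
          using ell2_nth_le[OF u] ell2_norm_nonneg[OF u] by (auto split: nat.split)
        finally show ?thesis by simp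
      qed
    qed
    then show ?thesis using lower_factor_eq_0_imp[of M u] M by blast
  qed
  \<comment> \<open>The left inverse property follows from the right one and injectivity, so the
    kernels need not be applied after the factors.\<close>
  have left: "R (?A u) = u" if u: "u \<in> ell2" for u
  proof -
    \<comment> \<open>The bound must also cover the constant subdiagonal \<open>1/2\<close>.\<close>
    define B' where "B' = max B (1/2)"
    have "?T u \<in> ell2"
      by (rule matrix_op_jacobi_ell2[OF u, where B=B'])
        (use bd in \<open>simp_all add: B'_def norm_divide max.coboundedI1\<close>)
    then have Au: "?A u \<in> ell2"
      using ell2_add[OF _ ell2_scale[OF u, of "- (x / 2)"]] by simp
    define v where "v = (\<lambda>n. R (?A u) n - u n)"
    have v: "v \<in> ell2"
      using ell2_add[OF R_ell2[OF Au] ell2_scale[OF u, of "-1"]] by (simp add: v_def)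
    have "?A v n = ?A (R (?A u)) n - ?A u n" for n
      unfolding v_def matrix_op_jacobi_diff by (simp add: algebra_simps)
    also have "?A (R (?A u)) n - ?A u n = 0" for n
      using fun_cong[OF right[OF Au], of n] by simp
    finally have "?A v = (\<lambda>_. 0)" by blast
    from inj[OF v this] show ?thesis by (auto simp: v_def fun_eq_iff)
  qed
  show ?thesis
    unfolding ell2_resolvent_set_def using R left right by blast
qed

text \<open>If the first pivot vanishes, row 0 of \<open>L u = 0\<close> is void and
  \<open>u n = u (n - 1) / M n\<close> with \<open>u 0 = 1\<close> solves the other rows. This
  eigenvector decays like \<open>q ^ n\<close> for some \<open>q < 1\<close>, hence is
  square-summable.\<close>

lemma jacobi_spectrum:
  assumes M: "\<And>n. M (Suc n) \<noteq> 0" "M 0 = 0"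
    and b: "\<And>n. 2 * b n = x - M n - 2 * c n / M (Suc n)"
    and lim: "M \<longlonglongrightarrow> 1 / z" and z: "0 < cmod z" "cmod z < 1"
  shows "x / 2 \<in> ell2_spectrum (matrix_op (jacobi_matrix (\<lambda>_. 1/2) b c))"
proof -
  let ?T = "matrix_op (jacobi_matrix (\<lambda>_. 1/2) b c)"
  define u where "u = (\<lambda>n. \<Prod>i\<in>{0..<n}. inverse (M (Suc i)))"
  obtain q where q: "cmod z < q" "q < 1" using dense z(2) by blast
  have q0: "0 < q" using z q by linarith
  have "(\<lambda>n. cmod (inverse (M (Suc n)))) \<longlonglongrightarrow> cmod (inverse (1 / z))"
    by (intro tendsto_intros LIMSEQ_Suc[OF lim]) (use z in auto)
  from order_tendstoD(2)[OF this, of q] q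
  have "eventually (\<lambda>n. cmod (inverse (M (Suc n))) < q) sequentially"
    by simp
  then have "eventually (\<lambda>n. cmod (inverse (M (Suc n))) \<le> q) sequentially"
    by (rule eventually_mono) simp
  from eventually_le_imp_prod_le_geometric[OF q0 _ this] obtain C where C: "0 < C"
      "\<And>j n. j \<le> n \<Longrightarrow> (\<Prod>i\<in>{j..<n}. cmod (inverse (M (Suc i)))) \<le> C * q ^ (n - j)" by auto
  have un: "cmod (u n) \<le> C * q ^ n" for n
    using C(2)[of 0 n] by (simp add: u_def flip: prod_norm)
  have "summable (\<lambda>n. C\<^sup>2 * (q\<^sup>2) ^ n)"
    using q q0 by (intro summable_mult summable_geometric) (auto simp: power_less_one_iff)
  then have "summable (\<lambda>n. (cmod (u n))\<^sup>2)"
  proof (rule summable_comparison_test'[where N=0])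
    show "norm ((cmod (u n))\<^sup>2) \<le> C\<^sup>2 * (q\<^sup>2) ^ n" for n
      using power_mono[OF un[of n], of 2]
      by (simp add: power_mult_distrib power_mult[symmetric] mult.commute)
  qed
  then have u: "u \<in> ell2" by (simp add: ell2_def)
  have l0: "lower_factor M u = (\<lambda>_. 0)"
  proof
    fix n
    show "lower_factor M u n = 0"
      by (cases n) (use M in \<open>auto simp: lower_factor_def u_def\<close>)
  qed
  have Tu: "(\<lambda>n. ?T u n - x / 2 * u n) = (\<lambda>_. 0)"
  proof
    fix n
    have "?T u n - x / 2 * u n = - (1/2) * upper_factor (\<lambda>n. 2 * c n / M (Suc n)) (lower_factor M u) n"
      by (rule jacobi_factorization[of M b x c]) (simp_all add: M b)
    then show "?T u n - x / 2 * u n = 0" by (simp add: l0 upper_factor_def)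
  qed
  have "x / 2 \<notin> ell2_resolvent_set ?T"
  proof
    assume "x / 2 \<in> ell2_resolvent_set ?T"
    then obtain R where R: "bounded_ell2_op R" "R (\<lambda>n. ?T u n - x / 2 * u n) = u"
      using u unfolding ell2_resolvent_set_def by blast
    have "R (\<lambda>n. 0 * u n) = (\<lambda>n. 0 * R u n)"
      using R(1) u unfolding bounded_ell2_op_def by blast
    then have "u = (\<lambda>_. 0)" using R(2)[unfolded Tu] by simp
    then have "u 0 = 0" by metis
    then show False by (simp add: u_def)
  qed
  then show ?thesis by (simp add: ell2_spectrum_def)
qed

section \<open>The continued fraction expansion in weighted norms\<close>

text \<open>A weighted \<open>l\<^sup>1\<close> norm is at most \<open>r\<close>. Bounding all
  partial sums includes summability, and finite sums can be subtracted when a bound is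
  absorbed.\<close>

definition weighted_bound :: "(nat \<Rightarrow> real) \<Rightarrow> complex fps \<Rightarrow> real \<Rightarrow> bool" where
  "weighted_bound \<omega> f r \<longleftrightarrow> (\<forall>N. (\<Sum>k<N. \<omega> k * cmod (fps_nth f k)) \<le> r)"

lemma weighted_bound_mono: "weighted_bound \<omega> f r \<Longrightarrow> r \<le> s \<Longrightarrow> weighted_bound \<omega> f s"
  unfolding weighted_bound_def using order_trans by blast

lemma weighted_bound_nth:
  assumes "weighted_bound \<omega> f r" "\<And>k. 0 \<le> \<omega> k"
  shows "\<omega> k * cmod (fps_nth f k) \<le> r"
proof -
  have "\<omega> k * cmod (fps_nth f k) \<le> (\<Sum>k<Suc k. \<omega> k * cmod (fps_nth f k))"
    using assms(2) by (simp add: sum_nonneg)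
  then show ?thesis using assms(1) unfolding weighted_bound_def using order_trans by blast
qed

lemma weighted_bound_nonneg: "weighted_bound \<omega> f r \<Longrightarrow> 0 \<le> r"
  unfolding weighted_bound_def by (drule spec[of _ 0]) simp

text \<open>The Banach algebra estimate with a gain \<open>d\<close>. For a shifted weight
  \<open>\<omega> (p + k)\<close>, log-concavity yields the hypothesis \<open>sub\<close> with
  \<open>d = \<omega> p\<close>, so products get smaller the further the weight is shifted.\<close>

lemma weighted_sum_mult_le:
  fixes f g :: "complex fps"
  assumes \<omega>: "\<And>k. 0 \<le> \<omega> k" and d: "0 \<le> d" and sub: "\<And>a b. d * \<omega> (a + b) \<le> \<omega> a * \<omega> b"
  shows "d * (\<Sum>k<N. \<omega> k * cmod (fps_nth (f * g) k))
    \<le> (\<Sum>k<N. \<omega> k * cmod (fps_nth f k)) * (\<Sum>k<N. \<omega> k * cmod (fps_nth g k))"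
proof -
  let ?F = "\<lambda>k. \<omega> k * cmod (fps_nth f k)" and ?G = "\<lambda>k. \<omega> k * cmod (fps_nth g k)"
  have "d * (\<omega> k * cmod (fps_nth (f * g) k)) \<le> (\<Sum>i\<le>k. ?F i * ?G (k - i))" for k
  proof -
    have "cmod (fps_nth (f * g) k) \<le> (\<Sum>i\<le>k. cmod (fps_nth f i) * cmod (fps_nth g (k - i)))"
      unfolding fps_mult_nth atLeast0AtMost by (rule order_trans[OF norm_sum]) (simp add: norm_mult)
    then have "d * (\<omega> k * cmod (fps_nth (f * g) k))
        \<le> d * (\<omega> k * (\<Sum>i\<le>k. cmod (fps_nth f i) * cmod (fps_nth g (k - i))))"
      by (intro mult_left_mono \<omega> d)
    also have "\<dots> = (\<Sum>i\<le>k. (d * \<omega> (i + (k - i))) * (cmod (fps_nth f i) * cmod (fps_nth g (k - i))))"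
      by (simp add: sum_distrib_left mult_ac)
    also have "\<dots> \<le> (\<Sum>i\<le>k. (\<omega> i * \<omega> (k - i)) * (cmod (fps_nth f i) * cmod (fps_nth g (k - i))))"
      by (intro sum_mono mult_right_mono sub) auto
    finally show ?thesis by (simp add: mult_ac)
  qed
  then have "d * (\<Sum>k<N. \<omega> k * cmod (fps_nth (f * g) k)) \<le> (\<Sum>k<N. \<Sum>i\<le>k. ?F i * ?G (k - i))"
    by (simp add: sum_distrib_left sum_mono)
  also have "\<dots> = (\<Sum>(i,j)\<in>{(i,j). i + j < N}. ?F i * ?G j)"
    by (rule sum.triangle_reindex[symmetric])
  also have "\<dots> \<le> (\<Sum>(i,j)\<in>{..<N} \<times> {..<N}. ?F i * ?G j)"
    by (rule sum_mono2) (auto simp: \<omega>)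
  also have "\<dots> = (\<Sum>k<N. ?F k) * (\<Sum>k<N. ?G k)"
    by (simp add: sum_product sum.cartesian_product)
  finally show ?thesis .
qed

text \<open>One step of the continued fraction expansion: if \<open>h = \<beta> + \<gamma> X + (1 - \<gamma>) X\<^sup>2 Y\<close>, then
  \<open>1/z + h = z + 1/z + \<beta> - (1 - \<gamma>) / (1/z + Y / (1 - z Y))\<close>.\<close>

definition strip_quot :: "complex fps \<Rightarrow> complex fps" where
  "strip_quot h = fps_const (inverse (1 - fps_nth h 1)) * fps_shift 2 h"

definition strip :: "complex fps \<Rightarrow> complex fps" where
  "strip h = strip_quot h * inverse (1 - fps_X * strip_quot h)"

text \<open>A fixed-point form of the definition: it lets the norm of \<open>strip h\<close> be
  absorbed into the left-hand side, in place of summing a Neumann series.\<close>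

lemma strip_eq: "strip h = strip_quot h + fps_X * (strip_quot h * strip h)"
proof -
  let ?D = "1 - fps_X * strip_quot h"
  have "?D * inverse ?D = 1" by (rule inverse_mult_eq_1') simp
  then have "?D * strip h = strip_quot h" by (simp add: strip_def mult_ac)
  then show ?thesis by (simp add: algebra_simps)
qed

lemma strip_identity:
  assumes "fps_nth h 1 \<noteq> 1"
  shows "(h - fps_const (fps_nth h 0) - fps_const (fps_nth h 1) * fps_X) * (1 + fps_X * strip h)
    = fps_const (1 - fps_nth h 1) * fps_X ^ 2 * strip h"
proof -
  let ?Y = "strip_quot h"
  have "h - fps_const (fps_nth h 0) - fps_const (fps_nth h 1) * fps_X = fps_X ^ 2 * fps_shift 2 h"
  proof (rule fps_ext)
    fix n
    consider "n = 0" | "n = 1" | m where "n = Suc (Suc m)" by (metis One_nat_def not0_implies_Suc)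
    then show "fps_nth (h - fps_const (fps_nth h 0) - fps_const (fps_nth h 1) * fps_X) n
        = fps_nth (fps_X ^ 2 * fps_shift 2 h) n"
      by cases (simp_all add: fps_X_power_mult_nth)
  qed
  also have "fps_shift 2 h = fps_const (1 - fps_nth h 1) * ?Y"
    using assms by (simp add: strip_quot_def flip: mult.assoc)
  finally have 1: "h - fps_const (fps_nth h 0) - fps_const (fps_nth h 1) * fps_X
      = fps_X ^ 2 * (fps_const (1 - fps_nth h 1) * ?Y)" .
  have "?Y * (1 + fps_X * strip h) = ?Y + fps_X * (?Y * strip h)" by (simp add: algebra_simps)
  also have "\<dots> = strip h" by (rule strip_eq[symmetric])
  finally have "fps_X ^ 2 * fps_const (1 - fps_nth h 1) * (?Y * (1 + fps_X * strip h))
      = fps_X ^ 2 * fps_const (1 - fps_nth h 1) * strip h" by simp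
  then show ?thesis unfolding 1 by (simp add: mult_ac)
qed

text \<open>The coefficient shift by two matches the move of the weight from \<open>m\<close> to
  \<open>m + 2\<close> and costs nothing. What costs is the division by
  \<open>1 - fps_nth h 1\<close>, and the product in \<open>strip_eq\<close>, where \<open>L\<close>
  pays for the factor \<open>fps_X\<close> and log-concavity gains
  \<open>1 / \<omega> (m + 2)\<close>. The two loss factors multiply to the stated
  denominator.\<close>

lemma weighted_bound_strip:
  assumes \<omega>: "\<And>k. 0 < \<omega> k"
    and lc: "\<And>p a b. \<omega> (p + a + b) * \<omega> p \<le> \<omega> (p + a) * \<omega> (p + b)"
    and L: "\<And>k. \<omega> (Suc k) \<le> L * \<omega> k" "0 \<le> L" and mono: "\<omega> (Suc m) \<le> \<omega> (Suc (Suc m))"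
    and h: "weighted_bound (\<lambda>k. \<omega> (m + k)) h r" and small: "(1 + L) * r / \<omega> (Suc m) < 1"
  shows "weighted_bound (\<lambda>k. \<omega> (m + 2 + k)) (strip h) (r / (1 - (1 + L) * r / \<omega> (Suc m)))"
    and "cmod (fps_nth h 1) \<le> r / \<omega> (Suc m)"
proof -
  define e where "e = 1 / \<omega> (Suc m)"
  have e: "0 < e" using \<omega> by (simp add: e_def)
  have r: "0 \<le> r" using weighted_bound_nonneg[OF h] .
  have "\<omega> (Suc m) * cmod (fps_nth h 1) \<le> r"
    using weighted_bound_nth[OF h, of 1] \<omega> by (simp add: less_imp_le)
  then show \<gamma>: "cmod (fps_nth h 1) \<le> r / \<omega> (Suc m)" using \<omega>[of "Suc m"] by (simp add: field_simps)
  have \<gamma>': "cmod (fps_nth h 1) \<le> r * e" using \<gamma> by (simp add: e_def)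
  have small': "(1 + L) * (r * e) < 1" using small by (simp add: e_def)
  have Lre: "0 \<le> L * (r * e)" using L r e by simp
  have re: "r * e < 1" using small' Lre by (simp add: algebra_simps)
  define y where "y = r / (1 - r * e)"
  have y: "0 \<le> y" using r re by (simp add: y_def)
  let ?w = "\<lambda>k. \<omega> (m + 2 + k)"
  have Y: "weighted_bound ?w (strip_quot h) y"
    unfolding weighted_bound_def
  proof
    fix N
    have g: "cmod (inverse (1 - fps_nth h 1)) \<le> 1 / (1 - r * e)"
    proof -
      have "1 - r * e \<le> cmod (1 - fps_nth h 1)"
        using norm_triangle_ineq2[of 1 "fps_nth h 1"] \<gamma>' by simp
      then show ?thesis using re by (simp add: norm_inverse divide_inverse le_imp_inverse_le)
    qed
    have "(\<Sum>k<N. ?w k * cmod (fps_nth (strip_quot h) k))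
        = cmod (inverse (1 - fps_nth h 1)) * (\<Sum>k<N. \<omega> (m + (k + 2)) * cmod (fps_nth h (k + 2)))"
      by (simp add: strip_quot_def norm_mult sum_distrib_left mult_ac add_ac)
    also have "(\<Sum>k<N. \<omega> (m + (k + 2)) * cmod (fps_nth h (k + 2)))
        = (\<Sum>k\<in>{2..<N+2}. \<omega> (m + k) * cmod (fps_nth h k))"
      by (rule sum.reindex_bij_witness[of _ "\<lambda>k. k - 2" "\<lambda>k. k + 2"]) auto
    also have "\<dots> \<le> (\<Sum>k<N+2. \<omega> (m + k) * cmod (fps_nth h k))"
      by (rule sum_mono2) (use \<omega> in \<open>auto simp: less_imp_le\<close>)
    also have "\<dots> \<le> r" using h unfolding weighted_bound_def by blast
    also have "cmod (inverse (1 - fps_nth h 1)) * r \<le> 1 / (1 - r * e) * r"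
      by (rule mult_right_mono[OF g r])
    finally show "(\<Sum>k<N. ?w k * cmod (fps_nth (strip_quot h) k)) \<le> y"
      by (simp add: y_def mult_left_mono)
  qed
  have Lye: "L * y * e < 1"
  proof -
    have "L * (r * e) < 1 - r * e" using small' by (simp add: algebra_simps)
    then show ?thesis using re by (simp add: y_def field_simps)
  qed
  have "(\<Sum>k<N. ?w k * cmod (fps_nth (strip h) k)) \<le> y / (1 - L * y * e)" for N
  proof -
    let ?S = "\<Sum>k<N. ?w k * cmod (fps_nth (strip h) k)"
    let ?P = "strip_quot h * strip h"
    have S0: "0 \<le> ?S" using \<omega> by (intro sum_nonneg) (auto simp: less_imp_le)
    have "?S \<le> (\<Sum>k<N. ?w k * cmod (fps_nth (strip_quot h) k))
              + (\<Sum>k<N. ?w k * cmod (fps_nth (fps_X * ?P) k))"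
    proof (subst sum.distrib[symmetric], rule sum_mono)
      fix k
      show "?w k * cmod (fps_nth (strip h) k)
          \<le> ?w k * cmod (fps_nth (strip_quot h) k) + ?w k * cmod (fps_nth (fps_X * ?P) k)"
        by (subst strip_eq, simp only: fps_add_nth distrib_left[symmetric])
          (intro mult_left_mono norm_triangle_ineq less_imp_le[OF \<omega>])
    qed
    also have "(\<Sum>k<N. ?w k * cmod (fps_nth (strip_quot h) k)) \<le> y"
      using Y unfolding weighted_bound_def by blast
    also have "(\<Sum>k<N. ?w k * cmod (fps_nth (fps_X * ?P) k)) \<le> (\<Sum>k<N. L * (?w k * cmod (fps_nth ?P k)))"
    proof (cases N)
      case (Suc N')
      have "(\<Sum>k<N. ?w k * cmod (fps_nth (fps_X * ?P) k)) = (\<Sum>k<N'. ?w (Suc k) * cmod (fps_nth ?P k))"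
        unfolding Suc by (subst sum.lessThan_Suc_shift) simp
      also have "\<dots> \<le> (\<Sum>k<N'. L * ?w k * cmod (fps_nth ?P k))"
        using L(1)[of "m + 2 + _"] by (intro sum_mono mult_right_mono) auto
      also have "\<dots> \<le> (\<Sum>k<N. L * ?w k * cmod (fps_nth ?P k))"
        unfolding Suc using \<omega> L by (simp add: less_imp_le)
      finally show ?thesis by (simp add: mult_ac)
    qed simp
    also have "\<dots> = L * (\<Sum>k<N. ?w k * cmod (fps_nth ?P k))" by (simp add: sum_distrib_left)
    also have "\<dots> \<le> L * (y * e * ?S)"
    proof (rule mult_left_mono[OF _ L(2)])
      have "\<omega> (m + 2) * (\<Sum>k<N. ?w k * cmod (fps_nth ?P k))
          \<le> (\<Sum>k<N. ?w k * cmod (fps_nth (strip_quot h) k)) * ?S"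
        by (rule weighted_sum_mult_le)
          (use \<omega> lc[of "m + 2"] in \<open>auto simp: less_imp_le add_ac mult_ac\<close>)
      also have "\<dots> \<le> y * ?S"
        using Y S0 unfolding weighted_bound_def by (intro mult_right_mono) auto
      finally have "(\<Sum>k<N. ?w k * cmod (fps_nth ?P k)) \<le> y * ?S * (1 / \<omega> (m + 2))"
        using \<omega>[of "m + 2"] by (simp add: field_simps)
      also have "\<dots> \<le> y * ?S * e"
        unfolding e_def using mono \<omega> y S0 by (intro mult_left_mono divide_left_mono) auto
      finally show "(\<Sum>k<N. ?w k * cmod (fps_nth ?P k)) \<le> y * e * ?S" by (simp add: mult_ac)
    qed
    \<comment> \<open>\<open>?S\<close> is a finite sum occurring on both sides, and
      \<open>L * y * e < 1\<close> allows it to be absorbed.\<close>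
    finally have "?S * (1 - L * y * e) \<le> y" by (simp add: algebra_simps)
    then show ?thesis using Lye by (simp add: field_simps)
  qed
  moreover have "y / (1 - L * y * e) = r / (1 - (1 + L) * r / \<omega> (Suc m))"
  proof -
    have "y / (1 - L * y * e) = r / ((1 - r * e) * (1 - L * y * e))" by (simp add: y_def)
    also have "(1 - r * e) * (1 - L * y * e) = 1 - (1 + L) * r * e"
      using re by (simp add: y_def algebra_simps) (simp add: field_simps)
    finally show ?thesis by (simp add: e_def)
  qed
  ultimately show "weighted_bound ?w (strip h) (r / (1 - (1 + L) * r / \<omega> (Suc m)))"
    by (simp add: weighted_bound_def)
qed

text \<open>One step enlarges the bound \<open>r\<close> by a term quadratic in \<open>r\<close> and
  proportional to \<open>1 / \<omega> (2 n + 1)\<close>. Smallness of \<open>\<eta>\<close> turns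
  this into at most \<open>\<eta> / \<omega> (2 n + 1)\<close>; these increments are summable, and
  the resulting a priori bound \<open>\<eta> * (1 + S)\<close> closes the induction.\<close>

lemma weighted_bound_strip_funpow:
  assumes \<omega>: "\<And>k. 0 < \<omega> k"
    and lc: "\<And>p a b. \<omega> (p + a + b) * \<omega> p \<le> \<omega> (p + a) * \<omega> (p + b)"
    and L: "\<And>k. \<omega> (Suc k) \<le> L * \<omega> k" "0 \<le> L" and mono: "\<And>m. \<omega> m \<le> \<omega> (Suc m)" and \<omega>0: "\<omega> 0 = 1"
    and S: "\<And>N. (\<Sum>n<N. 1 / \<omega> (2 * n + 1)) \<le> S"
    and h: "weighted_bound \<omega> h \<eta>" and small: "2 * (1 + L) * (1 + S)\<^sup>2 * \<eta> \<le> 1"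
  shows "weighted_bound (\<lambda>k. \<omega> (2 * n + k)) ((strip ^^ n) h) (\<eta> * (1 + (\<Sum>i<n. 1 / \<omega> (2 * i + 1))))"
proof (induction n)
  case 0
  then show ?case using h by simp
next
  case (Suc n)
  define q where "q = (\<Sum>i<n. 1 / \<omega> (2 * i + 1))"
  define e where "e = 1 / \<omega> (2 * n + 1)"
  define r where "r = \<eta> * (1 + q)"
  have \<eta>: "0 \<le> \<eta>" using weighted_bound_nonneg[OF h] .
  have q: "0 \<le> q" "q \<le> S" using S \<omega> by (auto simp: q_def intro!: sum_nonneg simp: less_imp_le)
  have "1 \<le> \<omega> k" for k
    by (induction k) (use \<omega>0 mono order_trans in auto)
  then have e: "0 < e" "e \<le> 1" using \<omega> by (auto simp: e_def)
  have r: "0 \<le> r" "r \<le> \<eta> * (1 + S)" using q \<eta> by (auto simp: r_def intro: mult_left_mono)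
  have S0: "0 \<le> S" using q by linarith
  have rr: "2 * (1 + L) * (r * (1 + S)) \<le> 1"
  proof -
    have "2 * (1 + L) * (r * (1 + S)) \<le> 2 * (1 + L) * (\<eta> * (1 + S) * (1 + S))"
      using r S0 L by (intro mult_left_mono mult_right_mono) auto
    then show ?thesis using small by (simp add: power2_eq_square mult_ac)
  qed
  have "(1 + L) * r \<le> (1 + L) * r * (1 + S)" using L r S0 by (simp add: mult_left_mono algebra_simps)
  moreover have "2 * (1 + L) * (r * (1 + S)) = 2 * ((1 + L) * r * (1 + S))" by simp
  ultimately have r1: "(1 + L) * r \<le> 1 / 2" using rr by linarith
  define s where "s = (1 + L) * r * e"
  have s: "0 \<le> s" "s \<le> 1 / 2"
  proof -
    show "0 \<le> s" using L r e by (simp add: s_def)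
    have "s \<le> (1 + L) * r * 1" unfolding s_def using L r e by (intro mult_left_mono) auto
    then show "s \<le> 1/2" using r1 by simp
  qed
  have IH: "weighted_bound (\<lambda>k. \<omega> (2 * n + k)) ((strip ^^ n) h) r"
    using Suc by (simp add: r_def q_def)
  have s_eq: "s = (1 + L) * r / \<omega> (Suc (2 * n))" by (simp add: s_def e_def)
  have "weighted_bound (\<lambda>k. \<omega> (2 * n + 2 + k)) (strip ((strip ^^ n) h)) (r / (1 - s))"
    unfolding s_eq by (rule weighted_bound_strip(1)[OF \<omega> lc L mono IH]) (use s s_eq in linarith)
  moreover have "r / (1 - s) \<le> \<eta> * (1 + (q + e))"
  proof -
    have "r \<le> r * (1 + 2 * s) * (1 - s)"
    proof -
      have "0 \<le> r * (s * (1 - 2 * s))" using r s by simp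
      then show ?thesis by (simp add: algebra_simps)
    qed
    then have "r / (1 - s) \<le> r * (1 + 2 * s)" using s by (simp add: field_simps)
    also have "\<dots> = r + (2 * (1 + L) * (r * (1 + q))) * (\<eta> * e)"
      by (simp add: s_def r_def algebra_simps)
    also have "\<dots> \<le> r + 1 * (\<eta> * e)"
    proof (intro add_left_mono mult_right_mono)
      have "2 * (1 + L) * (r * (1 + q)) \<le> 2 * (1 + L) * (r * (1 + S))"
        using L r q by (intro mult_left_mono) auto
      then show "2 * (1 + L) * (r * (1 + q)) \<le> 1" using rr by simp
    qed (use \<eta> e in auto)
    finally show ?thesis by (simp add: r_def algebra_simps)
  qed
  ultimately show ?case
    by (auto intro: weighted_bound_mono simp: q_def e_def add_ac)
qed

section \<open>Jacobi matrices from Weyl functions\<close>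

lemma fps_conv_radius_ge_1:
  fixes f :: "complex fps"
  assumes "\<And>k. cmod (fps_nth f k) \<le> B"
  shows "1 \<le> fps_conv_radius f"
  unfolding fps_conv_radius_def
proof (rule conv_radius_geI_ex')
  fix r :: real assume r: "0 < r" "ereal r < 1"
  have "summable (\<lambda>n. B * r ^ n)" using r by (intro summable_mult summable_geometric) auto
  then show "summable (\<lambda>n. fps_nth f n * of_real r ^ n)"
    by (rule summable_comparison_test') (use r assms in \<open>auto simp: norm_mult norm_power intro!: mult_right_mono\<close>)
qed

lemma norm_eval_fps_le:
  assumes f: "weighted_bound \<omega> f r" and \<omega>: "\<And>k. w \<le> \<omega> k" and w: "0 < w" and z: "cmod z < 1"
  shows "cmod (eval_fps f z) \<le> r / w"
proof -
  have part: "(\<Sum>k<N. cmod (fps_nth f k * z ^ k)) \<le> r / w" for N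
  proof -
    have "w * (\<Sum>k<N. cmod (fps_nth f k * z ^ k)) \<le> (\<Sum>k<N. \<omega> k * cmod (fps_nth f k))"
      unfolding sum_distrib_left
    proof (rule sum_mono)
      fix k
      have "cmod (fps_nth f k) * cmod z ^ k \<le> cmod (fps_nth f k) * 1"
        by (intro mult_left_mono power_le_one) (use z in auto)
      then have "w * (cmod (fps_nth f k) * cmod z ^ k) \<le> \<omega> k * cmod (fps_nth f k)"
        using \<omega>[of k] w by (intro mult_mono) auto
      then show "w * cmod (fps_nth f k * z ^ k) \<le> \<omega> k * cmod (fps_nth f k)"
        by (simp add: norm_mult norm_power)
    qed
    also have "\<dots> \<le> r" using f by (simp add: weighted_bound_def)
    finally show ?thesis using w by (simp add: field_simps)
  qed
  have s: "summable (\<lambda>k. cmod (fps_nth f k * z ^ k))"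
    by (rule summableI_nonneg_bounded[OF _ part]) auto
  have "cmod (eval_fps f z) \<le> (\<Sum>k. cmod (fps_nth f k * z ^ k))"
    unfolding eval_fps_def by (rule summable_norm[OF s])
  also have "\<dots> \<le> r / w" by (rule suminf_le_const[OF s part])
  finally show ?thesis .
qed

lemma strip_eval:
  fixes h :: "complex fps"
  assumes h1: "fps_nth h 1 \<noteq> 1" and R: "1 \<le> fps_conv_radius h" "1 \<le> fps_conv_radius (strip h)"
    and z: "z \<noteq> 0" "cmod z < 1" and M: "1 / z + eval_fps (strip h) z \<noteq> 0"
  shows "1 / z + eval_fps h z
    = z + 1 / z + fps_nth h 0 - (1 - fps_nth h 1) / (1 / z + eval_fps (strip h) z)"
proof -
  let ?H = "eval_fps h z" and ?H' = "eval_fps (strip h) z"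
  have z1: "ereal (cmod z) < 1" using z by simp
  note zR = less_le_trans[OF z1 R(1)] less_le_trans[OF z1 R(2)]
  have r1: "ereal (cmod z) < fps_conv_radius (fps_X * strip h)"
    by (rule less_le_trans[OF _ fps_conv_radius_mult]) (use zR in auto)
  have r2: "ereal (cmod z) < fps_conv_radius (1 + fps_X * strip h)"
    by (rule less_le_trans[OF _ fps_conv_radius_add]) (use r1 in auto)
  have r3: "ereal (cmod z) < fps_conv_radius (h - fps_const (fps_nth h 0))"
    by (rule less_le_trans[OF _ fps_conv_radius_diff]) (use zR in auto)
  have r4: "ereal (cmod z) < fps_conv_radius (fps_const (fps_nth h 1) * fps_X)"
    by (rule less_le_trans[OF _ fps_conv_radius_mult]) auto
  have r5: "ereal (cmod z) < fps_conv_radius (h - fps_const (fps_nth h 0) - fps_const (fps_nth h 1) * fps_X)"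
    by (rule less_le_trans[OF _ fps_conv_radius_diff]) (use r3 r4 in auto)
  have r6: "ereal (cmod z) < fps_conv_radius (fps_const (1 - fps_nth h 1) * fps_X ^ 2)"
    by (rule less_le_trans[OF _ fps_conv_radius_mult]) auto
  have "(?H - fps_nth h 0 - fps_nth h 1 * z) * (1 + z * ?H') = (1 - fps_nth h 1) * z ^ 2 * ?H'"
    using arg_cong[OF strip_identity[OF h1], of "\<lambda>f. eval_fps f z"] r1 r2 r3 r4 r5 r6 zR
    by (simp add: eval_fps_mult eval_fps_add eval_fps_diff)
  moreover have "1 + z * ?H' \<noteq> 0" using M z by (simp add: field_simps)
  ultimately have "?H = fps_nth h 0 + fps_nth h 1 * z + (1 - fps_nth h 1) * z ^ 2 * ?H' / (1 + z * ?H')"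
    by (simp add: field_simps)
  also have "(1 - fps_nth h 1) * z ^ 2 * ?H' / (1 + z * ?H')
      = (1 - fps_nth h 1) * z - (1 - fps_nth h 1) / (1 / z + ?H')"
  proof -
    have "1 / z + ?H' = (1 + z * ?H') / z" using z by (simp add: field_simps)
    then show ?thesis using \<open>1 + z * ?H' \<noteq> 0\<close> z
      by (simp add: divide_simps) (simp add: algebra_simps power2_eq_square)
  qed
  finally show ?thesis by (simp add: algebra_simps)
qed

section \<open>Stretched exponential weights\<close>

text \<open>The power 9/8 exceeds 1, so the reciprocals are summable uniformly in
  \<open>\<theta>\<close>, even at \<open>\<theta> = 0\<close>. It is also small enough that
  coefficients of size \<open>k powr (- (9/4))\<close> remain summable against it, because
  \<open>9/4 - 9/8 > 1\<close>.\<close>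

definition gevrey_weight :: "real \<Rightarrow> real \<Rightarrow> nat \<Rightarrow> real" where
  "gevrey_weight \<beta> \<theta> m = (1 + real m) powr (9/8) * exp (\<theta> * real m powr \<beta>)"

lemma gevrey_weight_0 [simp]: "gevrey_weight \<beta> \<theta> 0 = 1"
  by (simp add: gevrey_weight_def)

lemma gevrey_weight_pos: "0 < gevrey_weight \<beta> \<theta> m"
  by (simp add: gevrey_weight_def)

text \<open>Concavity of the power function, in the form that its increments over a step
  \<open>b\<close> decrease.\<close>

lemma powr_add_diff_antimono:
  fixes \<beta> a b :: real
  assumes "0 < \<beta>" "\<beta> \<le> 1" "0 \<le> p" "0 \<le> a" "0 \<le> b"
  shows "(p + a + b) powr \<beta> + p powr \<beta> \<le> (p + a) powr \<beta> + (p + b) powr \<beta>"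
proof (cases "a = 0 \<or> b = 0")
  case False
  then have ab: "0 < a" "0 < b" using assms by auto
  let ?f = "\<lambda>x. (x + b) powr \<beta> - x powr \<beta>"
  have "?f (p + a) \<le> ?f p"
  proof (rule DERIV_nonpos_imp_decreasing_open[where f = ?f and a = p and b = "p + a"])
    show "p \<le> p + a" using ab by simp
    show "continuous_on {p..p+a} ?f"
      using assms ab by (intro continuous_intros continuous_on_powr') auto
    fix x assume x: "p < x" "x < p + a"
    have "(?f has_real_derivative (\<beta> * (x + b) powr (\<beta> - 1) - \<beta> * x powr (\<beta> - 1))) (at x)"
      using x assms ab by (auto intro!: derivative_eq_intros)
    moreover have "(x + b) powr (\<beta> - 1) \<le> x powr (\<beta> - 1)"
      using x assms ab by (intro powr_mono2') auto
    ultimately show "\<exists>y. (?f has_real_derivative y) (at x) \<and> y \<le> 0"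
      using assms by (intro exI conjI) (auto intro: mult_left_mono)
  qed
  then show ?thesis by simp
qed auto

text \<open>Both factors are log-concave: for the linear terms the two sides differ by
  \<open>a * b\<close>, for the exponential it is concavity of the power. Since the weight is 1 at
  0, the case \<open>p = 0\<close> is submultiplicativity.\<close>

lemma gevrey_weight_log_concave:
  assumes \<beta>: "0 < \<beta>" "\<beta> \<le> 1" and \<theta>: "0 \<le> \<theta>"
  shows "gevrey_weight \<beta> \<theta> (p + a + b) * gevrey_weight \<beta> \<theta> p
    \<le> gevrey_weight \<beta> \<theta> (p + a) * gevrey_weight \<beta> \<theta> (p + b)"
proof -
  have "(1 + real (p + a + b)) * (1 + real p) \<le> (1 + real (p + a)) * (1 + real (p + b))"
    by (simp add: algebra_simps)
  then have 1: "((1 + real (p + a + b)) * (1 + real p)) powr (9/8)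
      \<le> ((1 + real (p + a)) * (1 + real (p + b))) powr (9/8)"
    by (intro powr_mono2) auto
  have "\<theta> * (real (p + a + b) powr \<beta> + real p powr \<beta>) \<le> \<theta> * (real (p + a) powr \<beta> + real (p + b) powr \<beta>)"
    using powr_add_diff_antimono[OF \<beta>, of p a b] \<theta> by (intro mult_left_mono) auto
  then have 2: "exp (\<theta> * (real (p + a + b) powr \<beta> + real p powr \<beta>))
      \<le> exp (\<theta> * (real (p + a) powr \<beta> + real (p + b) powr \<beta>))" by simp
  show ?thesis
    using mult_mono[OF 1 2] by (simp add: gevrey_weight_def powr_mult exp_add distrib_left[of \<theta>] mult_ac)
qed

lemma gevrey_weight_mono:
  assumes "0 < \<beta>" "0 \<le> \<theta>" "m \<le> n"
  shows "gevrey_weight \<beta> \<theta> m \<le> gevrey_weight \<beta> \<theta> n"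
  unfolding gevrey_weight_def using assms
  by (intro mult_mono powr_mono2 iffD2[OF exp_le_cancel_iff] mult_left_mono) auto

text \<open>By submultiplicativity the weight at 1 is a valid ratio, and \<open>12 = 4 * 3\<close>
  bounds \<open>2 powr (9/8) * exp \<theta>\<close> for every
  \<open>\<theta> \<le> 1\<close>.\<close>

lemma gevrey_weight_Suc:
  assumes \<beta>: "0 < \<beta>" "\<beta> \<le> 1" and \<theta>: "0 \<le> \<theta>" "\<theta> \<le> 1"
  shows "gevrey_weight \<beta> \<theta> (Suc k) \<le> 12 * gevrey_weight \<beta> \<theta> k"
proof -
  have "gevrey_weight \<beta> \<theta> 1 = 2 powr (9/8) * exp \<theta>" by (simp add: gevrey_weight_def)
  also have "\<dots> \<le> 2 powr 2 * exp 1" using \<theta> by (intro mult_mono powr_mono) auto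
  also have "\<dots> \<le> 4 * 3" using exp_le by (intro mult_mono) auto
  finally have "gevrey_weight \<beta> \<theta> 1 * gevrey_weight \<beta> \<theta> k \<le> 12 * gevrey_weight \<beta> \<theta> k"
    using gevrey_weight_pos[of \<beta> \<theta> k] by (intro mult_right_mono) auto
  moreover have "gevrey_weight \<beta> \<theta> (Suc k) \<le> gevrey_weight \<beta> \<theta> 1 * gevrey_weight \<beta> \<theta> k"
    using gevrey_weight_log_concave[OF \<beta> \<theta>(1), of 0 1 k] by simp
  ultimately show ?thesis by linarith
qed

lemma summable_powr_Suc: "summable (\<lambda>n. (1 + real n) powr (- (9/8)))"
proof -
  have "summable (\<lambda>n. real n powr (- (9/8)))" by (subst summable_real_powr_iff) simp
  then have "summable (\<lambda>n. real (Suc n) powr (- (9/8)))"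
    using summable_Suc_iff[of "\<lambda>n. real n powr (- (9/8))"] by blast
  then show ?thesis by (simp add: add.commute)
qed

lemma sum_inverse_gevrey_weight_le:
  assumes "0 \<le> \<theta>"
  shows "(\<Sum>n<N. 1 / gevrey_weight \<beta> \<theta> (2 * n + 1)) \<le> (\<Sum>n. (1 + real n) powr (- (9/8)))"
proof -
  have "(\<Sum>n<N. 1 / gevrey_weight \<beta> \<theta> (2 * n + 1)) \<le> (\<Sum>n<N. (1 + real n) powr (- (9/8)))"
  proof (rule sum_mono)
    fix n
    have "(1 + real n) powr (9/8) * 1 \<le> gevrey_weight \<beta> \<theta> (2 * n + 1)"
      unfolding gevrey_weight_def using assms by (intro mult_mono powr_mono2) auto
    then have "inverse (gevrey_weight \<beta> \<theta> (2 * n + 1)) \<le> inverse ((1 + real n) powr (9/8))"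
      by (intro le_imp_inverse_le) auto
    then show "1 / gevrey_weight \<beta> \<theta> (2 * n + 1) \<le> (1 + real n) powr (- (9/8))"
      unfolding powr_minus inverse_eq_divide by simp
  qed
  also have "\<dots> \<le> (\<Sum>n. (1 + real n) powr (- (9/8)))"
    by (intro sum_le_suminf summable_powr_Suc) auto
  finally show ?thesis .
qed

text \<open>Convexity of \<open>exp\<close>. A norm that is small at \<open>\<theta> = 0\<close> and
  merely finite at \<open>\<theta> = 1\<close> is thus small for some positive
  \<open>\<theta>\<close>.\<close>

lemma gevrey_weight_interpolate:
  assumes "0 \<le> \<theta>" "\<theta> \<le> 1"
  shows "gevrey_weight \<beta> \<theta> m \<le> gevrey_weight \<beta> 0 m + \<theta> * gevrey_weight \<beta> 1 m"
proof -
  let ?t = "real m powr \<beta>"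
  have "exp ((1 - \<theta>) *\<^sub>R 0 + \<theta> *\<^sub>R ?t) \<le> (1 - \<theta>) * exp 0 + \<theta> * exp ?t"
    by (rule convex_onD[OF exp_convex]) (use assms in auto)
  then have "exp (\<theta> * ?t) \<le> 1 + \<theta> * exp ?t" using assms by simp
  then have "(1 + real m) powr (9/8) * exp (\<theta> * ?t) \<le> (1 + real m) powr (9/8) * (1 + \<theta> * exp ?t)"
    by (intro mult_left_mono) auto
  then show ?thesis by (simp add: gevrey_weight_def algebra_simps)
qed

text \<open>The first row \<open>b0\<close>, \<open>c0\<close> is free; the remaining rows are the continued fraction expansion
  of \<open>1/z + h\<close>.\<close>

lemma jacobi_from_weyl_function:
  fixes b0 c0 :: complex
  assumes \<beta>: "0 < \<beta>" "\<beta> \<le> 1" and \<theta>: "0 < \<theta>" "\<theta> \<le> 1"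
    and h: "weighted_bound (gevrey_weight \<beta> \<theta>) h \<eta>"
    and small: "26 * (1 + (\<Sum>n. (1 + real n) powr (- (9/8))))\<^sup>2 * \<eta> \<le> 1"
  shows "\<exists>J \<in> jacobi_class \<beta>. \<forall>z. z \<noteq> 0 \<longrightarrow> cmod z < 1 \<longrightarrow>
    ((z + 1 / z) / 2 \<in> ell2_spectrum (matrix_op J) \<longleftrightarrow>
       (z\<^sup>2 + 1 - 2 * b0 * z) * (1 + z * eval_fps h z) = 2 * c0 * z\<^sup>2)"
proof -
  define S where "S = (\<Sum>n. (1 + real n) powr (- (9/8)))"
  define hs where "hs n = (strip ^^ n) h" for n
  let ?\<omega> = "gevrey_weight \<beta> \<theta>"
  note \<omega>0 = gevrey_weight_pos[of \<beta> \<theta>]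
  have S: "(\<Sum>n<N. 1 / ?\<omega> (2 * n + 1)) \<le> S" for N
    unfolding S_def using \<theta> by (intro sum_inverse_gevrey_weight_le) auto
  have S0: "0 \<le> S" using S[of 0] by simp
  have \<eta>: "0 \<le> \<eta>" using weighted_bound_nonneg[OF h] .
  define D where "D = \<eta> * (1 + S)"
  have D0: "0 \<le> D" using \<eta> S0 by (simp add: D_def)
  have D: "26 * D \<le> 1"
  proof -
    have "26 * D * 1 \<le> 26 * D * (1 + S)" using D0 S0 by (intro mult_left_mono) auto
    moreover have "26 * D * (1 + S) = 26 * (1 + S)\<^sup>2 * \<eta>" by (simp add: D_def power2_eq_square)
    ultimately show ?thesis using small unfolding S_def by linarith
  qed
  have wb: "weighted_bound (\<lambda>k. ?\<omega> (2 * n + k)) (hs n) D" for n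
  proof (rule weighted_bound_mono)
    show "weighted_bound (\<lambda>k. ?\<omega> (2 * n + k)) (hs n) (\<eta> * (1 + (\<Sum>i<n. 1 / ?\<omega> (2 * i + 1))))"
      unfolding hs_def
    \<comment> \<open>With \<open>L = 12\<close> the factor \<open>2 * (1 + L)\<close> is the 26 of
      the hypothesis \<open>small\<close>.\<close>
    proof (rule weighted_bound_strip_funpow[where L = 12 and S = S])
      show "?\<omega> (p + a + b) * ?\<omega> p \<le> ?\<omega> (p + a) * ?\<omega> (p + b)" for p a b
        by (rule gevrey_weight_log_concave) (use \<beta> \<theta> in auto)
      show "?\<omega> (Suc k) \<le> 12 * ?\<omega> k" for k
        by (rule gevrey_weight_Suc) (use \<beta> \<theta> in auto)
      show "?\<omega> m \<le> ?\<omega> (Suc m)" for m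
        by (rule gevrey_weight_mono) (use \<beta> \<theta> in auto)
    qed (use \<omega>0 S h small in \<open>auto simp: S_def\<close>)
    show "\<eta> * (1 + (\<Sum>i<n. 1 / ?\<omega> (2 * i + 1))) \<le> D"
      unfolding D_def using S \<eta> by (intro mult_left_mono) auto
  qed
  have \<omega>n: "?\<omega> (2 * n) \<le> ?\<omega> (2 * n + k)" for n k
    by (rule gevrey_weight_mono) (use \<beta> \<theta> in auto)
  have \<omega>1: "1 \<le> ?\<omega> n" for n
    using gevrey_weight_mono[OF \<beta>(1), of \<theta> 0 n] \<theta> by simp
  have coeff: "cmod (fps_nth (hs n) k) \<le> D / ?\<omega> (2 * n)" for n k
  proof -
    have "?\<omega> (2 * n) * cmod (fps_nth (hs n) k) \<le> ?\<omega> (2 * n + k) * cmod (fps_nth (hs n) k)"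
      by (intro mult_right_mono \<omega>n) auto
    also have "\<dots> \<le> D" by (rule weighted_bound_nth[OF wb]) (use \<omega>0 in \<open>auto simp: less_imp_le\<close>)
    finally show ?thesis using \<omega>0[of "2 * n"] by (simp add: field_simps)
  qed
  have ev: "cmod (eval_fps (hs n) z) \<le> D / ?\<omega> (2 * n)" if "cmod z < 1" for n z
    by (rule norm_eval_fps_le[OF wb \<omega>n \<omega>0 that])
  have D\<omega>: "D / ?\<omega> n \<le> D" for n
    using \<omega>1[of n] D0 \<omega>0[of n] by (simp add: divide_le_eq mult_left_le_one_le mult_le_cancel_left1)
  have R: "1 \<le> fps_conv_radius (hs n)" for n
    by (rule fps_conv_radius_ge_1) (rule coeff)
  \<comment> \<open>Row \<open>Suc m\<close> is read off \<open>hs m\<close> by comparing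
    \<open>strip_eval\<close> with the pivot recursion: \<open>2 b\<close> is minus the constant
    coefficient, \<open>2 c\<close> is 1 minus the linear one.\<close>
  define b where "b = (\<lambda>n. case n of 0 \<Rightarrow> b0 | Suc m \<Rightarrow> - fps_nth (hs m) 0 / 2)"
  define c where "c = (\<lambda>n. case n of 0 \<Rightarrow> c0 | Suc m \<Rightarrow> (1 - fps_nth (hs m) 1) / 2)"
  have \<omega>exp: "D / ?\<omega> (2 * n) \<le> D * exp (- \<theta> * real (2 * n) powr \<beta>)" for n
  proof -
    have "1 * exp (\<theta> * real (2 * n) powr \<beta>) \<le> ?\<omega> (2 * n)"
      unfolding gevrey_weight_def by (intro mult_right_mono ge_one_powr_ge_zero) auto
    then have "inverse (?\<omega> (2 * n)) \<le> inverse (exp (\<theta> * real (2 * n) powr \<beta>))"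
      by (intro le_imp_inverse_le) auto
    then show ?thesis using D0 unfolding divide_inverse
      by (intro mult_left_mono) (auto simp: exp_minus)
  qed
  \<comment> \<open>The factor \<open>exp \<theta>\<close> pays for row 1, whose entries are bounded
    by the weight at 0. From row 2 on, the weight index \<open>2 m\<close> is at least the row
    index. The remaining summands cover the free row 0 and make \<open>C1\<close> positive.\<close>
  define C1 where "C1 = D * exp \<theta> + cmod (c0 - 1/2) + cmod b0 + 1"
  have C1: "0 < C1" unfolding C1_def using D0 by (intro add_nonneg_pos add_nonneg_nonneg) auto
  have decay: "cmod (1/2 - 1/2) + cmod (c n - 1/2) + cmod (b n) \<le> C1 * exp (- \<theta> * real n powr \<beta>)" for n
  proof (cases n)
    case 0
    then show ?thesis using D0 by (simp add: b_def c_def C1_def)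
  next
    case (Suc m)
    have "c n - 1/2 = - fps_nth (hs m) 1 / 2" by (simp add: c_def Suc field_simps)
    then have "cmod (1/2 - 1/2) + cmod (c n - 1/2) + cmod (b n)
        = cmod (fps_nth (hs m) 1) / 2 + cmod (fps_nth (hs m) 0) / 2"
      by (simp add: b_def Suc norm_divide)
    also have "\<dots> \<le> D / ?\<omega> (2 * m)" using coeff[of m 0] coeff[of m 1] by linarith
    also have "\<dots> \<le> D * exp (- \<theta> * real (2 * m) powr \<beta>)" by (rule \<omega>exp)
    also have "\<dots> \<le> D * exp (\<theta> - \<theta> * real n powr \<beta>)"
    proof (intro mult_left_mono D0 iffD2[OF exp_le_cancel_iff])
      have "real n powr \<beta> \<le> real (2 * m) powr \<beta> + 1"
      proof (cases m)
        case (Suc l)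
        have "real n powr \<beta> \<le> real (2 * m) powr \<beta>"
          using \<beta> Suc \<open>n = Suc m\<close> by (intro powr_mono2) auto
        then show ?thesis by simp
      qed (use Suc in auto)
      then have "\<theta> * real n powr \<beta> \<le> \<theta> * (real (2 * m) powr \<beta> + 1)" using \<theta> by (intro mult_left_mono) auto
      then show "- \<theta> * real (2 * m) powr \<beta> \<le> \<theta> - \<theta> * real n powr \<beta>" by (simp add: algebra_simps)
    qed
    also have "\<dots> = D * exp \<theta> * exp (- \<theta> * real n powr \<beta>)" by (simp flip: exp_add)
    also have "\<dots> \<le> C1 * exp (- \<theta> * real n powr \<beta>)"
      unfolding C1_def by (intro mult_right_mono) auto
    finally show ?thesis .
  qed
  let ?J = "jacobi_matrix (\<lambda>_. 1/2) b c"
  have J: "?J \<in> jacobi_class \<beta>"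
    unfolding jacobi_class_def using decay C1 \<theta>(1) by blast
  have bd: "cmod (b n) \<le> C1 + 1" "cmod (c n) \<le> C1 + 1" for n
  proof -
    have "exp (- \<theta> * real n powr \<beta>) \<le> 1" using \<theta> by simp
    then have "C1 * exp (- \<theta> * real n powr \<beta>) \<le> C1 * 1" using C1 by (intro mult_left_mono) auto
    then have 1: "cmod (c n - 1/2) + cmod (b n) \<le> C1" using decay[of n] by simp
    then show "cmod (b n) \<le> C1 + 1" using norm_ge_zero[of "c n - 1/2"] by linarith
    have "cmod (c n) \<le> cmod (c n - 1/2) + 1/2"
      using norm_triangle_sub[of "c n" "1/2"] by (simp add: norm_divide)
    then show "cmod (c n) \<le> C1 + 1" using 1 norm_ge_zero[of "b n"] by linarith
  qed
  have lim0: "(\<lambda>n. D / ?\<omega> (2 * n)) \<longlonglongrightarrow> 0"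
  proof (rule Lim_null_comparison)
    show "\<forall>\<^sub>F n in sequentially. norm (D / ?\<omega> (2 * n)) \<le> D * (1 + real n) powr (- (9/8))"
    proof (rule always_eventually, rule allI)
      fix n
      have "(1 + real n) powr (9/8) * 1 \<le> ?\<omega> (2 * n)"
        unfolding gevrey_weight_def using \<theta> by (intro mult_mono powr_mono2) auto
      then have "inverse (?\<omega> (2 * n)) \<le> inverse ((1 + real n) powr (9/8))"
        by (intro le_imp_inverse_le) auto
      then have "D * inverse (?\<omega> (2 * n)) \<le> D * inverse ((1 + real n) powr (9/8))"
        using D0 by (rule mult_left_mono)
      moreover have "norm (D / ?\<omega> (2 * n)) = D * inverse (?\<omega> (2 * n))"
        using D0 \<omega>0[of "2 * n"] by (simp add: divide_inverse)
      ultimately show "norm (D / ?\<omega> (2 * n)) \<le> D * (1 + real n) powr (- (9/8))"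
        unfolding powr_minus by simp
    qed
    show "(\<lambda>n. D * (1 + real n) powr (- (9/8))) \<longlonglongrightarrow> 0"
      using tendsto_mult[OF tendsto_const[of D] summable_LIMSEQ_zero[OF summable_powr_Suc]] by simp
  qed
  have c_lim: "c \<longlonglongrightarrow> 1/2"
  proof (rule LIMSEQ_imp_Suc)
    have "(\<lambda>n. fps_nth (hs n) 1) \<longlonglongrightarrow> 0"
      by (rule Lim_null_comparison[OF _ lim0]) (use coeff in auto)
    then have "(\<lambda>n. (1 - fps_nth (hs n) 1) / 2) \<longlonglongrightarrow> (1 - 0) / 2"
      by (intro tendsto_intros) auto
    then show "(\<lambda>n. c (Suc n)) \<longlonglongrightarrow> 1/2" by (simp add: c_def)
  qed
  have "(z + 1 / z) / 2 \<in> ell2_spectrum (matrix_op ?J) \<longleftrightarrow>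
       (z\<^sup>2 + 1 - 2 * b0 * z) * (1 + z * eval_fps h z) = 2 * c0 * z\<^sup>2"
    if z: "z \<noteq> 0" "cmod z < 1" for z
  proof -
    define m where "m n = 1 / z + eval_fps (hs n) z" for n
    \<comment> \<open>The later pivots are values of the expansion, whereas \<open>M 0\<close> is
      whatever the equation of row 0 forces; its vanishing is the characteristic equation.\<close>
    define M where "M = (\<lambda>n. case n of 0 \<Rightarrow> z + 1 / z - 2 * b0 - 2 * c0 / m 0 | Suc n \<Rightarrow> m n)"
    have m0: "m n \<noteq> 0" for n
    proof
      assume "m n = 0"
      then have "eval_fps (hs n) z = - (1 / z)" by (simp add: m_def add_eq_0_iff)
      then have "1 / cmod z \<le> D" using order_trans[OF ev[OF z(2), of n] D\<omega>] by (simp add: norm_divide)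
      moreover have "1 < 1 / cmod z" using z by simp
      ultimately show False using D D0 by linarith
    qed
    have h1: "fps_nth (hs n) 1 \<noteq> 1" for n
    proof
      assume "fps_nth (hs n) 1 = 1"
      then have "1 \<le> D" using order_trans[OF coeff[of n 1] D\<omega>] by simp
      then show False using D by linarith
    qed
    have strip_m: "m n = z + 1 / z + fps_nth (hs n) 0 - (1 - fps_nth (hs n) 1) / m (Suc n)" for n
    proof -
      have hs: "hs (Suc n) = strip (hs n)" by (simp add: hs_def)
      show ?thesis
        using R[of "Suc n"] m0[of "Suc n"] unfolding m_def hs
        by (rule strip_eval[OF h1 R _ z])
    qed
    have b_eq: "2 * b n = z + 1 / z - M n - 2 * c n / M (Suc n)" for n
    proof (cases n)
      case (Suc k)
      have "2 * b n = - fps_nth (hs k) 0" "2 * c n = 1 - fps_nth (hs k) 1"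
        by (simp_all add: b_def c_def Suc)
      then show ?thesis using strip_m[of k] by (simp add: M_def Suc)
    qed (simp add: b_def c_def M_def)
    have M_Suc: "M (Suc n) \<noteq> 0" for n using m0 by (simp add: M_def)
    have M_lim: "M \<longlonglongrightarrow> 1 / z"
    proof (rule LIMSEQ_imp_Suc)
      have "(\<lambda>n. eval_fps (hs n) z) \<longlonglongrightarrow> 0"
        by (rule Lim_null_comparison[OF _ lim0]) (use ev z in auto)
      then have "(\<lambda>n. 1 / z + eval_fps (hs n) z) \<longlonglongrightarrow> 1 / z + 0" by (intro tendsto_intros)
      then show "(\<lambda>n. M (Suc n)) \<longlonglongrightarrow> 1 / z" by (simp add: M_def m_def)
    qed
    have z': "0 < cmod z" "cmod z < 1" using z by auto
    have "(z + 1 / z) / 2 \<in> ell2_spectrum (matrix_op ?J) \<longleftrightarrow> M 0 = 0"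
    proof
      assume "M 0 = 0"
      show "(z + 1 / z) / 2 \<in> ell2_spectrum (matrix_op ?J)"
        by (rule jacobi_spectrum[of M b "z + 1 / z" c z]) (fact M_Suc \<open>M 0 = 0\<close> b_eq M_lim z')+
    next
      assume sp: "(z + 1 / z) / 2 \<in> ell2_spectrum (matrix_op ?J)"
      show "M 0 = 0"
      proof (rule ccontr)
        assume "M 0 \<noteq> 0"
        then have M_nz: "M n \<noteq> 0" for n using M_Suc by (cases n) auto
        have "(z + 1 / z) / 2 \<in> ell2_resolvent_set (matrix_op ?J)"
          by (rule jacobi_resolvent[of M b "z + 1 / z" c z "C1 + 1"])
            (fact M_nz b_eq M_lim c_lim z' bd)+
        then show False using sp by (simp add: ell2_spectrum_def)
      qed
    qed
    also have "\<dots> \<longleftrightarrow> (z + 1 / z - 2 * b0) * m 0 = 2 * c0"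
      using m0[of 0] by (simp add: M_def field_simps)
    also have "\<dots> \<longleftrightarrow> (z * (z + 1 / z - 2 * b0)) * (z * m 0) = 2 * c0 * z\<^sup>2"
    proof -
      have "(z * (z + 1 / z - 2 * b0)) * (z * m 0) = ((z + 1 / z - 2 * b0) * m 0) * z\<^sup>2"
        by (simp add: power2_eq_square mult_ac)
      moreover have "z\<^sup>2 \<noteq> 0" using z by simp
      ultimately show ?thesis by (metis mult_right_cancel)
    qed
    also have "z * (z + 1 / z - 2 * b0) = z\<^sup>2 + 1 - 2 * b0 * z"
      using z by (simp add: field_simps power2_eq_square)
    also have "z * m 0 = 1 + z * eval_fps h z"
      using z by (simp add: m_def hs_def field_simps)
    finally show ?thesis .
  qed
  then show ?thesis using J by blast
qed

section \<open>Taylor coefficients of functions singular at 1\<close>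

text \<open>On the circle \<open>cnj u = r\<^sup>2 / u\<close>, so the integrand times
  \<open>du / u\<close> is \<open>du / ((1 - u) (u - r\<^sup>2))\<close>. Cauchy's formula at the
  interior point \<open>r\<^sup>2\<close> evaluates it.\<close>

lemma circle_mean_Poisson:
  assumes r: "0 < r" "r < 1"
  shows "((\<lambda>t. 1 / (cmod (1 - circlepath 0 r t))\<^sup>2) has_integral 1 / (1 - r\<^sup>2)) {0..1}"
proof -
  let ?\<gamma> = "circlepath 0 r"
  have ne: "1 - u \<noteq> 0" if "cmod u \<le> r" for u :: complex
    using that r by auto
  have r2: "r\<^sup>2 < r" "r\<^sup>2 < 1"
    using r power_strict_decreasing[of 1 2 r] power_strict_decreasing[of 0 2 r] by auto
  have "((\<lambda>u. 1 / (1 - u) / (u - of_real (r\<^sup>2))) has_contour_integral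
      2 * of_real pi * \<i> * (1 / (1 - of_real (r\<^sup>2)))) ?\<gamma>"
  proof (rule Cauchy_integral_circlepath)
    show "continuous_on (cball 0 r) (\<lambda>u::complex. 1 / (1 - u))"
      by (intro continuous_on_divide continuous_on_diff continuous_on_const continuous_on_id)
        (use ne in auto)
    show "(\<lambda>u. 1 / (1 - u)) holomorphic_on ball 0 r"
      by (intro holomorphic_on_divide holomorphic_on_diff holomorphic_on_const holomorphic_on_ident)
        (use ne in auto)
    show "cmod (of_real (r\<^sup>2) - 0) < r" using r2 r by (simp add: norm_power)
  qed
  then have "((\<lambda>t. 1 / (1 - ?\<gamma> t) / (?\<gamma> t - of_real (r\<^sup>2)) * vector_derivative ?\<gamma> (at t within {0..1}))
      has_integral 2 * of_real pi * \<i> * (1 / (1 - of_real (r\<^sup>2)))) {0..1}"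
    unfolding has_contour_integral_def .
  from has_integral_mult_right[OF this, of "1 / (2 * of_real pi * \<i>)"]
  have "((\<lambda>t. 1 / (2 * of_real pi * \<i>) * (1 / (1 - ?\<gamma> t) / (?\<gamma> t - of_real (r\<^sup>2)) *
      vector_derivative ?\<gamma> (at t within {0..1}))) has_integral of_real (1 / (1 - r\<^sup>2))) {0..1}"
    by simp
  then have "((\<lambda>t. complex_of_real (1 / (cmod (1 - ?\<gamma> t))\<^sup>2)) has_integral of_real (1 / (1 - r\<^sup>2))) {0..1}"
  proof (rule has_integral_eq[rotated])
    fix t :: real assume t: "t \<in> {0..1}"
    define u where "u = ?\<gamma> t"
    have u: "cmod u = r" using r by (simp add: u_def circlepath norm_mult)
    have u0: "u \<noteq> 0" "1 - u \<noteq> 0" using u r by auto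
    have vd: "vector_derivative ?\<gamma> (at t within {0..1}) = 2 * of_real pi * \<i> * u"
      using vector_derivative_circlepath01[of t 0 r] t by (simp add: u_def circlepath[of 0 r, THEN fun_cong])
    have r2u: "of_real (r\<^sup>2) = u * cnj u" using u by (simp add: complex_norm_square[symmetric])
    have "1 / (2 * of_real pi * \<i>) * (1 / (1 - u) / (u - of_real (r\<^sup>2)) * (2 * of_real pi * \<i> * u))
        = u / ((1 - u) * (u - of_real (r\<^sup>2)))" by simp
    also have "(1 - u) * (u - of_real (r\<^sup>2)) = u * ((1 - u) * cnj (1 - u))"
      unfolding r2u by (simp add: algebra_simps)
    also have "u / \<dots> = 1 / ((1 - u) * cnj (1 - u))" using u0 by simp
    also have "\<dots> = complex_of_real (1 / (cmod (1 - u))\<^sup>2)"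
      by (simp only: complex_norm_square of_real_divide of_real_1 of_real_power[symmetric])
    finally show "1 / (2 * of_real pi * \<i>) * (1 / (1 - ?\<gamma> t) / (?\<gamma> t - of_real (r\<^sup>2)) *
      vector_derivative ?\<gamma> (at t within {0..1})) = complex_of_real (1 / (cmod (1 - ?\<gamma> t))\<^sup>2)"
      unfolding vd u_def .
  qed
  from has_integral_Re[OF this] show ?thesis by simp
qed

text \<open>The mean of \<open>|1 - z|\<^sup>-\<^sup>1\<close> on the circle of radius \<open>r\<close> is at most \<open>(1 - r)\<^sup>-\<^sup>1\<^sup>/\<^sup>2\<close> by AM-GM and
  the mean of the Poisson kernel; this gains half a power of \<open>k\<close> over the supremum bound.\<close>

lemma higher_deriv_0_mean_bound:
  assumes f: "f holomorphic_on ball 0 1"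
    and K: "\<And>z. cmod z < 1 \<Longrightarrow> cmod (f z) \<le> K * cmod (1 - z) powr (- (5/4))"
    and r: "0 < r" "r < 1"
  shows "cmod ((deriv ^^ j) f 0) / fact j \<le> K * (1 - r) powr (- (3/4)) / r ^ j"
proof -
  let ?\<gamma> = "circlepath 0 r"
  have K0: "0 \<le> K" using order_trans[OF norm_ge_zero K[of 0]] by simp
  \<comment> \<open>The balance in the AM-GM inequality: the mean of \<open>1 / x\<^sup>2\<close> is
    at most \<open>\<tau>\<^sup>2\<close>, so both terms contribute at most
    \<open>\<tau>\<close>.\<close>
  define \<tau> where "\<tau> = (1 - r) powr (- (1/2))"
  have \<tau>: "0 < \<tau>" using r by (simp add: \<tau>_def)
  define c where "c = 2 * pi * K * (1 - r) powr (- (1/4)) / r ^ j"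
  have c: "0 \<le> c" using K0 r by (simp add: c_def)
  have "((\<lambda>u. f u / (u - 0) ^ Suc j) has_contour_integral (2 * pi * \<i>) / fact j * (deriv ^^ j) f 0) ?\<gamma>"
  proof (rule Cauchy_has_contour_integral_higher_derivative_circlepath)
    show "continuous_on (cball 0 r) f"
      by (rule continuous_on_subset[OF holomorphic_on_imp_continuous_on[OF f]]) (use r in auto)
    show "f holomorphic_on ball 0 r"
      by (rule holomorphic_on_subset[OF f]) (use r in auto)
  qed (use r in auto)
  then have int1: "((\<lambda>t. f (?\<gamma> t) / (?\<gamma> t - 0) ^ Suc j * vector_derivative ?\<gamma> (at t within {0..1}))
      has_integral (2 * pi * \<i>) / fact j * (deriv ^^ j) f 0) {0..1}"
    unfolding has_contour_integral_def .
  have int2: "((\<lambda>t. c * ((\<tau> + 1 / \<tau> * (1 / (cmod (1 - ?\<gamma> t))\<^sup>2)) / 2))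
      has_integral c * ((\<tau> * 1 + 1 / \<tau> * (1 / (1 - r\<^sup>2))) / 2)) {0..1}"
    using has_integral_const_real[of \<tau> 0 1]
    by (intro has_integral_mult_right has_integral_divide has_integral_add circle_mean_Poisson r) simp
  have pt: "norm (f (?\<gamma> t) / (?\<gamma> t - 0) ^ Suc j * vector_derivative ?\<gamma> (at t within {0..1}))
      \<le> c * ((\<tau> + 1 / \<tau> * (1 / (cmod (1 - ?\<gamma> t))\<^sup>2)) / 2)" if t: "t \<in> {0..1}" for t
  proof -
    define u where "u = ?\<gamma> t"
    have u: "cmod u = r" using r by (simp add: u_def circlepath norm_mult)
    have u0: "u \<noteq> 0" using u r by auto
    define x where "x = cmod (1 - u)"
    have x: "1 - r \<le> x" unfolding x_def using norm_triangle_ineq2[of 1 u] u by simp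
    then have x0: "0 < x" using r by linarith
    have vd: "vector_derivative ?\<gamma> (at t within {0..1}) = 2 * of_real pi * \<i> * u"
      using vector_derivative_circlepath01[of t 0 r] t by (simp add: u_def circlepath[of 0 r, THEN fun_cong])
    have "norm (f u / (u - 0) ^ Suc j * (2 * of_real pi * \<i> * u)) = 2 * pi * cmod (f u) / r ^ j"
      using u r u0 by (simp add: norm_mult norm_divide norm_power)
    also have "\<dots> \<le> 2 * pi * (K * x powr (- (5/4))) / r ^ j"
      using K[of u] u r unfolding x_def by (intro divide_right_mono mult_left_mono) auto
    \<comment> \<open>One factor \<open>1 / x\<close> is kept for averaging; the remaining quarter
      power is replaced by its supremum on the circle.\<close>
    also have "x powr (- (5/4)) = x powr (- (1/4)) * (1 / x)"
      using x0 powr_add[of x "- (1/4)" "-1"] by (simp add: powr_minus_divide)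
    also have "2 * pi * (K * (x powr (- (1/4)) * (1 / x))) / r ^ j
        = (2 * pi * K / r ^ j * (1 / x)) * x powr (- (1/4))" by (simp add: mult_ac)
    also have "\<dots> \<le> (2 * pi * K / r ^ j * (1 / x)) * (1 - r) powr (- (1/4))"
      using x r K0 x0 by (intro mult_left_mono powr_mono2') auto
    also have "\<dots> = c * (1 / x)" by (simp add: c_def)
    also have "\<dots> \<le> c * ((\<tau> + 1 / \<tau> * (1 / x\<^sup>2)) / 2)"
    proof (rule mult_left_mono[OF _ c])
      have "0 \<le> (\<tau> - 1 / x)\<^sup>2 / \<tau>" using \<tau> by simp
      also have "\<dots> = \<tau> + 1 / \<tau> * (1 / x\<^sup>2) - 2 * (1 / x)"
        using \<tau> x0 by (simp add: field_simps power2_eq_square)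
      finally show "1 / x \<le> (\<tau> + 1 / \<tau> * (1 / x\<^sup>2)) / 2" by simp
    qed
    finally show ?thesis unfolding vd u_def x_def .
  qed
  have "norm ((2 * pi * \<i>) / fact j * (deriv ^^ j) f 0) \<le> c * ((\<tau> * 1 + 1 / \<tau> * (1 / (1 - r\<^sup>2))) / 2)"
    using integral_norm_bound_integral[OF has_integral_integrable[OF int1] has_integral_integrable[OF int2] pt]
    by (simp only: integral_unique[OF int1] integral_unique[OF int2])
  also have "\<dots> \<le> c * \<tau>"
  proof (rule mult_left_mono[OF _ c])
    have tau2: "\<tau> * \<tau> = 1 / (1 - r)"
      unfolding \<tau>_def using r by (simp add: powr_minus_divide flip: powr_add)
    have "r\<^sup>2 \<le> r" using r power_decreasing[of 1 2 r] by simp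
    then have "1 - r \<le> 1 - r\<^sup>2" "0 < (1 - r\<^sup>2) * (1 - r)" using r by auto
    then have "1 / (1 - r\<^sup>2) \<le> \<tau> * \<tau>"
      unfolding tau2 by (intro divide_left_mono) auto
    then have "1 / \<tau> * (1 / (1 - r\<^sup>2)) \<le> 1 / \<tau> * (\<tau> * \<tau>)"
      using \<tau> by (intro mult_left_mono) auto
    also have "\<dots> = \<tau>" using \<tau> by simp
    finally have "1 / \<tau> * (1 / (1 - r\<^sup>2)) \<le> \<tau>" .
    then show "(\<tau> * 1 + 1 / \<tau> * (1 / (1 - r\<^sup>2))) / 2 \<le> \<tau>" by simp
  qed
  also have "c * \<tau> = 2 * pi * (K * ((1 - r) powr (- (1/4)) * (1 - r) powr (- (1/2))) / r ^ j)"
    by (simp add: c_def \<tau>_def)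
  also have "(1 - r) powr (- (1/4)) * (1 - r) powr (- (1/2)) = (1 - r) powr (- (3/4))"
    by (simp flip: powr_add)
  also have "norm ((2 * pi * \<i>) / fact j * (deriv ^^ j) f 0) = 2 * pi * (cmod ((deriv ^^ j) f 0) / fact j)"
    by (simp add: norm_mult norm_divide)
  finally have "(2 * pi) * (cmod ((deriv ^^ j) f 0) / fact j) \<le> (2 * pi) * (K * (1 - r) powr (- (3/4)) / r ^ j)"
    by simp
  then show ?thesis by (rule mult_left_le_imp_le) simp
qed

text \<open>The mean bound for the third derivative at radius \<open>1 - 1/k\<close> gives
  \<open>3 * K * k powr (3/4)\<close>, with \<open>(1 / r) ^ (k - 3) \<le> exp 1 \<le> 3\<close>.
  Returning to \<open>f\<close> divides by \<open>k (k - 1) (k - 2)\<close>, which is at least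
  \<open>2/9 * k ^ 3\<close> with equality at \<open>k = 3\<close>; hence the exponent 9/4 and the
  constant 27/2.\<close>

lemma norm_higher_deriv_0_le:
  assumes f: "f holomorphic_on ball 0 1"
    and K: "\<And>z. cmod z < 1 \<Longrightarrow> cmod ((deriv ^^ 3) f z) \<le> K * cmod (1 - z) powr (- (5/4))"
    and k: "3 \<le> k"
  shows "cmod ((deriv ^^ k) f 0) / fact k \<le> 27/2 * K * real k powr (- (9/4))"
proof -
  define r where "r = 1 - 1 / real k"
  have r: "0 < r" "r < 1" using k by (auto simp: r_def field_simps)
  have K0: "0 \<le> K" using order_trans[OF norm_ge_zero K[of 0]] by simp
  have "cmod ((deriv ^^ (k - 3)) ((deriv ^^ 3) f) 0) / fact (k - 3) \<le> K * (1 - r) powr (- (3/4)) / r ^ (k - 3)"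
    by (rule higher_deriv_0_mean_bound[OF _ K r]) (rule holomorphic_higher_deriv[OF f open_ball])
  also have "(deriv ^^ (k - 3)) ((deriv ^^ 3) f) = (deriv ^^ (k - 3 + 3)) f"
    by (simp only: funpow_add o_apply)
  also have "k - 3 + 3 = k" using k by simp
  also have "(1 - r) powr (- (3/4)) = real k powr (3/4)"
    unfolding r_def using k by (simp add: powr_minus powr_divide)
  also have "K * real k powr (3/4) / r ^ (k - 3) \<le> K * real k powr (3/4) * 3"
  proof -
    have "1 / r = 1 + 1 / real (k - 1)" using k unfolding r_def by (simp add: field_simps of_nat_diff)
    then have "(1 / r) ^ (k - 1) = (1 + 1 / real (k - 1)) ^ (k - 1)" by simp
    also have "\<dots> \<le> exp 1" by (rule exp_ge_one_plus_x_over_n_power_n) (use k in auto)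
    also have "\<dots> \<le> 3" by (rule exp_le)
    finally have "(1 / r) ^ (k - 1) \<le> 3" .
    moreover have "(1 / r) ^ (k - 3) \<le> (1 / r) ^ (k - 1)" using r by (intro power_increasing) auto
    ultimately have "(1 / r) ^ (k - 3) \<le> 3" by linarith
    then have "K * real k powr (3/4) * (1 / r) ^ (k - 3) \<le> K * real k powr (3/4) * 3"
      using K0 by (intro mult_left_mono) auto
    then show ?thesis by (simp add: power_one_over)
  qed
  finally have 1: "cmod ((deriv ^^ k) f 0) / fact (k - 3) \<le> K * real k powr (3/4) * 3" .
  have fact_k: "fact k = real k * (real k - 1) * (real k - 2) * fact (k - 3)"
  proof -
    define m where "m = k - 3"
    have m: "k = Suc (Suc (Suc m))" using k by (simp add: m_def)
    show ?thesis unfolding m by (simp add: algebra_simps)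
  qed
  define P where "P = real k * (real k - 1) * (real k - 2)"
  have P: "2/9 * real k ^ 3 \<le> P"
  proof -
    have "0 \<le> real k * ((real k - 3) * (7 * real k - 6))" using k by (intro mult_nonneg_nonneg) auto
    then show ?thesis unfolding P_def by (simp add: algebra_simps power3_eq_cube)
  qed
  have k3: "0 < real k ^ 3" using k by simp
  then have P0: "0 < P" using P by linarith
  have "cmod ((deriv ^^ k) f 0) / fact k = cmod ((deriv ^^ k) f 0) / fact (k - 3) / P"
    unfolding fact_k P_def by simp
  also have "\<dots> \<le> K * real k powr (3/4) * 3 / P" using 1 P0 by (intro divide_right_mono) auto
  also have "\<dots> \<le> K * real k powr (3/4) * 3 / (2/9 * real k ^ 3)"
    using P mult_pos_pos[OF P0 k3] K0 by (intro divide_left_mono) auto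
  also have "\<dots> = 27/2 * K * (real k powr (3/4) / real k powr 3)"
    using k by (simp add: powr_numeral)
  also have "real k powr (3/4) / real k powr 3 = real k powr (- (9/4))"
    unfolding powr_diff[symmetric] by simp
  finally show ?thesis .
qed

text \<open>Cauchy's inequality for the \<open>n\<close>-th derivative on circles of radius
  \<open>r < 1\<close>, with \<open>r\<close> tending to 1.\<close>

lemma norm_higher_deriv_0_le_sup:
  assumes f: "f holomorphic_on ball 0 1"
    and B: "\<And>z. cmod z < 1 \<Longrightarrow> cmod ((deriv ^^ n) f z) \<le> B" and n: "n \<le> k"
  shows "cmod ((deriv ^^ k) f 0) \<le> fact (k - n) * B"
proof -
  let ?F = "(deriv ^^ n) f"
  have F: "?F holomorphic_on ball 0 1" by (rule holomorphic_higher_deriv[OF f]) auto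
  have "(deriv ^^ (k - n)) ?F = (deriv ^^ (k - n + n)) f" by (simp only: funpow_add o_apply)
  then have eq: "(deriv ^^ (k - n)) ?F = (deriv ^^ k) f" using n by simp
  have "cmod ((deriv ^^ k) f 0) \<le> fact (k - n) * B / r ^ (k - n)" if r: "0 < r" "r < 1" for r
    unfolding eq[symmetric]
  proof (rule Cauchy_inequality)
    show "?F holomorphic_on ball 0 r" by (rule holomorphic_on_subset[OF F]) (use r in auto)
    show "continuous_on (cball 0 r) ?F"
      by (rule continuous_on_subset[OF holomorphic_on_imp_continuous_on[OF F]]) (use r in auto)
  qed (use r B in auto)
  then have "eventually (\<lambda>r. cmod ((deriv ^^ k) f 0) \<le> fact (k - n) * B / r ^ (k - n)) (at_left 1)"
    using eventually_at_left_real[of 0 "1::real"] by (auto elim: eventually_mono)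
  moreover have "((\<lambda>r::real. fact (k - n) * B / r ^ (k - n)) \<longlongrightarrow> fact (k - n) * B / 1 ^ (k - n)) (at_left 1)"
    by (intro tendsto_intros) auto
  ultimately have "cmod ((deriv ^^ k) f 0) \<le> fact (k - n) * B / 1 ^ (k - n)"
    by (intro tendsto_lowerbound[of _ _ "at_left (1::real)"]) auto
  then show ?thesis by simp
qed

lemma exp_uminus_le_powr:
  fixes t q :: real
  assumes "0 < t" "0 < q"
  shows "exp (- t) \<le> (q / t) powr q"
proof -
  have "t / q \<le> exp (t / q)" using exp_ge_add_one_self[of "t / q"] by linarith
  then have "(t / q) powr q \<le> exp (t / q) powr q" using assms by (intro powr_mono2) auto
  also have "\<dots> = exp t" using assms by (simp add: powr_def)
  finally have "inverse (exp t) \<le> inverse ((t / q) powr q)"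
    using assms by (intro le_imp_inverse_le) auto
  then show ?thesis using assms by (simp add: exp_minus powr_divide)
qed

text \<open>The bound is optimized at \<open>n \<approx> (k / (e D))\<^sup>\<alpha>\<^sup>/\<^sup>(\<^sup>1\<^sup>+\<^sup>\<alpha>\<^sup>)\<close>.\<close>

lemma stretched_exponential_of_powers:
  fixes \<alpha> A D x :: real
  assumes \<alpha>: "0 < \<alpha>" and A: "0 \<le> A" and D: "1 \<le> D"
    and b: "\<And>n. 1 \<le> n \<Longrightarrow> n \<le> k \<Longrightarrow> x \<le> A * (D * real n powr (1 + 1 / \<alpha>) / real k) ^ n"
    and b0: "x \<le> A"
  shows "x \<le> A * exp 1 * exp (- ((real k / (exp 1 * D)) powr (\<alpha> / (1 + \<alpha>))))"
proof -
  define y where "y = (real k / (exp 1 * D)) powr (\<alpha> / (1 + \<alpha>))"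
  define n where "n = nat \<lfloor>y\<rfloor>"
  have y: "0 \<le> y" by (simp add: y_def)
  have ny: "real n \<le> y" "y < real n + 1" unfolding n_def using y by linarith+
  have eD: "1 \<le> exp 1 * D" using D mult_mono[of 1 "exp 1" 1 D] by simp
  have "x \<le> A * exp (- real n)"
  proof (cases "n = 0")
    case False
    then have n1: "1 \<le> n" by simp
    then have y1: "1 \<le> y" using ny by linarith
    define w where "w = real k / (exp 1 * D)"
    have "w \<noteq> 0" using y1 unfolding y_def w_def[symmetric] by auto
    moreover have "0 \<le> w" using D by (simp add: w_def)
    ultimately have w0: "0 < w" by linarith
    have w1: "1 \<le> w"
    proof (rule ccontr)
      assume "\<not> 1 \<le> w"
      then have "w powr (\<alpha> / (1 + \<alpha>)) < 1 powr (\<alpha> / (1 + \<alpha>))"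
        using \<alpha> w0 by (intro powr_less_mono2) auto
      then show False using y1 by (simp add: y_def w_def)
    qed
    have "y \<le> w powr 1" unfolding y_def w_def[symmetric] using w1 \<alpha> by (intro powr_mono) auto
    also have "\<dots> = w" using w0 by simp
    also have "w \<le> real k" unfolding w_def using eD by (simp add: divide_le_eq mult_le_cancel_left1)
    finally have nk: "n \<le> k" using ny by linarith
    \<comment> \<open>The exponents \<open>\<alpha> / (1 + \<alpha>)\<close> and
      \<open>1 + 1 / \<alpha>\<close> are reciprocal, so this power of \<open>n\<close> is at most
      \<open>w\<close>, and the base of the \<open>n\<close>-th power becomes at most
      \<open>exp (-1)\<close>.\<close>
    have "real n powr (1 + 1 / \<alpha>) \<le> y powr (1 + 1 / \<alpha>)" using ny \<alpha> by (intro powr_mono2) auto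
    also have "\<dots> = w powr (\<alpha> / (1 + \<alpha>) * (1 + 1 / \<alpha>))" unfolding y_def w_def[symmetric] by (simp add: powr_powr)
    also have "\<alpha> / (1 + \<alpha>) * (1 + 1 / \<alpha>) = 1"
    proof -
      have "1 + 1 / \<alpha> = (1 + \<alpha>) / \<alpha>" "1 + \<alpha> \<noteq> 0" using \<alpha> by (auto simp: field_simps)
      then show ?thesis using \<alpha> by simp
    qed
    also have "w powr 1 = w" using w0 by simp
    finally have "D * real n powr (1 + 1 / \<alpha>) / real k \<le> D * w / real k"
      using D by (intro divide_right_mono mult_left_mono) auto
    also have "\<dots> = exp (-1)" using D n1 nk unfolding w_def by (simp add: exp_minus field_simps)
    finally have "(D * real n powr (1 + 1 / \<alpha>) / real k) ^ n \<le> exp (-1) ^ n"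
      using D by (intro power_mono) auto
    also have "\<dots> = exp (- real n)" by (simp flip: exp_of_nat_mult)
    finally have "A * (D * real n powr (1 + 1 / \<alpha>) / real k) ^ n \<le> A * exp (- real n)"
      using A by (rule mult_left_mono)
    then show ?thesis using b[OF n1 nk] by linarith
  qed (use b0 in simp)
  \<comment> \<open>Rounding \<open>y\<close> down to \<open>n\<close> costs at most a factor
    \<open>exp 1\<close>.\<close>
  also have "\<dots> \<le> A * exp (1 - y)" using ny A by (intro mult_left_mono) auto
  also have "\<dots> = A * exp 1 * exp (- y)" by (simp add: exp_diff exp_minus divide_inverse)
  finally show ?thesis unfolding y_def .
qed

text \<open>Flatness beats the Cauchy factor: \<open>exp (- c x powr (- \<alpha>)) / x ^ n\<close>
  is bounded by \<open>n powr (n / \<alpha>)\<close> up to an \<open>n\<close>-th power, so every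
  derivative is bounded on the whole disc. For each \<open>n\<close>, the \<open>k\<close>-th
  coefficient then carries \<open>1 / (k choose n)\<close>, which is at most
  \<open>(n / k) ^ n\<close>, and \<open>n\<close> is free to be optimized.\<close>

lemma flat_coefficients:
  fixes \<phi> :: "complex \<Rightarrow> complex"
  assumes \<alpha>: "0 < \<alpha>" and c: "0 < c" and \<rho>: "0 < \<rho>" and A: "0 \<le> A"
    and hol: "\<phi> holomorphic_on ball 0 1"
    and bd: "\<And>n z. cmod z < 1 \<Longrightarrow>
      cmod ((deriv ^^ n) \<phi> z) \<le> fact n * (A * exp (- c * cmod (1 - z) powr (- \<alpha>))) / (\<rho> * cmod (1 - z)) ^ n"
  shows "\<exists>c'>0. \<forall>k. cmod ((deriv ^^ k) \<phi> 0) / fact k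
    \<le> A * exp 1 * exp (- c' * real k powr (\<alpha> / (1 + \<alpha>)))"
proof -
  define D where "D = max 1 ((1 / (\<alpha> * c)) powr (1 / \<alpha>) / \<rho>)"
  have D: "1 \<le> D" "(1 / (\<alpha> * c)) powr (1 / \<alpha>) / \<rho> \<le> D" by (auto simp: D_def)
  have dn: "cmod ((deriv ^^ n) \<phi> z) \<le> fact n * (A * (D * real n powr (1 / \<alpha>)) ^ n)"
    if n: "1 \<le> n" and z: "cmod z < 1" for n z
  proof -
    define x where "x = cmod (1 - z)"
    have x: "0 < x" using z by (auto simp: x_def)
    define v where "v = 1 / (\<alpha> * c)"
    have v: "0 < v" using \<alpha> c by (simp add: v_def)
    define E where "E = v powr (1 / \<alpha>)"
    have "exp (- (c * x powr (- \<alpha>))) \<le> ((real n / \<alpha>) / (c * x powr (- \<alpha>))) powr (real n / \<alpha>)"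
      using n x c \<alpha> by (intro exp_uminus_le_powr) auto
    also have "(real n / \<alpha>) / (c * x powr (- \<alpha>)) = real n * v * x powr \<alpha>"
      using x by (simp add: v_def powr_minus divide_inverse)
    also have "\<dots> powr (real n / \<alpha>)
        = (real n powr (1 / \<alpha>)) powr real n * E powr real n * x powr real n"
      using \<alpha> c x by (simp add: powr_mult powr_powr E_def)
    also have "\<dots> = (real n powr (1 / \<alpha>) * E * x) ^ n"
      using n x v by (simp add: powr_realpow power_mult_distrib E_def)
    finally have e: "exp (- c * x powr (- \<alpha>)) \<le> (real n powr (1 / \<alpha>) * E * x) ^ n" by simp
    have "cmod ((deriv ^^ n) \<phi> z) \<le> fact n * (A * exp (- c * x powr (- \<alpha>))) / (\<rho> * x) ^ n"
      using bd[OF z, of n] by (simp add: x_def)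
    also have "\<dots> \<le> fact n * (A * (real n powr (1 / \<alpha>) * E * x) ^ n) / (\<rho> * x) ^ n"
      using A \<rho> x e by (intro divide_right_mono mult_left_mono) auto
    also have "\<dots> = fact n * (A * (E / \<rho> * real n powr (1 / \<alpha>)) ^ n)"
      using x by (simp add: power_mult_distrib power_divide)
    also have "\<dots> \<le> fact n * (A * (D * real n powr (1 / \<alpha>)) ^ n)"
      using A D(2) \<rho> unfolding E_def v_def
      by (intro mult_left_mono power_mono mult_right_mono) auto
    finally show ?thesis .
  qed
  define c' where "c' = (1 / (exp 1 * D)) powr (\<alpha> / (1 + \<alpha>))"
  have "0 < c'" using D by (simp add: c'_def)
  moreover have "cmod ((deriv ^^ k) \<phi> 0) / fact k \<le> A * exp 1 * exp (- c' * real k powr (\<alpha> / (1 + \<alpha>)))" for k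
  proof -
    have "cmod ((deriv ^^ k) \<phi> 0) / fact k
        \<le> A * exp 1 * exp (- ((real k / (exp 1 * D)) powr (\<alpha> / (1 + \<alpha>))))"
    proof (rule stretched_exponential_of_powers[OF \<alpha> A D(1)])
      have "cmod ((deriv ^^ 0) \<phi> z) \<le> A" if z: "cmod z < 1" for z
      proof -
        have "A * exp (- c * cmod (1 - z) powr (- \<alpha>)) \<le> A * 1" using A c by (intro mult_left_mono) auto
        then show ?thesis using bd[OF z, of 0] by simp
      qed
      from norm_higher_deriv_0_le_sup[OF hol this, of k]
      show "cmod ((deriv ^^ k) \<phi> 0) / fact k \<le> A" by (simp add: field_simps)
    next
      fix n assume n: "1 \<le> n" "n \<le> k"
      define B where "B = D * real n powr (1 / \<alpha>)"
      have B: "0 \<le> B" using D by (simp add: B_def)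
      have "cmod ((deriv ^^ k) \<phi> 0) \<le> fact (k - n) * (fact n * (A * B ^ n))"
        using norm_higher_deriv_0_le_sup[OF hol dn[OF n(1)] n(2)] by (simp add: B_def)
      then have "cmod ((deriv ^^ k) \<phi> 0) / fact k \<le> fact (k - n) * (fact n * (A * B ^ n)) / fact k"
        by (intro divide_right_mono) auto
      also have "\<dots> = A * B ^ n / real (k choose n)"
        using n by (simp add: binomial_fact field_simps)
      also have "\<dots> \<le> A * B ^ n / (real k / real n) ^ n"
      proof (rule divide_left_mono)
        show "(real k / real n) ^ n \<le> real (k choose n)" using n by (intro binomial_ge_n_over_k_pow_k)
      qed (use A B n in auto)
      also have "\<dots> = A * (B * real n / real k) ^ n"
        by (simp add: power_mult_distrib power_divide)
      also have "B * real n = D * real n powr (1 + 1 / \<alpha>)"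
        using n by (simp add: B_def powr_add)
      finally show "cmod ((deriv ^^ k) \<phi> 0) / fact k \<le> A * (D * real n powr (1 + 1 / \<alpha>) / real k) ^ n" .
    qed
    also have "real k / (exp 1 * D) = real k * (1 / (exp 1 * D))" by simp
    also have "\<dots> powr (\<alpha> / (1 + \<alpha>)) = c' * real k powr (\<alpha> / (1 + \<alpha>))"
      using D by (subst powr_mult) (auto simp: c'_def)
    finally show ?thesis by simp
  qed
  ultimately show ?thesis by blast
qed

section \<open>A flat function with zeros accumulating at 1\<close>

text \<open>The singularity is normalized to 1 here; a rotation moves it later. Subtracting 1 makes
  the function vanish at 0, so that \<open>flat_factor\<close> is 1 there and the perturbation has
  no constant term.\<close>

definition flat_exponent :: "real \<Rightarrow> complex \<Rightarrow> complex" where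
  "flat_exponent \<alpha> z = exp (- of_real \<alpha> * Ln (1 - z)) - 1"

text \<open>The mean of \<open>exp (- \<delta> (1 + t i) E)\<close> and
  \<open>exp (- \<delta> (1 - t i) E)\<close>. For small \<open>t\<close> both tilted exponentials
  still decay at 1, while their interference produces zeros.\<close>

definition flat_factor :: "real \<Rightarrow> real \<Rightarrow> real \<Rightarrow> complex \<Rightarrow> complex" where
  "flat_factor \<alpha> t \<delta> z =
     exp (- of_real \<delta> * flat_exponent \<alpha> z) * cos (of_real (\<delta> * t) * flat_exponent \<alpha> z)"

text \<open>Discs of radius proportional to \<open>cmod (1 - z)\<close> leave the unit disc, but
  \<open>1 - z' = (1 - z) (1 + v)\<close> with \<open>cmod v \<le> \<rho>\<close>, so the argument
  of \<open>1 - z'\<close> exceeds a right angle by at most \<open>2 * \<rho>\<close>.\<close>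

lemma sector_disc:
  assumes z: "cmod z < 1" and \<rho>: "0 < \<rho>" "\<rho> < 1/2" and z': "cmod (z' - z) \<le> \<rho> * cmod (1 - z)"
  shows "cmod (1 - z) / 2 \<le> cmod (1 - z')" "cmod (1 - z') \<le> 2 * cmod (1 - z)"
    and "1 - z' \<notin> \<real>\<^sub>\<le>\<^sub>0" "\<bar>Im (Ln (1 - z'))\<bar> \<le> pi / 2 + 2 * \<rho>"
proof -
  have Re: "0 < Re (1 - z)" using z complex_Re_le_cmod[of z] by simp
  then have z1: "1 - z \<noteq> 0" by auto
  define v where "v = (z - z') / (1 - z)"
  have v: "cmod v \<le> \<rho>"
    using z' z1 by (simp add: v_def norm_divide norm_minus_commute divide_le_eq)
  have eq: "1 - z' = (1 - z) * (1 + v)" using z1 by (simp add: v_def field_simps)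
  have v1: "1/2 \<le> cmod (1 + v)" "cmod (1 + v) \<le> 2"
    using norm_triangle_ineq[of 1 v] norm_triangle_ineq2[of 1 "- v"] v \<rho> by auto
  have "cmod (1 - z') = cmod (1 - z) * cmod (1 + v)" by (simp add: eq norm_mult)
  then show "cmod (1 - z) / 2 \<le> cmod (1 - z')" "cmod (1 - z') \<le> 2 * cmod (1 - z)"
    using mult_left_mono[OF v1(1), of "cmod (1 - z)"] mult_left_mono[OF v1(2), of "cmod (1 - z)"] by auto
  have v0: "1 + v \<noteq> 0" using v1 by auto
  have L1: "\<bar>Im (Ln (1 - z))\<bar> < pi / 2" by (rule Re_Ln_pos_lt_imp[OF Re])
  have "cmod (Ln (1 + v)) \<le> 2 * cmod v" using v \<rho> by (intro norm_Ln_le) auto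
  then have L2: "\<bar>Im (Ln (1 + v))\<bar> \<le> 2 * \<rho>" using abs_Im_le_cmod[of "Ln (1 + v)"] v by linarith
  have pi: "2 * \<rho> < pi / 2" using \<rho> pi_gt3 by linarith
  have s: "\<bar>Im (Ln (1 - z)) + Im (Ln (1 + v))\<bar> < pi" using L1 L2 pi by linarith
  have Ln: "Ln (1 - z') = Ln (1 - z) + Ln (1 + v)"
    unfolding eq by (rule Ln_times_simple[OF z1 v0]) (use s in auto)
  show "\<bar>Im (Ln (1 - z'))\<bar> \<le> pi / 2 + 2 * \<rho>" unfolding Ln using L1 L2 by auto
  have "\<bar>Im (Ln (1 - z'))\<bar> < pi" using s by (simp add: Ln)
  moreover have "1 - z' \<noteq> 0" using eq z1 v0 by simp
  ultimately show "1 - z' \<notin> \<real>\<^sub>\<le>\<^sub>0"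
    using Im_Ln_eq_pi[of "1 - z'"] by (auto simp: complex_nonpos_Reals_iff complex_eq_iff)
qed

text \<open>The argument of \<open>s = (1 - z) powr (- \<alpha>)\<close> is at most
  \<open>\<alpha> * \<kappa>\<close>, below a right angle, so \<open>Re s\<close> is at least
  \<open>cos (\<alpha> * \<kappa>) * cmod s\<close>. Half of this pays for the tilt by
  \<open>t\<close>, the other half remains as decay.\<close>

lemma flat_exponent_bounds:
  fixes z :: complex
  assumes \<alpha>: "0 < \<alpha>" and \<kappa>: "\<alpha> * \<kappa> < pi / 2" and y: "1 - z \<noteq> 0" "\<bar>Im (Ln (1 - z))\<bar> \<le> \<kappa>"
    and t: "t \<le> cos (\<alpha> * \<kappa>) / 2" "0 \<le> t"
  shows "cos (\<alpha> * \<kappa>) / 2 * cmod (1 - z) powr (- \<alpha>) - 1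
      \<le> Re (flat_exponent \<alpha> z) - t * \<bar>Im (flat_exponent \<alpha> z)\<bar>"
    and "cmod (flat_exponent \<alpha> z) \<le> cmod (1 - z) powr (- \<alpha>) + 1"
proof -
  define s where "s = exp (- of_real \<alpha> * Ln (1 - z))"
  have s: "cmod s = cmod (1 - z) powr (- \<alpha>)"
    using y by (simp add: s_def powr_def)
  have "\<bar>Im (- of_real \<alpha> * Ln (1 - z))\<bar> \<le> \<alpha> * \<kappa>"
    using \<alpha> y(2) by (simp add: abs_mult mult_left_mono)
  then have "cos (\<alpha> * \<kappa>) \<le> cos \<bar>Im (- of_real \<alpha> * Ln (1 - z))\<bar>"
    using \<kappa> by (intro cos_monotone_0_pi_le) auto
  then have "cos (\<alpha> * \<kappa>) * cmod s \<le> cos (Im (- of_real \<alpha> * Ln (1 - z))) * cmod s"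
    by (intro mult_right_mono) (auto simp: cos_abs_real)
  also have "\<dots> = Re s" by (simp add: s_def Re_exp)
  finally have Re: "cos (\<alpha> * \<kappa>) * cmod s \<le> Re s" .
  have "t * \<bar>Im s\<bar> \<le> cos (\<alpha> * \<kappa>) / 2 * cmod s"
    using t abs_Im_le_cmod[of s] by (intro mult_mono) auto
  then show "cos (\<alpha> * \<kappa>) / 2 * cmod (1 - z) powr (- \<alpha>) - 1
      \<le> Re (flat_exponent \<alpha> z) - t * \<bar>Im (flat_exponent \<alpha> z)\<bar>"
    using Re unfolding flat_exponent_def s_def[symmetric] s[symmetric] by simp
  show "cmod (flat_exponent \<alpha> z) \<le> cmod (1 - z) powr (- \<alpha>) + 1"
    unfolding flat_exponent_def s_def[symmetric] s[symmetric] using norm_triangle_ineq4[of s 1] by simp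
qed

lemma norm_cos_le_exp_Im: "cmod (cos w) \<le> exp \<bar>Im w\<bar>"
proof -
  have "cmod (cos w) = cmod (exp (\<i> * w) + exp (- (\<i> * w))) / 2"
    by (simp only: cos_exp_eq norm_divide norm_numeral)
  also have "\<dots> \<le> (cmod (exp (\<i> * w)) + cmod (exp (- (\<i> * w)))) / 2"
    by (intro divide_right_mono norm_triangle_ineq) auto
  also have "\<dots> \<le> exp \<bar>Im w\<bar>"
  proof -
    have "exp (- Im w) \<le> exp \<bar>Im w\<bar>" "exp (Im w) \<le> exp \<bar>Im w\<bar>" by auto
    then have "exp (- Im w) + exp (Im w) \<le> 2 * exp \<bar>Im w\<bar>" by linarith
    then show ?thesis by simp
  qed
  finally show ?thesis .
qed

lemma norm_flat_factor_le:
  assumes "0 \<le> \<delta>" "0 \<le> t" "l \<le> Re (flat_exponent \<alpha> z) - t * \<bar>Im (flat_exponent \<alpha> z)\<bar>"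
  shows "cmod (flat_factor \<alpha> t \<delta> z) \<le> exp (- (\<delta> * l))"
proof -
  let ?E = "flat_exponent \<alpha> z"
  have "cmod (flat_factor \<alpha> t \<delta> z) \<le> exp (- \<delta> * Re ?E) * exp \<bar>Im (of_real (\<delta> * t) * ?E)\<bar>"
    unfolding flat_factor_def norm_mult by (intro mult_mono norm_cos_le_exp_Im) auto
  also have "\<dots> = exp (- (\<delta> * (Re ?E - t * \<bar>Im ?E\<bar>)))"
    using assms(1,2) by (simp add: abs_mult algebra_simps flip: exp_add)
  also have "\<dots> \<le> exp (- (\<delta> * l))" using assms by (simp add: mult_left_mono)
  finally show ?thesis .
qed

lemma norm_exp_diff_1_le:
  fixes w :: complex
  assumes "-1 \<le> Re w"
  shows "cmod (exp (- w) - 1) \<le> 3 * cmod w" "cmod (exp (- w) - 1) \<le> 4"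
proof -
  let ?S = "{u::complex. Re u \<le> 1}"
  have "norm (exp (- w) - exp 0) \<le> exp 1 * norm (- w - 0)"
  proof (rule field_differentiable_bound)
    show "convex ?S" by (rule convex_halfspace_Re_le)
    show "(exp has_field_derivative exp u) (at u within ?S)" for u :: complex
      by (rule DERIV_subset[OF DERIV_exp]) auto
    show "norm (exp u) \<le> exp 1" if "u \<in> ?S" for u using that by simp
  qed (use assms in auto)
  also have "\<dots> \<le> 3 * norm (- w - 0)" by (intro mult_right_mono exp_le) auto
  finally show "cmod (exp (- w) - 1) \<le> 3 * cmod w" by simp
  have "cmod (exp (- w) - 1) \<le> exp (- Re w) + 1" using norm_triangle_ineq4[of "exp (- w)" 1] by simp
  also have "exp (- Re w) \<le> exp 1" using assms by simp
  also have "exp 1 \<le> (3::real)" by (rule exp_le)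
  finally show "cmod (exp (- w) - 1) \<le> 4" by simp
qed

text \<open>Interpolation between the Lipschitz bound \<open>3 * cmod w\<close> and the constant
  bound 4. The power 1/4 keeps some smallness in \<open>\<delta>\<close> but costs at most
  \<open>cmod (1 - z) powr (- (1/4))\<close>. Together with the double zero this leaves
  \<open>cmod (1 - z) powr (7/4)\<close>, enough for coefficients of order
  \<open>k powr (- (9/4))\<close>.\<close>

lemma norm_flat_factor_diff_1_le:
  assumes \<delta>: "0 < \<delta>" "\<delta> \<le> 1" and t: "0 \<le> t" "t \<le> 1"
    and l: "-1 \<le> Re (flat_exponent \<alpha> z) - t * \<bar>Im (flat_exponent \<alpha> z)\<bar>"
  shows "cmod (flat_factor \<alpha> t \<delta> z - 1) \<le> 4 * (2 * \<delta> * cmod (flat_exponent \<alpha> z)) powr (1/4)"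
proof -
  define u where "u = of_real \<delta> * flat_exponent \<alpha> z"
  have bound: "cmod (exp (- ((1 + of_real s * \<i>) * u)) - 1) \<le> 4 * (2 * cmod u) powr (1/4)"
    if s: "\<bar>s\<bar> = t" for s :: real
  proof -
    define w where "w = (1 + of_real s * \<i>) * u"
    have "-1 \<le> \<delta> * (Re (flat_exponent \<alpha> z) - t * \<bar>Im (flat_exponent \<alpha> z)\<bar>)"
    proof -
      have "\<delta> * (-1) \<le> \<delta> * (Re (flat_exponent \<alpha> z) - t * \<bar>Im (flat_exponent \<alpha> z)\<bar>)"
        using l \<delta> by (intro mult_left_mono) auto
      then show ?thesis using \<delta> by linarith
    qed
    also have "\<dots> \<le> Re w"
    proof -
      have "s * Im (flat_exponent \<alpha> z) \<le> t * \<bar>Im (flat_exponent \<alpha> z)\<bar>"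
        unfolding s[symmetric] abs_mult[symmetric] by simp
      then have "\<delta> * (s * Im (flat_exponent \<alpha> z)) \<le> \<delta> * (t * \<bar>Im (flat_exponent \<alpha> z)\<bar>)"
        using \<delta> by (intro mult_left_mono) auto
      then show ?thesis by (simp add: w_def u_def algebra_simps)
    qed
    finally have Re: "-1 \<le> Re w" .
    have "cmod (1 + of_real s * \<i>) \<le> 2"
      using norm_triangle_ineq[of 1 "of_real s * \<i>"] s t by (simp add: norm_mult)
    then have w: "cmod w \<le> 2 * cmod u" unfolding w_def norm_mult by (intro mult_right_mono) auto
    have "cmod (exp (- w) - 1) \<le> 4 * cmod w powr (1/4)"
    proof (cases "cmod w \<le> 1")
      case True
      have "cmod w = cmod w powr 1" by simp
      also have "\<dots> \<le> cmod w powr (1/4)"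
      proof (cases "w = 0")
        case False
        then show ?thesis using True by (intro powr_mono') auto
      qed simp
      finally show ?thesis using norm_exp_diff_1_le(1)[OF Re] norm_ge_zero[of w] by linarith
    next
      case False
      then have "1 \<le> cmod w powr (1/4)" by (intro ge_one_powr_ge_zero) auto
      then show ?thesis using norm_exp_diff_1_le(2)[OF Re] by linarith
    qed
    also have "\<dots> \<le> 4 * (2 * cmod u) powr (1/4)" using w by (intro mult_left_mono powr_mono2) auto
    finally show ?thesis unfolding w_def .
  qed
  have "flat_factor \<alpha> t \<delta> z = exp (- u) * ((exp (\<i> * (of_real t * u)) + exp (- (\<i> * (of_real t * u)))) / 2)"
    unfolding flat_factor_def cos_exp_eq u_def by (simp add: mult_ac)
  also have "\<dots> = (exp (- ((1 + of_real (- t) * \<i>) * u)) + exp (- ((1 + of_real t * \<i>) * u))) / 2"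
    by (simp add: ring_distribs mult_ac flip: exp_add)
  finally have "flat_factor \<alpha> t \<delta> z - 1
      = ((exp (- ((1 + of_real (- t) * \<i>) * u)) - 1) + (exp (- ((1 + of_real t * \<i>) * u)) - 1)) / 2"
    by (simp add: field_simps)
  also have "cmod \<dots> \<le> (cmod (exp (- ((1 + of_real (- t) * \<i>) * u)) - 1)
      + cmod (exp (- ((1 + of_real t * \<i>) * u)) - 1)) / 2"
    unfolding norm_divide norm_numeral by (intro divide_right_mono norm_triangle_ineq) auto
  also have "\<dots> \<le> 4 * (2 * cmod u) powr (1/4)" using bound[of "- t"] bound[of t] t by simp
  finally show ?thesis using \<delta> by (simp add: u_def norm_mult mult_ac)
qed

lemma holomorphic_flat_factor:
  assumes "\<And>z. z \<in> S \<Longrightarrow> 1 - z \<notin> \<real>\<^sub>\<le>\<^sub>0"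
  shows "flat_factor \<alpha> t \<delta> holomorphic_on S"
  unfolding flat_factor_def flat_exponent_def using assms by (auto intro!: holomorphic_intros)

text \<open>Cauchy's inequality on a disc of radius proportional to the distance from the
  singularity. Holomorphy is assumed on every set avoiding the slit because that disc may leave the
  unit disc.\<close>

lemma norm_higher_deriv_sector_le:
  assumes f: "\<And>S. (\<And>z. z \<in> S \<Longrightarrow> 1 - z \<notin> \<real>\<^sub>\<le>\<^sub>0) \<Longrightarrow> f holomorphic_on S"
    and z: "cmod z < 1" and \<rho>: "0 < \<rho>" "\<rho> < 1/2"
    and B: "\<And>z'. cmod (z' - z) \<le> \<rho> * cmod (1 - z) \<Longrightarrow> cmod (f z') \<le> B"
  shows "cmod ((deriv ^^ n) f z) \<le> fact n * B / (\<rho> * cmod (1 - z)) ^ n"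
proof -
  have z1: "0 < cmod (1 - z)" using z by auto
  have f': "f holomorphic_on cball z (\<rho> * cmod (1 - z))"
    by (rule f) (use sector_disc(3)[OF z \<rho>] in \<open>auto simp: dist_norm norm_minus_commute\<close>)
  show ?thesis
  proof (rule Cauchy_inequality)
    show "f holomorphic_on ball z (\<rho> * cmod (1 - z))"
      by (rule holomorphic_on_subset[OF f']) auto
    show "continuous_on (cball z (\<rho> * cmod (1 - z))) f"
      by (rule holomorphic_on_imp_continuous_on[OF f'])
  qed (use z1 \<rho> B in \<open>auto simp: norm_minus_commute\<close>)
qed

text \<open>The difference between the perturbed and unperturbed characteristic functions, after
  rotation; the double zero compensates the growth of \<open>flat_exponent\<close> at 1.\<close>

definition flat_perturbation :: "real \<Rightarrow> real \<Rightarrow> real \<Rightarrow> complex \<Rightarrow> complex" where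
  "flat_perturbation \<alpha> t \<delta> z = (1 - z)\<^sup>2 * (flat_factor \<alpha> t \<delta> z - 1)"

lemma unit_disc_avoids_slit: "cmod z < 1 \<Longrightarrow> 1 - z \<notin> \<real>\<^sub>\<le>\<^sub>0"
  using complex_Re_le_cmod[of z] by (auto simp: complex_nonpos_Reals_iff)

text \<open>The perturbation is not flat at 1, but it differs from a flat function by a polynomial
  of degree 2, which is invisible in the coefficients from 3 on.\<close>

lemma fps_expansion_flat_perturbation:
  assumes k: "3 \<le> k"
  shows "fps_nth (fps_expansion (flat_perturbation \<alpha> t \<delta>) 0) k
    = (deriv ^^ k) (\<lambda>z. (1 - z)\<^sup>2 * flat_factor \<alpha> t \<delta> z) 0 / fact k"
proof -
  let ?\<phi> = "\<lambda>z. (1 - z)\<^sup>2 * flat_factor \<alpha> t \<delta> z"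
  have "?\<phi> holomorphic_on ball 0 1"
    by (intro holomorphic_intros holomorphic_flat_factor) (auto simp: unit_disc_avoids_slit)
  then have "?\<phi> has_fps_expansion fps_expansion ?\<phi> 0"
    by (intro has_fps_expansion_fps_expansion[of "ball 0 1"]) auto
  then have "(\<lambda>z. ?\<phi> z - (1 - z)\<^sup>2) has_fps_expansion fps_expansion ?\<phi> 0 - (1 - fps_X)\<^sup>2"
    by (intro fps_expansion_intros)
  moreover have "(\<lambda>z. ?\<phi> z - (1 - z)\<^sup>2) = flat_perturbation \<alpha> t \<delta>"
    by (auto simp: flat_perturbation_def algebra_simps)
  ultimately have "fps_expansion (flat_perturbation \<alpha> t \<delta>) 0 = fps_expansion ?\<phi> 0 - (1 - fps_X)\<^sup>2"
    using fps_expansion_eqI by metis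
  moreover have "fps_nth ((1 - fps_X)\<^sup>2 :: complex fps) k = 0"
  proof -
    have "(1 - fps_X)\<^sup>2 = (1 - fps_X) - fps_X * (1 - fps_X :: complex fps)"
      by (simp only: power2_eq_square left_diff_distrib mult_1_left)
    then show ?thesis using k by (simp only: fps_sub_nth fps_X_mult_nth fps_X_nth fps_one_nth) auto
  qed
  ultimately show ?thesis by (simp add: fps_expansion_def)
qed

text \<open>Two estimates for the same coefficients: one tends to 0 with \<open>\<delta>\<close> and
  has constants independent of \<open>\<delta>\<close>, the other decays almost exponentially but
  with \<open>c\<close> and \<open>B\<close> depending on \<open>\<delta>\<close>.\<close>

lemma flat_perturbation_coefficients:
  assumes \<alpha>: "0 < \<alpha>" "\<alpha> < 1"
  shows "\<exists>t C. 0 < t \<and> 0 \<le> C \<and> (\<forall>\<delta>. 0 < \<delta> \<longrightarrow> \<delta> \<le> 1 \<longrightarrow>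
    (\<forall>k. cmod (fps_nth (fps_expansion (flat_perturbation \<alpha> t \<delta>) 0) k)
        \<le> C * \<delta> powr (1/4) * (1 + real k) powr (- (9/4))) \<and>
    (\<exists>c>0. \<exists>B. \<forall>k\<ge>3. cmod (fps_nth (fps_expansion (flat_perturbation \<alpha> t \<delta>) 0) k)
        \<le> B * exp (- c * real k powr (\<alpha> / (1 + \<alpha>)))))"
proof -
  \<comment> \<open>Since \<open>\<alpha> < 1\<close>, the angle \<open>\<alpha> * pi / 2\<close>
    lies \<open>pi * (1 - \<alpha>) / 2\<close> below a right angle; this \<open>\<rho>\<close> uses
    at most half of that gap.\<close>
  define \<rho> where "\<rho> = min (1/4) (pi * (1 - \<alpha>) / (8 * \<alpha>))"
  have \<rho>: "0 < \<rho>" "\<rho> < 1/2" using \<alpha> by (auto simp: \<rho>_def)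
  define \<kappa> where "\<kappa> = pi / 2 + 2 * \<rho>"
  have "\<alpha> * \<rho> \<le> \<alpha> * (pi * (1 - \<alpha>) / (8 * \<alpha>))"
    using \<alpha> by (intro mult_left_mono) (auto simp: \<rho>_def)
  also have "\<dots> = pi * (1 - \<alpha>) / 8" using \<alpha> by simp
  finally have "\<alpha> * \<kappa> \<le> \<alpha> * pi / 2 + pi * (1 - \<alpha>) / 4" by (simp add: \<kappa>_def algebra_simps)
  also have "\<dots> < pi / 2"
  proof -
    have "0 < pi * (1 - \<alpha>)" using \<alpha> by simp
    moreover have "\<alpha> * pi / 2 + pi * (1 - \<alpha>) / 4 = pi / 2 - pi * (1 - \<alpha>) / 4" by (simp add: field_simps)
    ultimately show ?thesis by linarith
  qed
  finally have \<kappa>: "\<alpha> * \<kappa> < pi / 2" .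
  have "0 < \<alpha> * \<kappa>" using \<alpha> \<rho> by (auto simp: \<kappa>_def intro!: mult_pos_pos add_pos_pos)
  then have c1: "0 < cos (\<alpha> * \<kappa>)" using \<kappa> by (intro cos_gt_zero) auto
  \<comment> \<open>The largest tilt that \<open>flat_exponent_bounds\<close> admits.\<close>
  define t where "t = cos (\<alpha> * \<kappa>) / 2"
  have t: "0 < t" "t \<le> 1" using c1 cos_le_one[of "\<alpha> * \<kappa>"] unfolding t_def by linarith+
  have sector: "1 - z' \<noteq> 0" "cmod (1 - z') \<le> 2 * cmod (1 - z)" "cmod (1 - z') < 4"
      "t * cmod (1 - z') powr (- \<alpha>) - 1
        \<le> Re (flat_exponent \<alpha> z') - t * \<bar>Im (flat_exponent \<alpha> z')\<bar>"
      "cmod (flat_exponent \<alpha> z') \<le> cmod (1 - z') powr (- \<alpha>) + 1"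
    if z: "cmod z < 1" and z': "cmod (z' - z) \<le> \<rho> * cmod (1 - z)" for z z'
  proof -
    note sd = sector_disc[OF z \<rho> z']
    have "0 < cmod (1 - z)" using z by auto
    then show ne: "1 - z' \<noteq> 0" using sd(1) by auto
    show "cmod (1 - z') \<le> 2 * cmod (1 - z)" by (rule sd(2))
    have "cmod (1 - z) < 2" using norm_triangle_ineq4[of 1 z] z by simp
    then show "cmod (1 - z') < 4" using sd(2) by linarith
    from flat_exponent_bounds[OF \<alpha>(1) \<kappa> ne, of t] sd(4) t
    show "t * cmod (1 - z') powr (- \<alpha>) - 1
        \<le> Re (flat_exponent \<alpha> z') - t * \<bar>Im (flat_exponent \<alpha> z')\<bar>"
      "cmod (flat_exponent \<alpha> z') \<le> cmod (1 - z') powr (- \<alpha>) + 1"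
      by (auto simp: \<kappa>_def t_def)
  qed
  \<comment> \<open>The first summand serves \<open>k \<ge> 3\<close>: 192 is
    \<open>3! * 32\<close>, and 8 exceeds \<open>2 powr (9/4)\<close>, the price of replacing
    \<open>k\<close> by \<open>1 + k\<close>. The second serves \<open>k < 3\<close>, where 27 makes
    up for the decaying factor.\<close>
  define C where "C = 27/2 * 192 * 8 / \<rho> ^ 3 + 32 * 27 / \<rho> ^ 3"
  have C: "0 \<le> C" using \<rho> by (simp add: C_def)
  have small: "cmod (fps_nth (fps_expansion (flat_perturbation \<alpha> t \<delta>) 0) k)
        \<le> C * \<delta> powr (1/4) * (1 + real k) powr (- (9/4))"
    if \<delta>: "0 < \<delta>" "\<delta> \<le> 1" for \<delta> k
  proof -
    let ?g = "flat_perturbation \<alpha> t \<delta>"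
    define d where "d = \<delta> powr (1/4)"
    have d: "0 < d" using \<delta> by (simp add: d_def)
    have hol: "?g holomorphic_on S" if "\<And>z. z \<in> S \<Longrightarrow> 1 - z \<notin> \<real>\<^sub>\<le>\<^sub>0" for S
      unfolding flat_perturbation_def using that by (intro holomorphic_intros holomorphic_flat_factor)
    have g: "cmod (?g z') \<le> 32 * d * cmod (1 - z) powr (7/4)"
      if z: "cmod z < 1" and z': "cmod (z' - z) \<le> \<rho> * cmod (1 - z)" for z z'
    proof -
      note s = sector[OF z z']
      define y where "y = cmod (1 - z')"
      have y: "0 < y" "y < 4" "y \<le> 2 * cmod (1 - z)" using s by (auto simp: y_def)
      \<comment> \<open>Bounding \<open>y powr (- \<alpha>)\<close> by \<open>4 / y\<close> is
        cheap, since only the fourth root of \<open>flat_exponent\<close> enters.\<close>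
      have "y powr (- \<alpha>) = y powr (1 - \<alpha>) / y"
        using y powr_add[of y "1 - \<alpha>" "-1"] by (simp add: powr_minus_divide)
      also have "\<dots> \<le> 4 / y"
      proof (rule divide_right_mono)
        have "y powr (1 - \<alpha>) \<le> 4 powr (1 - \<alpha>)" using y \<alpha> by (intro powr_mono2) auto
        also have "\<dots> \<le> 4 powr 1" using \<alpha> by (intro powr_mono) auto
        finally show "y powr (1 - \<alpha>) \<le> 4" by simp
      qed (use y in simp)
      finally have "y powr (- \<alpha>) \<le> 4 / y" .
      moreover have "1 \<le> 4 / y" using y by simp
      ultimately have "cmod (flat_exponent \<alpha> z') \<le> 8 / y"
        using s(5) unfolding y_def[symmetric] by linarith
      then have E: "2 * \<delta> * cmod (flat_exponent \<alpha> z') \<le> 2 * \<delta> * (8 / y)"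
        using \<delta> by (intro mult_left_mono) auto
      have "0 \<le> t * y powr (- \<alpha>)" using t by simp
      then have "-1 \<le> Re (flat_exponent \<alpha> z') - t * \<bar>Im (flat_exponent \<alpha> z')\<bar>"
        using s(4) unfolding y_def[symmetric] by linarith
      then have "cmod (flat_factor \<alpha> t \<delta> z' - 1) \<le> 4 * (2 * \<delta> * cmod (flat_exponent \<alpha> z')) powr (1/4)"
        using t by (intro norm_flat_factor_diff_1_le \<delta>) auto
      also have "\<dots> \<le> 4 * (2 * \<delta> * (8 / y)) powr (1/4)"
        using \<delta> by (intro mult_left_mono powr_mono2 E) auto
      also have "(2 * \<delta> * (8 / y)) powr (1/4) = 2 * d * y powr (- (1/4))"
      proof -
        define v where "v = 1 / y"
        have v: "0 \<le> v" "2 * \<delta> * (8 / y) = 16 * \<delta> * v" "v powr (1/4) = y powr (- (1/4))"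
          using y powr_divide[of 1 y "1/4"] powr_minus_divide[of y "1/4"] by (simp_all add: v_def)
        have "(16::real) powr (1/4) = (2 powr 4) powr (1/4)" by simp
        also have "\<dots> = 2" by (simp only: powr_powr) simp
        finally have "(16::real) powr (1/4) = 2" .
        then show ?thesis unfolding v(2) v(3)[symmetric] d_def using v(1) \<delta> by (simp add: powr_mult)
      qed
      finally have F: "cmod (flat_factor \<alpha> t \<delta> z' - 1) \<le> 8 * d * y powr (- (1/4))" by simp
      have "cmod (?g z') = y powr 2 * cmod (flat_factor \<alpha> t \<delta> z' - 1)"
        using y by (simp add: flat_perturbation_def norm_mult norm_power y_def powr_numeral)
      also have "\<dots> \<le> y powr 2 * (8 * d * y powr (- (1/4)))" using F by (intro mult_left_mono) auto
      also have "\<dots> = 8 * d * (y powr 2 * y powr (- (1/4)))" by simp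
      also have "y powr 2 * y powr (- (1/4)) = y powr (7/4)" unfolding powr_add[symmetric] by simp
      also have "\<dots> \<le> (2 * cmod (1 - z)) powr (7/4)" using y by (intro powr_mono2) auto
      also have "\<dots> = 2 powr (7/4) * cmod (1 - z) powr (7/4)" by (simp add: powr_mult)
      also have "\<dots> \<le> 2 powr 2 * cmod (1 - z) powr (7/4)" by (intro mult_right_mono powr_mono) auto
      finally show ?thesis using d by (simp add: mult_left_mono)
    qed
    have der: "cmod ((deriv ^^ n) ?g z) \<le> fact n * (32 * d * cmod (1 - z) powr (7/4)) / (\<rho> * cmod (1 - z)) ^ n"
      if z: "cmod z < 1" for n z
      by (rule norm_higher_deriv_sector_le[OF hol z \<rho> g[OF z]])
    have g_eq: "cmod (fps_nth (fps_expansion ?g 0) k) = cmod ((deriv ^^ k) ?g 0) / fact k"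
      by (simp add: fps_expansion_def norm_divide)
    show ?thesis
    proof (cases "3 \<le> k")
      case True
      have "cmod ((deriv ^^ k) ?g 0) / fact k \<le> 27/2 * (192 / \<rho> ^ 3 * d) * real k powr (- (9/4))"
      proof (rule norm_higher_deriv_0_le[OF _ _ True])
        show "?g holomorphic_on ball 0 1" by (rule hol) (auto simp: unit_disc_avoids_slit)
        fix z :: complex assume z: "cmod z < 1"
        define x where "x = cmod (1 - z)"
        have x: "0 < x" using z by (auto simp: x_def)
        have "cmod ((deriv ^^ 3) ?g z) \<le> fact 3 * (32 * d * x powr (7/4)) / (\<rho> * x) ^ 3"
          using der[OF z, of 3] by (simp add: x_def)
        also have "\<dots> = 192 / \<rho> ^ 3 * d * (x powr (7/4) / x powr 3)"
          using x by (simp add: power_mult_distrib powr_numeral fact_numeral)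
        also have "x powr (7/4) / x powr 3 = x powr (- (5/4))" unfolding powr_diff[symmetric] by simp
        finally show "cmod ((deriv ^^ 3) ?g z) \<le> 192 / \<rho> ^ 3 * d * cmod (1 - z) powr (- (5/4))"
          by (simp add: x_def)
      qed
      also have "\<dots> \<le> 27/2 * (192 / \<rho> ^ 3 * d) * (8 * (1 + real k) powr (- (9/4)))"
      proof (rule mult_left_mono)
        have "real k powr (- (9/4)) \<le> ((1 + real k) / 2) powr (- (9/4))"
          using True by (intro powr_mono2') auto
        also have "\<dots> = (1 + real k) powr (- (9/4)) * (1 / 2 powr (- (9/4)))"
          by (subst powr_divide) auto
        also have "1 / 2 powr (- (9/4)) = (2::real) powr (9/4)"
          using powr_minus_divide[of "2::real" "- (9/4)"] by simp
        also have "(1 + real k) powr (- (9/4)) * 2 powr (9/4) \<le> (1 + real k) powr (- (9/4)) * 2 powr 3"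
          by (intro mult_left_mono powr_mono) auto
        finally show "real k powr (- (9/4)) \<le> 8 * (1 + real k) powr (- (9/4))" by simp
      qed (use d \<rho> in auto)
      also have "\<dots> = 27/2 * 192 * 8 / \<rho> ^ 3 * d * (1 + real k) powr (- (9/4))" by simp
      also have "\<dots> \<le> C * d * (1 + real k) powr (- (9/4))"
        using \<rho> d by (intro mult_right_mono) (auto simp: C_def divide_right_mono)
      finally show ?thesis by (simp add: g_eq d_def)
    next
      case False
      have "cmod ((deriv ^^ k) ?g 0) / fact k \<le> 32 * d / \<rho> ^ k"
        using der[of 0 k] by (simp add: field_simps)
      also have "\<dots> \<le> 32 * d / \<rho> ^ 3"
        using False \<rho> d by (intro divide_left_mono power_decreasing) auto
      also have "\<dots> \<le> 32 * d / \<rho> ^ 3 * (27 * (1 + real k) powr (- (9/4)))"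
      proof -
        have "3 powr (- (9/4)) \<le> (1 + real k) powr (- (9/4))"
          using False by (intro powr_mono2') auto
        moreover have "3 powr (- 3) \<le> (3::real) powr (- (9/4))" by (intro powr_mono) auto
        moreover have "3 powr (- 3) = (1 / 27 :: real)" using powr_minus_divide[of "3::real" 3] by simp
        ultimately have "1 \<le> 27 * (1 + real k) powr (- (9/4))" by linarith
        then have "32 * d / \<rho> ^ 3 * 1 \<le> 32 * d / \<rho> ^ 3 * (27 * (1 + real k) powr (- (9/4)))"
          using d \<rho> by (intro mult_left_mono) auto
        then show ?thesis by simp
      qed
      also have "\<dots> = (32 * 27 / \<rho> ^ 3) * d * (1 + real k) powr (- (9/4))" by simp
      also have "\<dots> \<le> C * d * (1 + real k) powr (- (9/4))"
        using \<rho> d by (intro mult_right_mono) (auto simp: C_def divide_right_mono)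
      finally show ?thesis by (simp add: g_eq d_def)
    qed
  qed
  have flat: "\<exists>c>0. \<exists>B. \<forall>k\<ge>3. cmod (fps_nth (fps_expansion (flat_perturbation \<alpha> t \<delta>) 0) k)
        \<le> B * exp (- c * real k powr (\<alpha> / (1 + \<alpha>)))" if \<delta>: "0 < \<delta>" "\<delta> \<le> 1" for \<delta>
  proof -
    let ?\<phi> = "\<lambda>z. (1 - z)\<^sup>2 * flat_factor \<alpha> t \<delta> z"
    have hol: "?\<phi> holomorphic_on S" if "\<And>z. z \<in> S \<Longrightarrow> 1 - z \<notin> \<real>\<^sub>\<le>\<^sub>0" for S
      using that by (intro holomorphic_intros holomorphic_flat_factor)
    have \<phi>: "cmod (?\<phi> z') \<le> 48 * exp (- (\<delta> * t / 2) * cmod (1 - z) powr (- \<alpha>))"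
      if z: "cmod z < 1" and z': "cmod (z' - z) \<le> \<rho> * cmod (1 - z)" for z z'
    proof -
      note s = sector[OF z z']
      define y where "y = cmod (1 - z')"
      define x where "x = cmod (1 - z)"
      have y: "0 < y" "y < 4" "y \<le> 2 * x" using s by (auto simp: y_def x_def)
      have "x powr (- \<alpha>) / 2 \<le> x powr (- \<alpha>) * 2 powr (- \<alpha>)"
      proof -
        have "2 powr (-1) \<le> (2::real) powr (- \<alpha>)" using \<alpha> by (intro powr_mono) auto
        then have "1/2 \<le> (2::real) powr (- \<alpha>)" by (simp add: powr_minus_divide)
        then have "x powr (- \<alpha>) * (1/2) \<le> x powr (- \<alpha>) * 2 powr (- \<alpha>)" by (intro mult_left_mono) auto
        then show ?thesis by simp
      qed
      also have "\<dots> = (2 * x) powr (- \<alpha>)" using y by (simp add: powr_mult)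
      also have "\<dots> \<le> y powr (- \<alpha>)" using y \<alpha> by (intro powr_mono2') auto
      finally have xy: "x powr (- \<alpha>) / 2 \<le> y powr (- \<alpha>)" .
      have "cmod (flat_factor \<alpha> t \<delta> z') \<le> exp (- (\<delta> * (t * y powr (- \<alpha>) - 1)))"
        unfolding y_def using \<delta> t by (intro norm_flat_factor_le s(4)) auto
      also have "\<dots> = exp \<delta> * exp (- (\<delta> * t * y powr (- \<alpha>)))"
        by (simp add: algebra_simps flip: exp_add)
      also have "\<dots> \<le> 3 * exp (- (\<delta> * t / 2) * x powr (- \<alpha>))"
      proof (rule mult_mono)
        have "exp \<delta> \<le> exp 1" using \<delta> by simp
        also have "\<dots> \<le> 3" by (rule exp_le)
        finally show "exp \<delta> \<le> 3" .
        have "\<delta> * t * (x powr (- \<alpha>) / 2) \<le> \<delta> * t * y powr (- \<alpha>)"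
          using xy \<delta> t by (intro mult_left_mono) auto
        then show "exp (- (\<delta> * t * y powr (- \<alpha>))) \<le> exp (- (\<delta> * t / 2) * x powr (- \<alpha>))" by simp
      qed auto
      finally have F: "cmod (flat_factor \<alpha> t \<delta> z') \<le> 3 * exp (- (\<delta> * t / 2) * x powr (- \<alpha>))" .
      have "cmod (?\<phi> z') = y\<^sup>2 * cmod (flat_factor \<alpha> t \<delta> z')" by (simp add: norm_mult norm_power y_def)
      also have "\<dots> \<le> 4\<^sup>2 * (3 * exp (- (\<delta> * t / 2) * x powr (- \<alpha>)))"
        using y F by (intro mult_mono power_mono) auto
      finally show ?thesis by (simp add: x_def)
    qed
    have "\<exists>c'>0. \<forall>k. cmod ((deriv ^^ k) ?\<phi> 0) / fact k
        \<le> 48 * exp 1 * exp (- c' * real k powr (\<alpha> / (1 + \<alpha>)))"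
    proof (rule flat_coefficients[OF \<alpha>(1) _ \<rho>(1)])
      show "0 < \<delta> * t / 2" using \<delta> t by simp
      show "?\<phi> holomorphic_on ball 0 1" by (rule hol) (auto simp: unit_disc_avoids_slit)
      show "cmod ((deriv ^^ n) ?\<phi> z)
          \<le> fact n * (48 * exp (- (\<delta> * t / 2) * cmod (1 - z) powr (- \<alpha>))) / (\<rho> * cmod (1 - z)) ^ n"
        if z: "cmod z < 1" for n z
        by (rule norm_higher_deriv_sector_le[OF hol z \<rho> \<phi>[OF z]])
    qed simp
    then obtain c' where "0 < c'" and c': "\<And>k. cmod ((deriv ^^ k) ?\<phi> 0) / fact k
        \<le> 48 * exp 1 * exp (- c' * real k powr (\<alpha> / (1 + \<alpha>)))" by blast
    moreover have "cmod (fps_nth (fps_expansion (flat_perturbation \<alpha> t \<delta>) 0) k)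
        \<le> 48 * exp 1 * exp (- c' * real k powr (\<alpha> / (1 + \<alpha>)))" if "3 \<le> k" for k
      using c'[of k] by (simp add: fps_expansion_flat_perturbation[OF that] norm_divide)
    ultimately show ?thesis by blast
  qed
  show ?thesis using t(1) C small flat by blast
qed

section \<open>Removing the pole of the Weyl function\<close>

lemma weighted_bound_mult:
  assumes f: "weighted_bound \<omega> f r" and g: "weighted_bound \<omega> g s"
    and \<omega>: "\<And>k. 0 \<le> \<omega> k" and sub: "\<And>a b. \<omega> (a + b) \<le> \<omega> a * \<omega> b"
  shows "weighted_bound \<omega> (f * g) (r * s)"
  unfolding weighted_bound_def
proof
  fix N
  have "1 * (\<Sum>k<N. \<omega> k * cmod (fps_nth (f * g) k))
      \<le> (\<Sum>k<N. \<omega> k * cmod (fps_nth f k)) * (\<Sum>k<N. \<omega> k * cmod (fps_nth g k))"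
    by (rule weighted_sum_mult_le) (use \<omega> sub in auto)
  also have "\<dots> \<le> r * s"
    using f g \<omega> unfolding weighted_bound_def by (intro mult_mono sum_nonneg) (auto intro: weighted_bound_nonneg[OF f])
  finally show "(\<Sum>k<N. \<omega> k * cmod (fps_nth (f * g) k)) \<le> r * s" by simp
qed

lemma weighted_bound_add:
  assumes "weighted_bound \<omega> f r" "weighted_bound \<omega> g s" "\<And>k. 0 \<le> \<omega> k"
  shows "weighted_bound \<omega> (f + g) (r + s)"
  unfolding weighted_bound_def
proof
  fix N
  have "(\<Sum>k<N. \<omega> k * cmod (fps_nth (f + g) k))
      \<le> (\<Sum>k<N. \<omega> k * cmod (fps_nth f k) + \<omega> k * cmod (fps_nth g k))"
    using assms(3) by (intro sum_mono) (auto simp: distrib_left[symmetric] intro!: mult_left_mono norm_triangle_ineq)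
  also have "\<dots> \<le> r + s"
    using assms(1,2) unfolding weighted_bound_def sum.distrib by (intro add_mono) auto
  finally show "(\<Sum>k<N. \<omega> k * cmod (fps_nth (f + g) k)) \<le> r + s" .
qed

lemma weighted_bound_shift:
  assumes f: "weighted_bound \<omega> f r" and \<omega>: "\<And>k. 0 \<le> \<omega> k" "\<And>k. \<omega> k \<le> \<omega> (Suc k)"
  shows "weighted_bound \<omega> (fps_shift 1 f) r"
  unfolding weighted_bound_def
proof
  fix N
  have "(\<Sum>k<N. \<omega> k * cmod (fps_nth (fps_shift 1 f) k)) \<le> (\<Sum>k<N. \<omega> (Suc k) * cmod (fps_nth f (Suc k)))"
    using \<omega> by (intro sum_mono) (auto intro: mult_right_mono)
  also have "\<dots> \<le> (\<Sum>k<Suc N. \<omega> k * cmod (fps_nth f k))"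
    using \<omega>(1) by (subst sum.lessThan_Suc_shift) auto
  also have "\<dots> \<le> r" using f unfolding weighted_bound_def by blast
  finally show "(\<Sum>k<N. \<omega> k * cmod (fps_nth (fps_shift 1 f) k)) \<le> r" .
qed

text \<open>The quotient of \<open>Q\<close> by \<open>1 - X/a\<close> with its coefficients summed from the tail; this differs from the
  formal quotient unless \<open>Q\<close> vanishes at \<open>a\<close>, but it is bounded for \<open>|a| < 1\<close>.\<close>

definition root_quotient :: "complex \<Rightarrow> complex fps \<Rightarrow> complex fps" where
  "root_quotient a Q = Abs_fps (\<lambda>k. - (\<Sum>j. fps_nth Q (k + 1 + j) * a ^ (j + 1)))"

lemma summable_shifted_power:
  fixes Q :: "complex fps"
  assumes B: "\<And>k. cmod (fps_nth Q k) \<le> B" and a: "cmod a < 1"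
  shows "summable (\<lambda>j. fps_nth Q (k + j) * a ^ (j + i))"
proof (rule summable_comparison_test')
  show "summable (\<lambda>j. B * (cmod a ^ j * cmod a ^ i))"
    using a by (intro summable_mult summable_mult2 summable_geometric) auto
  show "norm (fps_nth Q (k + j) * a ^ (j + i)) \<le> B * (cmod a ^ j * cmod a ^ i)" for j
    using B[of "k + j"] by (auto simp: norm_mult norm_power power_add intro!: mult_right_mono)
qed

text \<open>Successive tails of the series at \<open>a\<close> satisfy the two-term recursion of the
  product. Its constant coefficient is \<open>fps_nth Q 0 - eval_fps Q a\<close>, which is where
  \<open>zero\<close> enters.\<close>

lemma root_quotient_identity:
  assumes B: "\<And>k. cmod (fps_nth Q k) \<le> B" and a: "cmod a < 1" "a \<noteq> 0" and zero: "eval_fps Q a = 0"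
  shows "(1 - fps_const (1 / a) * fps_X) * root_quotient a Q = Q"
proof (rule fps_ext)
  fix k
  let ?D = "root_quotient a Q"
  have s: "summable (\<lambda>j. fps_nth Q (i + j) * a ^ j)" for i
    using summable_shifted_power[OF B a(1), of i 0] by simp
  have step: "(\<Sum>j. fps_nth Q (i + j) * a ^ j) = fps_nth Q i - fps_nth ?D i" for i
    using suminf_split_head[OF s[of i]] by (simp add: root_quotient_def)
  show "fps_nth ((1 - fps_const (1 / a) * fps_X) * ?D) k = fps_nth Q k"
  proof (cases k)
    case 0
    have "eval_fps Q a = fps_nth Q 0 - fps_nth ?D 0" using step[of 0] by (simp add: eval_fps_def)
    then show ?thesis using zero 0 by simp
  next
    case (Suc i)
    have "fps_nth ?D i = - (a * (\<Sum>j. fps_nth Q (Suc i + j) * a ^ j))"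
      using suminf_mult[OF s[of "Suc i"], of a] by (simp add: root_quotient_def mult_ac)
    then have "1 / a * fps_nth ?D i = - (fps_nth Q k - fps_nth ?D k)"
      using a step[of "Suc i"] Suc by (simp add: field_simps)
    then show ?thesis by (simp add: Suc left_diff_distrib mult.assoc)
  qed
qed

text \<open>Coefficient \<open>k\<close> involves only later coefficients of \<open>Q\<close>, so a
  monotone weight can be moved inside; interchanging the sums leaves a geometric series in
  \<open>cmod a\<close>.\<close>

lemma weighted_bound_root_quotient:
  assumes Q: "weighted_bound \<omega> Q r" and \<omega>: "\<And>k. 1 \<le> \<omega> k" "\<And>m n. m \<le> n \<Longrightarrow> \<omega> m \<le> \<omega> n"
    and a: "cmod a < 1"
  shows "weighted_bound \<omega> (root_quotient a Q) (r / (1 - cmod a))"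
  unfolding weighted_bound_def
proof
  fix N
  have \<omega>0: "0 \<le> \<omega> k" for k using \<omega>(1)[of k] by linarith
  have r: "0 \<le> r" by (rule weighted_bound_nonneg[OF Q])
  have B: "cmod (fps_nth Q k) \<le> r" for k
  proof -
    have "1 * cmod (fps_nth Q k) \<le> \<omega> k * cmod (fps_nth Q k)" by (intro mult_right_mono \<omega>) auto
    then show ?thesis using weighted_bound_nth[OF Q \<omega>0, of k] by linarith
  qed
  have "(\<lambda>m. \<Sum>k<N. \<omega> k * cmod (- (\<Sum>j<m. fps_nth Q (k + 1 + j) * a ^ (j + 1))))
      \<longlonglongrightarrow> (\<Sum>k<N. \<omega> k * cmod (- (\<Sum>j. fps_nth Q (k + 1 + j) * a ^ (j + 1))))"
    by (intro tendsto_sum tendsto_mult_left tendsto_norm tendsto_minus summable_LIMSEQ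
        summable_shifted_power[OF B a])
  moreover have "(\<Sum>k<N. \<omega> k * cmod (- (\<Sum>j<m. fps_nth Q (k + 1 + j) * a ^ (j + 1)))) \<le> r / (1 - cmod a)" for m
  proof -
    have "(\<Sum>k<N. \<omega> k * cmod (- (\<Sum>j<m. fps_nth Q (k + 1 + j) * a ^ (j + 1))))
        \<le> (\<Sum>k<N. \<Sum>j<m. \<omega> (k + 1 + j) * cmod (fps_nth Q (k + 1 + j)) * cmod a ^ j)"
    proof (rule sum_mono)
      fix k
      have "\<omega> k * cmod (- (\<Sum>j<m. fps_nth Q (k + 1 + j) * a ^ (j + 1)))
          \<le> \<omega> k * (\<Sum>j<m. cmod (fps_nth Q (k + 1 + j)) * cmod a ^ j)"
      proof (intro mult_left_mono \<omega>0)
        show "cmod (- (\<Sum>j<m. fps_nth Q (k + 1 + j) * a ^ (j + 1)))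
            \<le> (\<Sum>j<m. cmod (fps_nth Q (k + 1 + j)) * cmod a ^ j)"
          unfolding norm_minus_cancel
        proof (rule order_trans[OF norm_sum], rule sum_mono)
          fix j
          have "cmod a ^ (j + 1) \<le> cmod a ^ j" using a by (intro power_decreasing) auto
          then show "norm (fps_nth Q (k + 1 + j) * a ^ (j + 1)) \<le> cmod (fps_nth Q (k + 1 + j)) * cmod a ^ j"
            unfolding norm_mult norm_power by (intro mult_left_mono) auto
        qed
      qed
      also have "\<dots> \<le> (\<Sum>j<m. \<omega> (k + 1 + j) * cmod (fps_nth Q (k + 1 + j)) * cmod a ^ j)"
        unfolding sum_distrib_left mult.assoc
        by (intro sum_mono mult_right_mono \<omega>(2)) auto
      finally show "\<omega> k * cmod (- (\<Sum>j<m. fps_nth Q (k + 1 + j) * a ^ (j + 1)))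
          \<le> (\<Sum>j<m. \<omega> (k + 1 + j) * cmod (fps_nth Q (k + 1 + j)) * cmod a ^ j)" .
    qed
    also have "\<dots> = (\<Sum>j<m. (\<Sum>k<N. \<omega> (k + 1 + j) * cmod (fps_nth Q (k + 1 + j))) * cmod a ^ j)"
      by (subst sum.swap) (simp add: sum_distrib_right)
    also have "\<dots> \<le> (\<Sum>j<m. r * cmod a ^ j)"
    proof (intro sum_mono mult_right_mono)
      fix j
      have "(\<Sum>k<N. \<omega> (k + 1 + j) * cmod (fps_nth Q (k + 1 + j)))
          = (\<Sum>i\<in>{1 + j..<N + 1 + j}. \<omega> i * cmod (fps_nth Q i))"
        by (rule sum.reindex_bij_witness[of _ "\<lambda>i. i - 1 - j" "\<lambda>k. k + 1 + j"]) auto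
      also have "\<dots> \<le> (\<Sum>i<N + 1 + j. \<omega> i * cmod (fps_nth Q i))"
        by (rule sum_mono2) (use \<omega>0 in auto)
      also have "\<dots> \<le> r" using Q unfolding weighted_bound_def by blast
      finally show "(\<Sum>k<N. \<omega> (k + 1 + j) * cmod (fps_nth Q (k + 1 + j))) \<le> r" .
    qed auto
    also have "\<dots> = r * (\<Sum>j<m. cmod a ^ j)" by (simp add: sum_distrib_left)
    also have "\<dots> \<le> r * (1 / (1 - cmod a))"
    proof (intro mult_left_mono r)
      have "(\<Sum>j<m. cmod a ^ j) \<le> (\<Sum>j. cmod a ^ j)"
        using a by (intro sum_le_suminf summable_geometric) auto
      then show "(\<Sum>j<m. cmod a ^ j) \<le> 1 / (1 - cmod a)" using a by (simp add: suminf_geometric)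
    qed
    finally show ?thesis by simp
  qed
  ultimately have "(\<Sum>k<N. \<omega> k * cmod (- (\<Sum>j. fps_nth Q (k + 1 + j) * a ^ (j + 1)))) \<le> r / (1 - cmod a)"
    by (intro LIMSEQ_le_const2) auto
  then show "(\<Sum>k<N. \<omega> k * cmod (fps_nth (root_quotient a Q) k)) \<le> r / (1 - cmod a)"
    by (simp add: root_quotient_def)
qed

text \<open>The series \<open>h\<close> with \<open>z h (z\<^sup>2 + 1 - (a + 1/a) z) = G + \<kappa> z\<^sup>2\<close>, where \<open>\<kappa>\<close> is chosen such that the
  right-hand side vanishes at the zero \<open>a\<close> of the quadratic factor in the unit disc.\<close>

definition weyl_correction :: "complex \<Rightarrow> complex fps \<Rightarrow> complex fps" where
  "weyl_correction a G =
     root_quotient a (fps_shift 1 (G + fps_const (- eval_fps G a / a\<^sup>2) * fps_X\<^sup>2)) * Abs_fps (\<lambda>k. a ^ k)"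

lemma eval_weyl_correction:
  assumes B: "\<And>k. cmod (fps_nth G k) \<le> B" and G0: "fps_nth G 0 = 0"
    and a: "a \<noteq> 0" "cmod a < 1" and z: "cmod z < 1"
    and h: "1 \<le> fps_conv_radius (weyl_correction a G)"
  shows "(z\<^sup>2 + 1 - (a + 1 / a) * z) * (z * eval_fps (weyl_correction a G) z)
    = eval_fps G z - eval_fps G a / a\<^sup>2 * z\<^sup>2"
proof -
  define \<kappa> where "\<kappa> = - eval_fps G a / a\<^sup>2"
  define Q where "Q = G + fps_const \<kappa> * fps_X\<^sup>2"
  define T where "T = Abs_fps (\<lambda>k. a ^ k)"
  have hw: "weyl_correction a G = root_quotient a (fps_shift 1 Q) * T"
    by (simp add: weyl_correction_def Q_def \<kappa>_def T_def)
  have RG: "1 \<le> fps_conv_radius G" by (rule fps_conv_radius_ge_1[OF B])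
  have Q0: "fps_nth Q 0 = 0" by (simp add: Q_def G0)
  have XQ: "fps_X * fps_shift 1 Q = Q"
    by (rule fps_ext) (use Q0 in \<open>simp add: fps_X_mult_nth\<close>)
  have RQ: "ereal (cmod u) < fps_conv_radius Q" if u: "cmod u < 1" for u
    unfolding Q_def
  proof (rule less_le_trans[OF _ fps_conv_radius_add])
    have "ereal (cmod u) < fps_conv_radius (fps_const \<kappa> * fps_X\<^sup>2)"
      by (rule less_le_trans[OF _ fps_conv_radius_mult]) auto
    then show "ereal (cmod u) < min (fps_conv_radius G) (fps_conv_radius (fps_const \<kappa> * fps_X\<^sup>2))"
      using less_le_trans[OF _ RG, of "ereal (cmod u)"] u by simp
  qed
  have evQ: "eval_fps Q u = eval_fps G u + \<kappa> * u\<^sup>2" if u: "cmod u < 1" for u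
  proof -
    have 1: "ereal (cmod u) < fps_conv_radius G" using less_le_trans[OF _ RG, of "ereal (cmod u)"] u by simp
    have 2: "ereal (cmod u) < fps_conv_radius (fps_const \<kappa> * fps_X\<^sup>2)"
      by (rule less_le_trans[OF _ fps_conv_radius_mult]) auto
    show ?thesis unfolding Q_def using 1 2 by (simp add: eval_fps_add eval_fps_mult)
  qed
  have RQ': "ereal (cmod u) < fps_conv_radius (fps_shift 1 Q)" if "cmod u < 1" for u
    using RQ[OF that] by simp
  have evQ': "u * eval_fps (fps_shift 1 Q) u = eval_fps Q u" if u: "cmod u < 1" for u
    using arg_cong[OF XQ, of "\<lambda>f. eval_fps f u"] RQ'[OF u] by (simp add: eval_fps_mult)
  have "eval_fps Q a = 0" using evQ[OF a(2)] a by (simp add: \<kappa>_def)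
  then have zero: "eval_fps (fps_shift 1 Q) a = 0" using evQ'[OF a(2)] a by simp
  have BQ: "cmod (fps_nth (fps_shift 1 Q) k) \<le> B + cmod \<kappa>" for k
  proof -
    have "cmod (fps_nth (fps_shift 1 Q) k) \<le> cmod (fps_nth G (Suc k)) + cmod (\<kappa> * fps_nth (fps_X\<^sup>2) (Suc k))"
      unfolding Q_def by (simp add: norm_triangle_ineq)
    also have "cmod (\<kappa> * fps_nth (fps_X\<^sup>2) (Suc k)) \<le> cmod \<kappa>" by (simp add: fps_X_power_nth norm_mult)
    finally show ?thesis using B[of "Suc k"] by linarith
  qed
  have T: "(1 - fps_const a * fps_X) * T = 1"
  proof (rule fps_ext)
    fix k
    show "fps_nth ((1 - fps_const a * fps_X) * T) k = fps_nth 1 k"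
      by (cases k) (simp_all add: T_def left_diff_distrib mult.assoc)
  qed
  \<comment> \<open>The quadratic factor splits as \<open>(1 - z / a) (1 - a z)\<close>. Only the
    first factor vanishes in the disc and needs the tail quotient; the second is inverted by the
    geometric series \<open>T\<close>.\<close>
  let ?P = "(1 - fps_const (1 / a) * fps_X) * (1 - fps_const a * fps_X)"
  have "?P * weyl_correction a G
      = ((1 - fps_const (1 / a) * fps_X) * root_quotient a (fps_shift 1 Q)) * ((1 - fps_const a * fps_X) * T)"
    unfolding hw by (simp only: mult_ac)
  also have "\<dots> = fps_shift 1 Q"
    unfolding T root_quotient_identity[OF BQ a(2,1) zero] by (rule mult_1_right)
  finally have main: "?P * weyl_correction a G = fps_shift 1 Q" .
  have R1: "ereal (cmod z) < fps_conv_radius (1 - fps_const c * fps_X)" for c :: complex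
  proof (rule less_le_trans[OF _ fps_conv_radius_diff])
    have "ereal (cmod z) < fps_conv_radius (fps_const c * fps_X)"
      by (rule less_le_trans[OF _ fps_conv_radius_mult]) auto
    then show "ereal (cmod z) < min (fps_conv_radius 1) (fps_conv_radius (fps_const c * fps_X))" by simp
  qed
  have R2: "ereal (cmod z) < fps_conv_radius (fps_const c * fps_X)" for c :: complex
    by (rule less_le_trans[OF _ fps_conv_radius_mult]) auto
  have RP: "ereal (cmod z) < fps_conv_radius ?P"
    by (rule less_le_trans[OF _ fps_conv_radius_mult]) (use R1 in auto)
  have Rh: "ereal (cmod z) < fps_conv_radius (weyl_correction a G)"
    by (rule less_le_trans[OF _ h]) (use z in auto)
  have "eval_fps ?P z = (1 - 1 / a * z) * (1 - a * z)"
    by (simp add: eval_fps_mult[OF R1 R1] eval_fps_diff[OF _ R2] eval_fps_mult)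
  also have "\<dots> = z\<^sup>2 + 1 - (a + 1 / a) * z" using a by (simp add: field_simps power2_eq_square)
  finally have P: "eval_fps ?P z = z\<^sup>2 + 1 - (a + 1 / a) * z" .
  have "(z\<^sup>2 + 1 - (a + 1 / a) * z) * eval_fps (weyl_correction a G) z = eval_fps (fps_shift 1 Q) z"
    using arg_cong[OF main, of "\<lambda>f. eval_fps f z"] unfolding eval_fps_mult[OF RP Rh] P .
  then have "(z\<^sup>2 + 1 - (a + 1 / a) * z) * (z * eval_fps (weyl_correction a G) z) = eval_fps Q z"
    using evQ'[OF z] by (metis mult.left_commute)
  then show ?thesis using evQ[OF z] by (simp add: \<kappa>_def)
qed

lemma weighted_bound_weyl_correction:
  assumes \<omega>: "\<And>k. 1 \<le> \<omega> k" "\<And>m n. m \<le> n \<Longrightarrow> \<omega> m \<le> \<omega> n" "\<And>a b. \<omega> (a + b) \<le> \<omega> a * \<omega> b"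
    and a: "a \<noteq> 0" "cmod a < 1" and sum: "summable (\<lambda>k. \<omega> k * cmod a ^ k)"
  shows "\<exists>C\<ge>0. \<forall>G r. weighted_bound \<omega> G r \<longrightarrow> weighted_bound \<omega> (weyl_correction a G) (C * r)"
proof -
  have \<omega>0: "0 \<le> \<omega> k" for k using \<omega>(1)[of k] by linarith
  define S where "S = (\<Sum>k. \<omega> k * cmod a ^ k)"
  have S: "0 \<le> S" unfolding S_def using \<omega>0 by (intro suminf_nonneg sum) auto
  \<comment> \<open>The factors are the cost of adding the multiple of \<open>fps_X\<^sup>2\<close>,
    of the tail quotient, and of the geometric series.\<close>
  define C where "C = (1 + \<omega> 2 / (cmod a)\<^sup>2) / (1 - cmod a) * S"
  have "0 \<le> C" unfolding C_def using \<omega>0 a S by (intro mult_nonneg_nonneg divide_nonneg_nonneg add_nonneg_nonneg) auto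
  moreover have "weighted_bound \<omega> (weyl_correction a G) (C * r)" if G: "weighted_bound \<omega> G r" for G r
  proof -
    have r: "0 \<le> r" by (rule weighted_bound_nonneg[OF G])
    define \<kappa> where "\<kappa> = - eval_fps G a / a\<^sup>2"
    have "cmod (eval_fps G a) \<le> r / 1"
      by (rule norm_eval_fps_le[OF G _ _ a(2)]) (use \<omega> in auto)
    then have \<kappa>: "cmod \<kappa> \<le> r / (cmod a)\<^sup>2"
      by (simp add: \<kappa>_def norm_divide norm_power divide_right_mono)
    have "weighted_bound \<omega> (fps_const \<kappa> * fps_X\<^sup>2) (\<omega> 2 * (r / (cmod a)\<^sup>2))"
      unfolding weighted_bound_def
    proof
      fix N
      have "(\<Sum>k<N. \<omega> k * cmod (fps_nth (fps_const \<kappa> * fps_X\<^sup>2) k))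
          = (\<Sum>k<N. if k = 2 then \<omega> 2 * cmod \<kappa> else 0)"
        by (intro sum.cong) (auto simp: fps_X_power_nth)
      also have "\<dots> \<le> \<omega> 2 * cmod \<kappa>" using \<omega>0 by (simp add: sum.delta')
      also have "\<dots> \<le> \<omega> 2 * (r / (cmod a)\<^sup>2)" by (intro mult_left_mono \<kappa> \<omega>0)
      finally show "(\<Sum>k<N. \<omega> k * cmod (fps_nth (fps_const \<kappa> * fps_X\<^sup>2) k)) \<le> \<omega> 2 * (r / (cmod a)\<^sup>2)" .
    qed
    from weighted_bound_add[OF G this \<omega>0]
    have "weighted_bound \<omega> (root_quotient a (fps_shift 1 (G + fps_const \<kappa> * fps_X\<^sup>2)))
        ((r + \<omega> 2 * (r / (cmod a)\<^sup>2)) / (1 - cmod a))"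
      by (intro weighted_bound_root_quotient weighted_bound_shift \<omega> \<omega>0 a) auto
    moreover have "weighted_bound \<omega> (Abs_fps (\<lambda>k. a ^ k)) S"
      unfolding weighted_bound_def S_def
      using \<omega>0 by (auto simp: norm_power intro!: sum_le_suminf sum)
    ultimately have "weighted_bound \<omega> (weyl_correction a G)
        ((r + \<omega> 2 * (r / (cmod a)\<^sup>2)) / (1 - cmod a) * S)"
      unfolding weyl_correction_def \<kappa>_def by (intro weighted_bound_mult \<omega>0 \<omega>(3))
    moreover have "(r + \<omega> 2 * (r / (cmod a)\<^sup>2)) / (1 - cmod a) * S = C * r"
      by (simp add: C_def field_simps)
    ultimately show ?thesis by simp
  qed
  ultimately show ?thesis by blast
qed

section \<open>Zeros and eigenvalues\<close>

lemma summable_gevrey_weight_mult: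
  assumes "0 < c" "0 < \<beta>" "\<beta> < \<gamma>"
  shows "summable (\<lambda>k. gevrey_weight \<beta> 1 k * exp (- c * real k powr \<gamma>))"
proof (rule summable_comparison_test_bigo)
  show "summable (\<lambda>k. norm (inverse (real k ^ 2)))"
    using inverse_power_summable[of 2, where ?'a = real] by simp
  show "(\<lambda>k. gevrey_weight \<beta> 1 k * exp (- c * real k powr \<gamma>)) \<in> O(\<lambda>k. inverse (real k ^ 2))"
    unfolding gevrey_weight_def using assms by real_asymp
qed

lemma weighted_bound_interpolate:
  assumes "weighted_bound (gevrey_weight \<beta> 0) h r" "weighted_bound (gevrey_weight \<beta> 1) h s"
    and \<theta>: "0 \<le> \<theta>" "\<theta> \<le> 1"
  shows "weighted_bound (gevrey_weight \<beta> \<theta>) h (r + \<theta> * s)"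
  unfolding weighted_bound_def
proof
  fix N
  have "(\<Sum>k<N. gevrey_weight \<beta> \<theta> k * cmod (fps_nth h k))
      \<le> (\<Sum>k<N. (gevrey_weight \<beta> 0 k + \<theta> * gevrey_weight \<beta> 1 k) * cmod (fps_nth h k))"
    by (intro sum_mono mult_right_mono gevrey_weight_interpolate \<theta>) auto
  also have "\<dots> = (\<Sum>k<N. gevrey_weight \<beta> 0 k * cmod (fps_nth h k))
      + \<theta> * (\<Sum>k<N. gevrey_weight \<beta> 1 k * cmod (fps_nth h k))"
    by (simp add: ring_distribs sum.distrib sum_distrib_left mult.assoc)
  also have "\<dots> \<le> r + \<theta> * s"
    using assms unfolding weighted_bound_def by (intro add_mono mult_left_mono) auto
  finally show "(\<Sum>k<N. gevrey_weight \<beta> \<theta> k * cmod (fps_nth h k)) \<le> r + \<theta> * s" .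
qed

lemma weyl_correction_gevrey_bound:
  assumes \<beta>: "0 < \<beta>" "\<beta> < 1" and \<theta>: "0 \<le> \<theta>" "\<theta> \<le> 1" and a: "a \<noteq> 0" "cmod a < 1"
  shows "\<exists>C\<ge>0. \<forall>G r. weighted_bound (gevrey_weight \<beta> \<theta>) G r \<longrightarrow>
    weighted_bound (gevrey_weight \<beta> \<theta>) (weyl_correction a G) (C * r)"
proof (rule weighted_bound_weyl_correction[OF _ _ _ a])
  show "1 \<le> gevrey_weight \<beta> \<theta> k" for k
    using gevrey_weight_mono[OF \<beta>(1) \<theta>(1), of 0 k] by simp
  show "m \<le> n \<Longrightarrow> gevrey_weight \<beta> \<theta> m \<le> gevrey_weight \<beta> \<theta> n" for m n
    by (rule gevrey_weight_mono[OF \<beta>(1) \<theta>(1)])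
  show "gevrey_weight \<beta> \<theta> (i + j) \<le> gevrey_weight \<beta> \<theta> i * gevrey_weight \<beta> \<theta> j" for i j
    using gevrey_weight_log_concave[OF \<beta>(1) _ \<theta>(1), of 0 i j] \<beta> by simp
  show "summable (\<lambda>k. gevrey_weight \<beta> \<theta> k * cmod a ^ k)"
  proof (rule summable_comparison_test')
    \<comment> \<open>Geometric decay is stretched exponential decay with exponent 1, which exceeds
      \<open>\<beta>\<close>.\<close>
    define c where "c = - ln (cmod a)"
    have c: "0 < c" using a by (simp add: c_def)
    show "summable (\<lambda>k. gevrey_weight \<beta> 1 k * exp (- c * real k powr 1))"
      by (rule summable_gevrey_weight_mult[OF c \<beta>])
    fix k :: nat
    have "gevrey_weight \<beta> \<theta> k \<le> gevrey_weight \<beta> 1 k"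
      unfolding gevrey_weight_def using \<theta> by (intro mult_left_mono iffD2[OF exp_le_cancel_iff] mult_right_mono) auto
    moreover have "cmod a ^ k = exp (- c * real k powr 1)"
      using a by (simp add: c_def mult.commute exp_of_nat_mult)
    ultimately show "norm (gevrey_weight \<beta> \<theta> k * cmod a ^ k) \<le> gevrey_weight \<beta> 1 k * exp (- c * real k powr 1)"
      using gevrey_weight_pos[of \<beta> \<theta> k] by (simp add: mult_right_mono)
  qed
qed

section \<open>The Joukowski map from the punctured disc onto the slit plane\<close>

lemma joukowski_inj:
  fixes z u :: complex
  assumes "z \<noteq> 0" "cmod z < 1" "u \<noteq> 0" "cmod u < 1" "z + 1 / z = u + 1 / u"
  shows "z = u"
proof -
  have "(z - u) * (z * u - 1) = 0" using assms(1,3,5) by (simp add: field_simps)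
  moreover have "cmod (z * u) < 1"
    using assms(2,4) mult_strict_mono[of "cmod z" 1 "cmod u" 1] by (simp add: norm_mult)
  then have "z * u \<noteq> 1" by auto
  ultimately show ?thesis by simp
qed

text \<open>The roots of \<open>z\<^sup>2 - 2 \<mu> z + 1\<close> are mutually inverse, so one lies
  inside the disc unless both lie on the circle; there \<open>1 / z = cnj z\<close> would make
  \<open>\<mu> = Re z\<close> a point of the interval.\<close>

lemma joukowski_surj:
  assumes \<mu>: "\<mu> \<notin> complex_of_real ` {-1..1}"
  obtains z where "z \<noteq> 0" "cmod z < 1" "\<mu> = (z + 1 / z) / 2"
proof -
  define z where "z = \<mu> + csqrt (\<mu>\<^sup>2 - 1)"
  have "(z - \<mu>)\<^sup>2 = \<mu>\<^sup>2 - 1" by (simp add: z_def)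
  then have q: "z\<^sup>2 + 1 = 2 * \<mu> * z" by (simp add: power2_eq_square algebra_simps)
  then have z0: "z \<noteq> 0" by auto
  have eq: "\<mu> = (z + 1 / z) / 2" using q z0 by (simp add: field_simps power2_eq_square)
  have "cmod z \<noteq> 1"
  proof
    assume 1: "cmod z = 1"
    then have "z * cnj z = 1" using complex_norm_square[of z] by simp
    then have "1 / z = cnj z" using z0 by (simp add: field_simps)
    then have "\<mu> = complex_of_real (Re z)" using eq by (simp add: complex_add_cnj)
    moreover have "Re z \<in> {-1..1}" using abs_Re_le_cmod[of z] 1 by auto
    ultimately show False using \<mu> by blast
  qed
  then consider "cmod z < 1" | "1 < cmod z" by linarith
  then show ?thesis
  proof cases
    case 1
    then show ?thesis using that z0 eq by blast
  next
    case 2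
    have "cmod (1 / z) < 1" using 2 z0 by (simp add: norm_divide divide_less_eq)
    moreover have "\<mu> = (1 / z + 1 / (1 / z)) / 2" using eq by (simp add: add.commute)
    ultimately show ?thesis using that[of "1 / z"] z0 by simp
  qed
qed

lemma joukowski_off_interval:
  assumes z: "z \<noteq> 0" "cmod z < 1"
  shows "(z + 1 / z) / 2 \<notin> complex_of_real ` {-1..1}"
proof
  assume "(z + 1 / z) / 2 \<in> complex_of_real ` {-1..1}"
  then obtain x where x: "(z + 1 / z) / 2 = complex_of_real x" "-1 \<le> x" "x \<le> 1" by auto
  define e where "e = cis (arccos x)"
  have e: "cmod e = 1" "e \<noteq> 0" by (auto simp: e_def)
  have "e + 1 / e = complex_of_real (2 * x)"
  proof -
    have "1 / e = cnj e" by (simp add: e_def divide_inverse cis_cnj)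
    then show ?thesis using x by (simp add: complex_add_cnj e_def)
  qed
  then have "z + 1 / z = e + 1 / e" using x(1) by (simp add: field_simps)
  then have "(z - e) * (z * e - 1) = 0" using z e by (simp add: field_simps)
  then have "z = e \<or> z * e = 1" by simp
  then have "cmod z = 1" using e by (auto simp: norm_mult dest: arg_cong[of _ _ cmod])
  then show False using z by simp
qed

section \<open>Location of the zeros of the flat factor\<close>

text \<open>The zeros of \<open>flat_factor\<close> are the points where \<open>(1 - y)\<^sup>-\<^sup>\<alpha>\<close> takes one of these values.\<close>

definition zero_level :: "real \<Rightarrow> int \<Rightarrow> real" where
  "zero_level \<tau> n = 1 + (real_of_int n + 1/2) * pi / \<tau>"

text \<open>A zero of the cosine makes \<open>exp u\<close> real. Since \<open>\<alpha> < 1\<close>,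
  the imaginary part of \<open>u\<close> is less than \<open>pi\<close> in modulus and has vanishing
  sine, so it is 0: negative values are excluded and \<open>y\<close> is real.\<close>

lemma flat_factor_zeroD:
  assumes \<alpha>: "0 < \<alpha>" "\<alpha> < 1" and \<tau>: "0 < \<delta> * t" and y: "cmod y < 1" and zero: "flat_factor \<alpha> t \<delta> y = 0"
  shows "\<exists>n. 0 < zero_level (\<delta> * t) n \<and>
    y = complex_of_real (1 - zero_level (\<delta> * t) n powr (- (1 / \<alpha>)))"
proof -
  define u where "u = - of_real \<alpha> * Ln (1 - y)"
  have "cos (of_real (\<delta> * t) * flat_exponent \<alpha> y) = 0" using zero by (simp add: flat_factor_def)
  then obtain n :: int where n: "of_real (\<delta> * t) * flat_exponent \<alpha> y = of_real (n * pi) + of_real pi / 2"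
    unfolding cos_eq_0 by blast
  define R where "R = zero_level (\<delta> * t) n"
  have "flat_exponent \<alpha> y = of_real ((real_of_int n + 1/2) * pi / (\<delta> * t))"
  proof -
    have "complex_of_real (\<delta> * t) \<noteq> 0" using \<tau> by (simp only: of_real_eq_0_iff)
    then have "flat_exponent \<alpha> y = of_real (\<delta> * t) * flat_exponent \<alpha> y / of_real (\<delta> * t)"
      by (rule nonzero_mult_div_cancel_left[symmetric])
    also have "\<dots> = (of_real (n * pi) + of_real pi / 2) / of_real (\<delta> * t)" by (simp only: n)
    finally show ?thesis by (simp add: ring_distribs)
  qed
  moreover have "exp u = 1 + flat_exponent \<alpha> y" by (simp add: flat_exponent_def u_def)
  ultimately have expu: "exp u = of_real R" by (simp only: R_def zero_level_def of_real_add of_real_1)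
  have Re: "0 < Re (1 - y)" using y complex_Re_le_cmod[of y] by simp
  have "\<bar>Im (Ln (1 - y))\<bar> < pi / 2" by (rule Re_Ln_pos_lt_imp[OF Re])
  then have "\<alpha> * \<bar>Im (Ln (1 - y))\<bar> < 1 * pi"
    using \<alpha> pi_gt_zero by (intro mult_strict_mono') auto
  then have Imu: "\<bar>Im u\<bar> < pi" using \<alpha> by (simp add: u_def abs_mult)
  have "exp (Re u) * sin (Im u) = 0" using arg_cong[OF expu, of Im] by (simp add: Im_exp)
  then have "sin (Im u) = 0" by simp
  then have Imu0: "Im u = 0" using Imu sin_eq_0_pi[of "Im u"] by linarith
  have "Re (exp u) = exp (Re u)" by (simp only: Re_exp Imu0 cos_zero mult_1_right)
  then have R: "R = exp (Re u)" by (simp only: expu Re_complex_of_real)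
  have "Re u = ln R" by (simp only: R ln_exp)
  then have u: "u = of_real (ln R)" using Imu0 by (intro complex_eqI) simp_all
  have "Ln (1 - y) = - u / of_real \<alpha>" using \<alpha> by (simp add: u_def)
  then have "Ln (1 - y) = of_real (- (1 / \<alpha>) * ln R)" by (simp add: u)
  moreover have "1 - y \<noteq> 0" using Re by auto
  ultimately have "1 - y = exp (of_real (- (1 / \<alpha>) * ln R))" by (metis exp_Ln)
  also have "\<dots> = of_real (R powr (- (1 / \<alpha>)))"
  proof -
    have "R powr (- (1 / \<alpha>)) = exp (- (1 / \<alpha>) * ln R)" using R by (simp only: powr_def) auto
    then show ?thesis by (simp only: exp_of_real)
  qed
  finally have "y = complex_of_real (1 - R powr (- (1 / \<alpha>)))" by (simp add: algebra_simps)
  moreover have "0 < R" unfolding R by simp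
  ultimately show ?thesis unfolding R_def by blast
qed

lemma flat_factor_zeroI:
  assumes \<alpha>: "0 < \<alpha>" and \<tau>: "0 < \<delta> * t" and n: "0 \<le> n"
  shows "0 < 1 - zero_level (\<delta> * t) n powr (- (1 / \<alpha>))" "1 - zero_level (\<delta> * t) n powr (- (1 / \<alpha>)) < 1"
    and "flat_factor \<alpha> t \<delta> (complex_of_real (1 - zero_level (\<delta> * t) n powr (- (1 / \<alpha>)))) = 0"
proof -
  define R where "R = zero_level (\<delta> * t) n"
  have R: "1 < R" unfolding R_def zero_level_def using \<tau> n by simp
  define s where "s = R powr (- (1 / \<alpha>))"
  have s: "0 < s" "s < 1" unfolding s_def using R \<alpha> by (auto intro!: powr_less_one)
  then show "0 < 1 - zero_level (\<delta> * t) n powr (- (1 / \<alpha>))" "1 - zero_level (\<delta> * t) n powr (- (1 / \<alpha>)) < 1"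
    by (auto simp: s_def R_def)
  have "Ln (of_real s) = of_real (ln s)" using s by (simp add: Ln_of_real)
  also have "ln s = - (1 / \<alpha>) * ln R" using R by (simp add: s_def ln_powr)
  finally have "- of_real \<alpha> * Ln (1 - complex_of_real (1 - s)) = of_real (ln R)" using \<alpha> by simp
  then have "flat_exponent \<alpha> (complex_of_real (1 - s)) = of_real (R - 1)"
    unfolding flat_exponent_def using R by (simp only: exp_of_real) simp
  then have "of_real (\<delta> * t) * flat_exponent \<alpha> (complex_of_real (1 - s)) = of_real (\<delta> * t * (R - 1))"
    by simp
  also have "\<delta> * t * (R - 1) = \<delta> * t * ((real_of_int n + 1/2) * pi / (\<delta> * t))"
    by (simp add: R_def zero_level_def)
  also have "\<dots> = (real_of_int n + 1/2) * pi"
    using \<tau> by (metis less_irrefl nonzero_mult_div_cancel_left times_divide_eq_right)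
  also have "\<dots> = real_of_int n * pi + pi / 2" by (simp add: algebra_simps)
  finally have "cos (of_real (\<delta> * t) * flat_exponent \<alpha> (complex_of_real (1 - s))) = 0"
    unfolding cos_eq_0 by (intro exI[of _ n]) simp
  then show "flat_factor \<alpha> t \<delta> (complex_of_real (1 - zero_level (\<delta> * t) n powr (- (1 / \<alpha>)))) = 0"
    by (simp add: flat_factor_def s_def R_def)
qed

text \<open>At a zero the level equals \<open>cmod (1 - y) powr (- \<alpha>)\<close>. Positivity
  bounds the index \<open>n\<close> from below, the distance \<open>\<eta>\<close> from 1 bounds it
  from above.\<close>

lemma flat_factor_zeros:
  assumes \<alpha>: "0 < \<alpha>" "\<alpha> < 1" and \<delta>: "0 < \<delta>" and t: "0 < t"
  defines "Z \<equiv> {y. cmod y < 1 \<and> flat_factor \<alpha> t \<delta> y = 0}"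
  shows "infinite Z" and "\<And>\<eta>. 0 < \<eta> \<Longrightarrow> finite {y \<in> Z. \<eta> \<le> cmod (1 - y)}"
proof -
  define \<tau> where "\<tau> = \<delta> * t"
  have \<tau>: "0 < \<tau>" using \<delta> t by (simp add: \<tau>_def)
  let ?p = "\<lambda>n. complex_of_real (1 - zero_level \<tau> n powr (- (1 / \<alpha>)))"
  have in_Z: "?p n \<in> Z" if "0 \<le> n" for n
  proof -
    have "\<bar>1 - zero_level \<tau> n powr (- (1 / \<alpha>))\<bar> < 1"
      using flat_factor_zeroI(1,2)[OF \<alpha>(1) \<tau>[unfolded \<tau>_def] that] by (simp add: \<tau>_def)
    then have "cmod (?p n) < 1" by (simp only: norm_of_real)
    then show ?thesis
      using flat_factor_zeroI(3)[OF \<alpha>(1) \<tau>[unfolded \<tau>_def] that] by (simp add: Z_def \<tau>_def)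
  qed
  have "inj_on (\<lambda>n. ?p (int n)) UNIV"
  proof (rule inj_onI)
    fix m n :: nat
    assume "?p (int m) = ?p (int n)"
    then have eq: "zero_level \<tau> (int m) powr (- (1 / \<alpha>)) = zero_level \<tau> (int n) powr (- (1 / \<alpha>))"
      unfolding of_real_eq_iff by simp
    have pos: "0 < zero_level \<tau> (int k)" for k
      unfolding zero_level_def using \<tau> by (intro add_pos_nonneg) auto
    have "(zero_level \<tau> (int m) powr (- (1 / \<alpha>))) powr (- \<alpha>)
        = (zero_level \<tau> (int n) powr (- (1 / \<alpha>))) powr (- \<alpha>)" using eq by simp
    then have "zero_level \<tau> (int m) = zero_level \<tau> (int n)"
      using \<alpha> pos by (simp add: powr_powr less_imp_le)
    then show "m = n" using \<tau> by (simp add: zero_level_def)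
  qed
  then have "infinite ((\<lambda>n. ?p (int n)) ` UNIV)" using finite_imageD infinite_UNIV_nat by blast
  moreover have "(\<lambda>n. ?p (int n)) ` UNIV \<subseteq> Z" using in_Z by auto
  ultimately show "infinite Z" using finite_subset by blast
  fix \<eta> :: real assume \<eta>: "0 < \<eta>"
  define M where "M = \<eta> powr (- \<alpha>)"
  have "{y \<in> Z. \<eta> \<le> cmod (1 - y)} \<subseteq> ?p ` {\<lfloor>- \<tau> / pi - 1/2\<rfloor>..\<lceil>\<tau> * M / pi\<rceil>}"
  proof
    fix y assume "y \<in> {y \<in> Z. \<eta> \<le> cmod (1 - y)}"
    then have y: "cmod y < 1" "flat_factor \<alpha> t \<delta> y = 0" "\<eta> \<le> cmod (1 - y)" by (auto simp: Z_def)
    obtain n where n: "0 < zero_level \<tau> n" "y = ?p n"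
      using flat_factor_zeroD[OF \<alpha> \<tau>[unfolded \<tau>_def] y(1,2)] unfolding \<tau>_def by blast
    define R where "R = zero_level \<tau> n"
    have "1 - y = complex_of_real (R powr (- (1 / \<alpha>)))" by (simp add: n(2) R_def)
    then have "\<eta> \<le> R powr (- (1 / \<alpha>))" using y(3) by simp
    then have "(R powr (- (1 / \<alpha>))) powr (- \<alpha>) \<le> \<eta> powr (- \<alpha>)"
      using \<eta> \<alpha> by (intro powr_mono2') auto
    then have RM: "R \<le> M" using n(1) \<alpha> by (simp add: powr_powr M_def R_def less_imp_le)
    have R: "\<tau> * R = \<tau> + (real_of_int n + 1/2) * pi" using \<tau> by (simp add: R_def zero_level_def field_simps)
    have "0 < \<tau> * R" using \<tau> n(1) by (simp add: R_def)
    then have "- \<tau> < (real_of_int n + 1/2) * pi" using R by linarith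
    then have "- \<tau> / pi < real_of_int n + 1/2" by (simp only: pos_divide_less_eq[OF pi_gt_zero])
    then have lo: "\<lfloor>- \<tau> / pi - 1/2\<rfloor> \<le> n" by linarith
    have "\<tau> * R \<le> \<tau> * M" using RM \<tau> by (intro mult_left_mono) auto
    then have "(real_of_int n + 1/2) * pi \<le> \<tau> * M" using R \<tau> by linarith
    then have "real_of_int n + 1/2 \<le> \<tau> * M / pi" by (simp only: pos_le_divide_eq[OF pi_gt_zero])
    then have hi: "n \<le> \<lceil>\<tau> * M / pi\<rceil>" by linarith
    show "y \<in> ?p ` {\<lfloor>- \<tau> / pi - 1/2\<rfloor>..\<lceil>\<tau> * M / pi\<rceil>}" using n(2) lo hi by auto
  qed
  then show "finite {y \<in> Z. \<eta> \<le> cmod (1 - y)}" by (rule finite_subset) auto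
qed

lemma accumulation_unique:
  fixes S :: "complex set"
  assumes inf: "infinite S" and fin: "\<And>e. 0 < e \<Longrightarrow> finite (S - ball p e)"
  shows "{z. z islimpt S} = {p}"
proof -
  have "p islimpt S" unfolding islimpt_eq_infinite_ball
  proof (intro allI impI)
    fix e :: real assume "0 < e"
    moreover have "S = (S - ball p e) \<union> (S \<inter> ball p e)" by blast
    ultimately show "infinite (S \<inter> ball p e)" using inf fin finite_UnI by metis
  qed
  moreover have "z = p" if "z islimpt S" for z
  proof (rule ccontr)
    assume "z \<noteq> p"
    define e where "e = dist z p / 2"
    have e: "0 < e" using \<open>z \<noteq> p\<close> by (simp add: e_def)
    have "S \<inter> ball z e \<subseteq> S - ball p e"
    proof
      fix x assume x: "x \<in> S \<inter> ball z e"
      have "dist z p \<le> dist z x + dist p x" by (metis dist_commute dist_triangle)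
      then show "x \<in> S - ball p e" using x by (auto simp: e_def)
    qed
    then have "finite (S \<inter> ball z e)" using fin[OF e] finite_subset by blast
    then show False using that e unfolding islimpt_eq_infinite_ball by blast
  qed
  ultimately show ?thesis by blast
qed

section \<open>Choice of the parameters and conclusion\<close>

text \<open>The order of choice matters: \<open>\<alpha>\<close> makes the decay stronger than the
  weight, \<open>t\<close> depends on \<open>\<alpha>\<close> alone, \<open>\<delta>\<close> makes
  the polynomial norm small, and \<open>\<theta>\<close> comes last, against an exponential norm
  that is finite but possibly huge.\<close>

lemma flat_perturbation_small:
  assumes \<beta>: "0 < \<beta>" "\<beta> < 1/2" and w: "cmod w = 1" and a: "a \<noteq> 0" "cmod a < 1" and \<eta>: "0 < \<eta>"
  shows "\<exists>\<alpha> t \<delta> G \<theta>. 0 < \<alpha> \<and> \<alpha> < 1 \<and> 0 < t \<and> 0 < \<delta> \<and> 0 < \<theta> \<and> \<theta> \<le> 1 \<and>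
    (\<forall>k. cmod (fps_nth G k) \<le> 1) \<and> fps_nth G 0 = 0 \<and>
    (\<forall>z. cmod z < 1 \<longrightarrow> eval_fps G z = flat_perturbation \<alpha> t \<delta> (w * z)) \<and>
    weighted_bound (gevrey_weight \<beta> \<theta>) (weyl_correction a G) \<eta>"
proof -
  \<comment> \<open>The condition \<open>\<beta> < \<alpha> / (1 + \<alpha>)\<close> amounts to
    \<open>\<alpha> > \<beta> / (1 - \<beta>)\<close>, compatible with \<open>\<alpha> < 1\<close>
    because \<open>\<beta> < 1/2\<close>.\<close>
  have "\<beta> / (1 - \<beta>) < 1" using \<beta> by (simp add: divide_less_eq)
  then obtain \<alpha> where \<alpha>: "\<beta> / (1 - \<beta>) < \<alpha>" "\<alpha> < 1" using dense by blast
  have "0 < \<beta> / (1 - \<beta>)" using \<beta> by simp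
  then have \<alpha>0: "0 < \<alpha>" using \<alpha>(1) by linarith
  define \<gamma> where "\<gamma> = \<alpha> / (1 + \<alpha>)"
  have \<beta>\<gamma>: "\<beta> < \<gamma>"
  proof -
    have "\<beta> < \<alpha> * (1 - \<beta>)" using \<alpha>(1) \<beta> by (simp add: pos_divide_less_eq)
    then have "\<beta> * (1 + \<alpha>) < \<alpha>" by (simp add: algebra_simps)
    then show ?thesis using \<alpha>0 by (simp add: \<gamma>_def pos_less_divide_eq)
  qed
  obtain t C where t: "0 < t" and C: "0 \<le> C"
    and small: "\<And>\<delta> k. 0 < \<delta> \<Longrightarrow> \<delta> \<le> 1 \<Longrightarrow>
        cmod (fps_nth (fps_expansion (flat_perturbation \<alpha> t \<delta>) 0) k)
        \<le> C * \<delta> powr (1/4) * (1 + real k) powr (- (9/4))"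
    and flat: "\<And>\<delta>. 0 < \<delta> \<Longrightarrow> \<delta> \<le> 1 \<Longrightarrow> \<exists>c>0. \<exists>B. \<forall>k\<ge>3.
        cmod (fps_nth (fps_expansion (flat_perturbation \<alpha> t \<delta>) 0) k) \<le> B * exp (- c * real k powr \<gamma>)"
    using flat_perturbation_coefficients[OF \<alpha>0 \<alpha>(2)] unfolding \<gamma>_def by blast
  obtain C0 where C0: "0 \<le> C0" "\<And>G r. weighted_bound (gevrey_weight \<beta> 0) G r \<Longrightarrow>
      weighted_bound (gevrey_weight \<beta> 0) (weyl_correction a G) (C0 * r)"
    using weyl_correction_gevrey_bound[OF \<beta>(1) _ _ _ a, of 0] \<beta> by auto
  obtain C1 where C1: "0 \<le> C1" "\<And>G r. weighted_bound (gevrey_weight \<beta> 1) G r \<Longrightarrow>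
      weighted_bound (gevrey_weight \<beta> 1) (weyl_correction a G) (C1 * r)"
    using weyl_correction_gevrey_bound[OF \<beta>(1) _ _ _ a, of 1] \<beta> by auto
  define S where "S = (\<Sum>n. (1 + real n) powr (- (9/8)))"
  have S: "0 \<le> S" unfolding S_def by (intro suminf_nonneg summable_powr_Suc) auto
  \<comment> \<open>\<open>d\<close> will be \<open>\<delta> powr (1/4)\<close>, the rate in
    \<open>small\<close>. In the denominator, \<open>C0 * C * S\<close> controls the weighted norm,
    \<open>C\<close> the single coefficients, and 1 keeps it positive.\<close>
  define d where "d = min 1 (min (\<eta> / 2) 1 / (C0 * C * S + C + 1))"
  have den: "0 < C0 * C * S + C + 1" using C0(1) C S by (intro add_nonneg_pos add_nonneg_nonneg mult_nonneg_nonneg) auto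
  have d: "0 < d" "d \<le> 1" using \<eta> den by (auto simp: d_def)
  have dden: "d * (C0 * C * S + C + 1) \<le> min (\<eta> / 2) 1"
  proof -
    have "d \<le> min (\<eta> / 2) 1 / (C0 * C * S + C + 1)" by (simp add: d_def)
    then show ?thesis using den by (simp only: pos_le_divide_eq)
  qed
  then have dd: "d * (C0 * C * S + C + 1) \<le> \<eta> / 2" "d * (C0 * C * S + C + 1) \<le> 1" by simp_all
  have dC: "C0 * (C * d * S) \<le> \<eta> / 2" "C * d \<le> 1"
  proof -
    have "0 \<le> C0 * C * S * d" "0 \<le> C * d" using C0(1) C S d by auto
    moreover have "d * (C0 * C * S + C + 1) = C0 * (C * d * S) + C * d + d" by (simp add: algebra_simps)
    moreover have "C0 * (C * d * S) = C0 * C * S * d" by simp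
    ultimately show "C0 * (C * d * S) \<le> \<eta> / 2" "C * d \<le> 1"
      using dd d by linarith+
  qed
  define \<delta> where "\<delta> = d ^ 4"
  have \<delta>: "0 < \<delta>" "\<delta> \<le> 1" using d by (auto simp: \<delta>_def power_le_one)
  have \<delta>d: "\<delta> powr (1/4) = d"
    using d by (simp add: \<delta>_def powr_powr flip: powr_numeral)
  let ?g = "flat_perturbation \<alpha> t \<delta>"
  \<comment> \<open>Rotation by \<open>w\<close> moves the singularity from 1 to
    \<open>1 / w\<close> and preserves the moduli of the coefficients.\<close>
  define G where "G = Abs_fps (\<lambda>k. w ^ k * fps_nth (fps_expansion ?g 0) k)"
  have Gk: "cmod (fps_nth G k) = cmod (fps_nth (fps_expansion ?g 0) k)" for k
    by (simp add: G_def norm_mult norm_power w)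
  have G_le: "cmod (fps_nth G k) \<le> C * d * (1 + real k) powr (- (9/4))" for k
    using small[OF \<delta>, of k] by (simp add: Gk \<delta>d)
  have G1: "cmod (fps_nth G k) \<le> 1" for k
  proof -
    have "(1 + real k) powr (- (9/4)) \<le> 1 powr (- (9/4))" by (intro powr_mono2') auto
    then have "C * d * (1 + real k) powr (- (9/4)) \<le> C * d * 1" using C d by (intro mult_left_mono) auto
    then show ?thesis using G_le[of k] dC(2) by linarith
  qed
  have G0: "fps_nth G 0 = 0"
    by (simp add: G_def fps_expansion_def flat_perturbation_def flat_factor_def flat_exponent_def)
  have hol: "?g holomorphic_on eball 0 1"
  proof -
    have "?g holomorphic_on ball 0 1"
      unfolding flat_perturbation_def
      by (intro holomorphic_intros holomorphic_flat_factor) (auto simp: unit_disc_avoids_slit)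
    then show ?thesis using eball_ereal[of "0::complex" 1] by (simp add: one_ereal_def)
  qed
  have evG: "eval_fps G z = ?g (w * z)" if z: "cmod z < 1" for z
  proof -
    have "eval_fps G z = eval_fps (fps_expansion ?g 0) (w * z)"
      by (simp add: eval_fps_def G_def power_mult_distrib mult_ac)
    also have "\<dots> = ?g (0 + w * z)"
      by (rule eval_fps_expansion'[OF hol]) (use z w in \<open>simp add: norm_mult\<close>)
    finally show ?thesis by simp
  qed
  have wb0: "weighted_bound (gevrey_weight \<beta> 0) G (C * d * S)"
    unfolding weighted_bound_def
  proof
    fix N
    have "(\<Sum>k<N. gevrey_weight \<beta> 0 k * cmod (fps_nth G k)) \<le> (\<Sum>k<N. C * d * (1 + real k) powr (- (9/8)))"
    proof (rule sum_mono)
      fix k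
      have "gevrey_weight \<beta> 0 k * cmod (fps_nth G k)
          \<le> (1 + real k) powr (9/8) * (C * d * (1 + real k) powr (- (9/4)))"
        unfolding gevrey_weight_def using G_le[of k] by (simp add: mult_left_mono)
      also have "\<dots> = C * d * ((1 + real k) powr (9/8) * (1 + real k) powr (- (9/4)))" by simp
      also have "(1 + real k) powr (9/8) * (1 + real k) powr (- (9/4)) = (1 + real k) powr (- (9/8))"
        unfolding powr_add[symmetric] by simp
      finally show "gevrey_weight \<beta> 0 k * cmod (fps_nth G k) \<le> C * d * (1 + real k) powr (- (9/8))" .
    qed
    also have "\<dots> = C * d * (\<Sum>k<N. (1 + real k) powr (- (9/8)))" by (simp add: sum_distrib_left)
    also have "\<dots> \<le> C * d * S"
      unfolding S_def using C d by (intro mult_left_mono sum_le_suminf summable_powr_Suc) auto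
    finally show "(\<Sum>k<N. gevrey_weight \<beta> 0 k * cmod (fps_nth G k)) \<le> C * d * S" .
  qed
  obtain c B where c: "0 < c" and B: "\<And>k. 3 \<le> k \<Longrightarrow> cmod (fps_nth G k) \<le> B * exp (- c * real k powr \<gamma>)"
    using flat[OF \<delta>] unfolding Gk by blast
  have sum1: "summable (\<lambda>k. gevrey_weight \<beta> 1 k * cmod (fps_nth G k))"
  proof (rule summable_comparison_test'[where N = 3])
    show "summable (\<lambda>k. B * (gevrey_weight \<beta> 1 k * exp (- c * real k powr \<gamma>)))"
      by (intro summable_mult summable_gevrey_weight_mult c \<beta> \<beta>\<gamma>)
    fix k :: nat assume k: "3 \<le> k"
    have "gevrey_weight \<beta> 1 k * cmod (fps_nth G k) \<le> gevrey_weight \<beta> 1 k * (B * exp (- c * real k powr \<gamma>))"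
      by (intro mult_left_mono B[OF k] less_imp_le gevrey_weight_pos)
    then show "norm (gevrey_weight \<beta> 1 k * cmod (fps_nth G k)) \<le> B * (gevrey_weight \<beta> 1 k * exp (- c * real k powr \<gamma>))"
      using gevrey_weight_pos[of \<beta> 1 k] by (simp add: mult.left_commute)
  qed
  define s where "s = (\<Sum>k. gevrey_weight \<beta> 1 k * cmod (fps_nth G k))"
  have wb1: "weighted_bound (gevrey_weight \<beta> 1) G s"
    unfolding weighted_bound_def s_def
    using gevrey_weight_pos[of \<beta> 1] by (intro allI sum_le_suminf sum1) (auto simp: less_imp_le)
  have s: "0 \<le> s" by (rule weighted_bound_nonneg[OF wb1])
  define \<theta> where "\<theta> = min 1 (\<eta> / 2 / (C1 * s + 1))"
  have den1: "0 < C1 * s + 1" using C1(1) s by (intro add_nonneg_pos) auto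
  have \<theta>: "0 < \<theta>" "\<theta> \<le> 1" using \<eta> den1 by (auto simp: \<theta>_def)
  have "\<theta> * (C1 * s + 1) \<le> \<eta> / 2"
  proof -
    have "\<theta> \<le> \<eta> / 2 / (C1 * s + 1)" by (simp add: \<theta>_def)
    then show ?thesis using den1 by (simp only: pos_le_divide_eq)
  qed
  then have \<theta>s: "\<theta> * (C1 * s) \<le> \<eta> / 2" using \<theta> by (simp add: algebra_simps)
  have "weighted_bound (gevrey_weight \<beta> \<theta>) (weyl_correction a G) (C0 * (C * d * S) + \<theta> * (C1 * s))"
    by (intro weighted_bound_interpolate C0(2) C1(2) wb0 wb1) (use \<theta> in auto)
  then have "weighted_bound (gevrey_weight \<beta> \<theta>) (weyl_correction a G) \<eta>"
    by (rule weighted_bound_mono) (use dC(1) \<theta>s in linarith)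
  then show ?thesis using \<alpha>0 \<alpha>(2) t \<delta>(1) \<theta> G1 G0 evG by blast
qed

theorem theorem2:
  fixes \<epsilon> \<nu> :: real
  assumes "0 < \<epsilon>" and "\<epsilon> < 1/2" and "-1 < \<nu>" and "\<nu> < 1"
  shows "\<exists>J. J \<in> jacobi_class (1/2 - \<epsilon>) \<and>
             infinite (discrete_spectrum J) \<and>
             accumulation_set J = {complex_of_real \<nu>}"
proof -
  define \<beta> where "\<beta> = 1/2 - \<epsilon>"
  have \<beta>: "0 < \<beta>" "\<beta> < 1/2" using assms by (auto simp: \<beta>_def)
  \<comment> \<open>On the unit circle \<open>1 / w\<close> is \<open>cnj w\<close>, so the point
    \<open>1 / w\<close>, where the zeros accumulate, corresponds to the spectral value
    \<open>Re w = \<nu>\<close>.\<close>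
  define w where "w = cis (arccos \<nu>)"
  have w: "cmod w = 1" "w \<noteq> 0" by (auto simp: w_def)
  have w_inv: "1 / w = cnj w" by (simp add: w_def divide_inverse cis_cnj)
  have w_mean: "(1 / w + w) / 2 = complex_of_real \<nu>"
    unfolding w_inv using assms by (simp add: complex_eq_iff w_def)
  \<comment> \<open>This is where \<open>\<nu>\<close> must be an interior point: \<open>w\<close>,
    which also becomes the diagonal entry \<open>b0\<close>, avoids the interval and is the
    Joukowski image of a point \<open>a\<close> of the disc.\<close>
  have "Im w \<noteq> 0"
  proof -
    have "0 < sin (arccos \<nu>)" using assms arccos_lt_bounded[of \<nu>] by (intro sin_gt_zero) auto
    then show ?thesis by (simp add: w_def)
  qed
  then have "w \<notin> complex_of_real ` {-1..1}" by auto
  then obtain a where a: "a \<noteq> 0" "cmod a < 1" "w = (a + 1 / a) / 2" by (rule joukowski_surj)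
  define S where "S = (\<Sum>n. (1 + real n) powr (- (9/8)))"
  have S: "0 \<le> S" unfolding S_def by (intro suminf_nonneg summable_powr_Suc) auto
  define \<eta> where "\<eta> = 1 / (26 * (1 + S)\<^sup>2)"
  have \<eta>: "0 < \<eta>" using S by (auto simp: \<eta>_def intro!: divide_pos_pos mult_pos_pos)
  have \<eta>1: "26 * (1 + S)\<^sup>2 * \<eta> \<le> 1" using S by (simp add: \<eta>_def)
  obtain \<alpha> t \<delta> G \<theta> where pars: "0 < \<alpha>" "\<alpha> < 1" "0 < t" "0 < \<delta>" "0 < \<theta>" "\<theta> \<le> 1"
    and G1: "\<And>k. cmod (fps_nth G k) \<le> 1" and G0: "fps_nth G 0 = 0"
    and evG: "\<And>z. cmod z < 1 \<Longrightarrow> eval_fps G z = flat_perturbation \<alpha> t \<delta> (w * z)"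
    and wb: "weighted_bound (gevrey_weight \<beta> \<theta>) (weyl_correction a G) \<eta>"
    using flat_perturbation_small[OF \<beta> w(1) a(1,2) \<eta>] by blast
  define h where "h = weyl_correction a G"
  \<comment> \<open>\<open>1 - w\<^sup>2\<close> turns the unperturbed function into
    \<open>(1 - w z)\<^sup>2\<close>; the last term cancels the multiple of \<open>z\<^sup>2\<close>
    introduced by \<open>weyl_correction\<close>.\<close>
  define c0 where "c0 = (1 - w\<^sup>2 - eval_fps G a / a\<^sup>2) / 2"
  have c2: "2 * c0 = 1 - w\<^sup>2 - eval_fps G a / a\<^sup>2" by (simp add: c0_def)
  obtain J where J: "J \<in> jacobi_class \<beta>" and spec: "\<And>z. z \<noteq> 0 \<Longrightarrow> cmod z < 1 \<Longrightarrow>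
    (z + 1 / z) / 2 \<in> ell2_spectrum (matrix_op J) \<longleftrightarrow>
       (z\<^sup>2 + 1 - 2 * w * z) * (1 + z * eval_fps h z) = 2 * c0 * z\<^sup>2"
    using jacobi_from_weyl_function[OF \<beta>(1) _ pars(5,6) wb, of w c0] \<beta>(2) \<eta>1
    unfolding S_def h_def by auto
  define Z where "Z = {y. cmod y < 1 \<and> flat_factor \<alpha> t \<delta> y = 0}"
  have spec': "(z + 1 / z) / 2 \<in> ell2_spectrum (matrix_op J) \<longleftrightarrow> w * z \<in> Z"
    if z: "z \<noteq> 0" "cmod z < 1" for z
  proof -
    have h1: "1 \<le> fps_conv_radius h"
    proof (rule fps_conv_radius_ge_1)
      fix k
      have "1 * cmod (fps_nth h k) \<le> gevrey_weight \<beta> \<theta> k * cmod (fps_nth h k)"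
        using gevrey_weight_mono[OF \<beta>(1), of \<theta> 0 k] pars(5) by (intro mult_right_mono) auto
      also have "\<dots> \<le> \<eta>"
        unfolding h_def by (rule weighted_bound_nth[OF wb]) (rule less_imp_le[OF gevrey_weight_pos])
      finally show "cmod (fps_nth h k) \<le> \<eta>" by simp
    qed
    have w2: "2 * w = a + 1 / a" by (simp add: a(3))
    have "(z\<^sup>2 + 1 - 2 * w * z) * (z * eval_fps h z)
        = flat_perturbation \<alpha> t \<delta> (w * z) - eval_fps G a / a\<^sup>2 * z\<^sup>2"
      unfolding w2 h_def evG[OF z(2), symmetric]
      by (rule eval_weyl_correction[OF G1 G0 a(1,2) z(2) h1[unfolded h_def]])
    then have "(z\<^sup>2 + 1 - 2 * w * z) * (1 + z * eval_fps h z) - 2 * c0 * z\<^sup>2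
        = (1 - w * z)\<^sup>2 + flat_perturbation \<alpha> t \<delta> (w * z)"
      unfolding c2 by (simp add: algebra_simps power2_eq_square)
    also have "\<dots> = (1 - w * z)\<^sup>2 * flat_factor \<alpha> t \<delta> (w * z)"
      by (simp add: flat_perturbation_def algebra_simps)
    finally have eq: "(z\<^sup>2 + 1 - 2 * w * z) * (1 + z * eval_fps h z) = 2 * c0 * z\<^sup>2
        \<longleftrightarrow> (1 - w * z)\<^sup>2 * flat_factor \<alpha> t \<delta> (w * z) = 0" by (metis eq_iff_diff_eq_0)
    have wz: "cmod (w * z) < 1" using z w by (simp add: norm_mult)
    then have "1 - w * z \<noteq> 0" by auto
    then show ?thesis unfolding spec[OF z] eq using wz by (simp add: Z_def)
  qed
  \<comment> \<open>The eigenvalue as a function of the rotated variable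
    \<open>y = w z\<close>.\<close>
  define F where "F y = (y / w + 1 / (y / w)) / 2" for y
  have "flat_factor \<alpha> t \<delta> 0 = 1" by (simp add: flat_factor_def flat_exponent_def)
  then have Z0: "0 \<notin> Z" by (auto simp: Z_def)
  have yw: "y / w \<noteq> 0" "cmod (y / w) < 1" if "y \<in> Z" for y
    using that Z0 w by (auto simp: Z_def norm_divide)
  have disc: "discrete_spectrum J = F ` Z"
  proof (intro equalityI subsetI)
    fix \<mu> assume "\<mu> \<in> discrete_spectrum J"
    then have \<mu>: "\<mu> \<in> ell2_spectrum (matrix_op J)" "\<mu> \<notin> complex_of_real ` {-1..1}"
      by (auto simp: discrete_spectrum_def)
    obtain z where z: "z \<noteq> 0" "cmod z < 1" "\<mu> = (z + 1 / z) / 2" using joukowski_surj[OF \<mu>(2)] .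
    have "w * z \<in> Z" using spec'[OF z(1,2)] \<mu>(1) z(3) by simp
    moreover have "\<mu> = F (w * z)" using w z(3) by (simp add: F_def)
    ultimately show "\<mu> \<in> F ` Z" by blast
  next
    fix \<mu> assume "\<mu> \<in> F ` Z"
    then obtain y where y: "y \<in> Z" "\<mu> = F y" by blast
    have "w * (y / w) \<in> Z" using y w by simp
    then have "\<mu> \<in> ell2_spectrum (matrix_op J)"
      unfolding y(2) F_def using spec'[OF yw[OF y(1)]] by blast
    moreover have "\<mu> \<notin> complex_of_real ` {-1..1}"
      unfolding y(2) F_def by (rule joukowski_off_interval[OF yw[OF y(1)]])
    ultimately show "\<mu> \<in> discrete_spectrum J" by (simp add: discrete_spectrum_def)
  qed
  have "inj_on F Z"
  proof (rule inj_onI)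
    fix x y assume x: "x \<in> Z" and y: "y \<in> Z" and "F x = F y"
    then have "x / w + 1 / (x / w) = y / w + 1 / (y / w)"
      unfolding F_def divide_cancel_right by simp
    from joukowski_inj[OF yw[OF x] yw[OF y] this] show "x = y" using w by simp
  qed
  then have inf: "infinite (discrete_spectrum J)"
    unfolding disc using flat_factor_zeros(1)[OF pars(1,2,4,3)] finite_imageD unfolding Z_def by blast
  have "finite (discrete_spectrum J - ball (complex_of_real \<nu>) e)" if e: "0 < e" for e
  proof -
    \<comment> \<open>The zeros accumulate only at the boundary point 1, so continuity of
      \<open>F\<close> there leaves finitely many eigenvalues outside any ball around
      \<open>\<nu>\<close>.\<close>
    have "isCont F 1" unfolding F_def using w by (intro continuous_intros) auto
    moreover have "F 1 = complex_of_real \<nu>" using w_mean w by (simp add: F_def)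
    ultimately obtain \<rho> where \<rho>: "0 < \<rho>" "\<And>y. dist y 1 < \<rho> \<Longrightarrow> dist (F y) (complex_of_real \<nu>) < e"
      using e unfolding continuous_at_eps_delta by metis
    have "discrete_spectrum J - ball (complex_of_real \<nu>) e \<subseteq> F ` {y \<in> Z. \<rho> \<le> cmod (1 - y)}"
    proof
      fix \<mu> assume "\<mu> \<in> discrete_spectrum J - ball (complex_of_real \<nu>) e"
      then obtain y where y: "y \<in> Z" "\<mu> = F y" "\<not> dist (F y) (complex_of_real \<nu>) < e"
        unfolding disc by (auto simp: dist_commute)
      then have "\<not> dist y 1 < \<rho>" using \<rho>(2) by blast
      then have "\<rho> \<le> cmod (1 - y)" by (simp add: dist_norm norm_minus_commute)
      then show "\<mu> \<in> F ` {y \<in> Z. \<rho> \<le> cmod (1 - y)}" using y by blast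
    qed
    moreover have "finite {y \<in> Z. \<rho> \<le> cmod (1 - y)}"
      using flat_factor_zeros(2)[OF pars(1,2,4,3) \<rho>(1)] by (simp add: Z_def)
    ultimately show ?thesis using finite_subset by blast
  qed
  then have "accumulation_set J = {complex_of_real \<nu>}"
    unfolding accumulation_set_def by (rule accumulation_unique[OF inf])
  then show ?thesis using J inf unfolding \<beta>_def by blast
qed

end
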